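(* Let $(k,D,\Delta)\in\mathbb{R}_+^3$. Suppose there exist random variables $U,V,Q,T$ taking values in finite sets $\mathcal U,\mathcal V,\mathcal Q,\mathcal T$ and a function $\hat A:\mathcal V\times\mathcal B\to\mathcal A$ such that: - the joint distribution factorizes as $p(u,v,q,t,a,b,e,x,y,z)=p(u|v)\,p(v|a)\,p(a,b,e)\,p(q|t)\,p(t|x)\,p(x)\,P(y,z|x)$, where $p(x)$ is an arbitrary input distribution; - the following four inequalities hold: \begin{align*} I(U;A|B)&\le k\,I(Q;Y),\\ I(V;A|B)&\le k\,I(T;Y),\\ D&\ge \mathbb{E}\big[d(A,\hat A(V,B))\big],\\ \Delta&\le H(A|U,E)-\Big[I(V;A|U,B)-k\big(I(T;Y|Q)-I(T;Z|Q)\big)\Big]_+ . \end{align*} Then $(k,D,\Delta)$ is achievable, i.e. $(k,D,\Delta)\in\mathcal R^*$.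
   Context: Setup (secure lossy source-channel wiretapping). Let $\mathcal A,\mathcal B,\mathcal E,\mathcal X,\mathcal Y,\mathcal Z$ be finite sets. Alice, Bob and Eve observe sequences $(A_i)_{i\ge1}$, $(B_i)_{i\ge1}$, $(E_i)_{i\ge1}$ with values in $\mathcal A,\mathcal B,\mathcal E$; the triples $(A_i,B_i,E_i)$ are i.i.d. across $i$ with a given joint distribution $p(a,b,e)$. Alice communicates with Bob and Eve over a discrete memoryless channel with input $X\in\mathcal X$, outputs $Y\in\mathcal Y$ (at Bob) and $Z\in\mathcal Z$ (at Eve), and transition probability $P(y,z|x)$. Let $d:\mathcal A\times\mathcal A\to[0,d_{\max}]$ with $d_{\max}<\infty$ be a distortion measure, extended to sequences by $d(a^n,b^n)=\frac1n\sum_{i=1}^n d(a_i,b_i)$. An $(n,m)$-code consists of a stochastic encoder given by a transition probability $P_{X^m|A^n}$ from $\mathcal A^n$ to $\mathcal X^m$, and a decoder $g:\mathcal Y^m\times\mathcal B^n\to\mathcal A^n$; the channel input is $X^m$ produced by the encoder from $A^n$ and $(Y^m,Z^m)$ is the memoryless channel output. A tuple $(k,D,\Delta)\in\mathbb{R}_+^3$ is achievable if for every $\varepsilon>0$ there is an $(n,m)$-code with $m/n\le k+\varepsilon$, $\mathbb{E}[d(A^n,g(Y^m,B^n))]\le D+\varepsilon$, and $\frac1n H(A^n|E^n,Z^m)\ge\Delta-\varepsilon$. The set of achievable tuples is denoted $\mathcal R^*$. In single-letter expressions, $(A,B,E)\sim p(a,b,e)$ and $(Y,Z)$ is the output of $P(y,z|x)$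 with input $X$. Notation: $[x]_+=\max(0,x)$. *)

theory Defs
  imports "HOL-Probability.Probability"
begin

definition ent :: "'a pmf \<Rightarrow> real" where
  "ent P = - (\<Sum>x\<in>set_pmf P. pmf P x * log 2 (pmf P x))"

definition cond_ent :: "'w pmf \<Rightarrow> ('w \<Rightarrow> 'a) \<Rightarrow> ('w \<Rightarrow> 'c) \<Rightarrow> real" where
  "cond_ent J X Y = ent (map_pmf (\<lambda>w. (X w, Y w)) J) - ent (map_pmf Y J)"

definition cmi :: "'w pmf \<Rightarrow> ('w \<Rightarrow> 'a) \<Rightarrow> ('w \<Rightarrow> 'b) \<Rightarrow> ('w \<Rightarrow> 'c) \<Rightarrow> real" where
  "cmi J X Y Z = cond_ent J X Z - cond_ent J X (\<lambda>w. (Y w, Z w))"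

definition mi :: "'w pmf \<Rightarrow> ('w \<Rightarrow> 'a) \<Rightarrow> ('w \<Rightarrow> 'b) \<Rightarrow> real" where
  "mi J X Y = cmi J X Y (\<lambda>_. ())"

fun iid_list :: "nat \<Rightarrow> 'a pmf \<Rightarrow> 'a list pmf" where
  "iid_list 0 p = return_pmf []"
| "iid_list (Suc n) p = bind_pmf p (\<lambda>x. bind_pmf (iid_list n p) (\<lambda>xs. return_pmf (x # xs)))"

fun chan_list :: "('x \<Rightarrow> ('y \<times> 'z) pmf) \<Rightarrow> 'x list \<Rightarrow> ('y list \<times> 'z list) pmf" where
  "chan_list W [] = return_pmf ([], [])"
| "chan_list W (x # xs) = bind_pmf (W x) (\<lambda>(y, z).
      bind_pmf (chan_list W xs) (\<lambda>(ys, zs). return_pmf (y # ys, z # zs)))"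

definition seq_dist :: "('a \<Rightarrow> 'a \<Rightarrow> real) \<Rightarrow> 'a list \<Rightarrow> 'a list \<Rightarrow> real" where
  "seq_dist d as bs = (\<Sum>i<length as. d (as ! i) (bs ! i)) / real (length as)"

definition valid_code :: "nat \<Rightarrow> nat \<Rightarrow> ('a list \<Rightarrow> 'x list pmf) \<Rightarrow> ('y list \<Rightarrow> 'b list \<Rightarrow> 'a list) \<Rightarrow> bool" where
  "valid_code n m enc g \<longleftrightarrow>
     (\<forall>as. length as = n \<longrightarrow> (\<forall>xs\<in>set_pmf (enc as). length xs = m)) \<and>
     (\<forall>ys bs. length ys = m \<longrightarrow> length bs = n \<longrightarrow> length (g ys bs) = n)"

definition code_joint :: "nat \<Rightarrow> ('a \<times> 'b \<times> 'e) pmf \<Rightarrow> ('x \<Rightarrow> ('y \<times> 'z) pmf) \<Rightarrow> ('a list \<Rightarrow> 'x list pmf)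
    \<Rightarrow> (('a \<times> 'b \<times> 'e) list \<times> 'x list \<times> ('y list \<times> 'z list)) pmf" where
  "code_joint n p W enc =
     bind_pmf (iid_list n p) (\<lambda>s. bind_pmf (enc (map fst s)) (\<lambda>xs.
       bind_pmf (chan_list W xs) (\<lambda>yz. return_pmf (s, xs, yz))))"

definition achievable :: "('a \<times> 'b \<times> 'e) pmf \<Rightarrow> ('x \<Rightarrow> ('y \<times> 'z) pmf) \<Rightarrow> ('a \<Rightarrow> 'a \<Rightarrow> real)
    \<Rightarrow> real \<Rightarrow> real \<Rightarrow> real \<Rightarrow> bool" where
  "achievable p W d k D \<Delta> \<longleftrightarrow>
    (\<forall>\<epsilon>>0. \<exists>n m (enc :: 'a list \<Rightarrow> 'x list pmf) (g :: 'y list \<Rightarrow> 'b list \<Rightarrow> 'a list).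
       n > 0 \<and> valid_code n m enc g \<and>
       real m / real n \<le> k + \<epsilon> \<and>
       measure_pmf.expectation (code_joint n p W enc)
         (\<lambda>(s, xs, ys, zs). seq_dist d (map fst s) (g ys (map (\<lambda>t. fst (snd t)) s))) \<le> D + \<epsilon> \<and>
       cond_ent (code_joint n p W enc) (\<lambda>(s, xs, ys, zs). map fst s)
         (\<lambda>(s, xs, ys, zs). (map (\<lambda>t. snd (snd t)) s, zs)) / real n \<ge> \<Delta> - \<epsilon>)"

definition sl_joint :: "('a \<times> 'b \<times> 'e) pmf \<Rightarrow> ('a \<Rightarrow> 'v pmf) \<Rightarrow> ('v \<Rightarrow> 'u pmf)
    \<Rightarrow> 'x pmf \<Rightarrow> ('x \<Rightarrow> 't pmf) \<Rightarrow> ('t \<Rightarrow> 'q pmf) \<Rightarrow> ('x \<Rightarrow> ('y \<times> 'z) pmf)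
    \<Rightarrow> (('u \<times> 'v \<times> 'a \<times> 'b \<times> 'e) \<times> ('q \<times> 't \<times> 'x \<times> 'y \<times> 'z)) pmf" where
  "sl_joint p pVA pUV px pTX pQT W =
     bind_pmf p (\<lambda>(a, b, e). bind_pmf (pVA a) (\<lambda>v. bind_pmf (pUV v) (\<lambda>u.
     bind_pmf px (\<lambda>x. bind_pmf (pTX x) (\<lambda>t. bind_pmf (pQT t) (\<lambda>q.
     bind_pmf (W x) (\<lambda>(y, z). return_pmf ((u, v, a, b, e), (q, t, x, y, z)))))))))"

end

theory Submission
  imports Defs
begin

text \<open>
  Random coding with two superposed layers and no binning. The outer layer consists of words
  (U(s), Q(s)), the inner one of words V(s,j) and T(s,j,\<kappa>), where \<kappa> is local randomness; the pair
  (s,j) describes the source word and T(s,j,\<kappa>) is sent through p(x|t). Bob looks for the pair (s,j) whose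
  words are likely together with both his channel output and his side information.

  The index (s,j) is drawn by the likelihood encoder, the posterior of the index in an idealised model
  where (s,j) is uniform and V(s,j) emits the source word. In that model the average over the codebook
  of every joint law is exactly i.i.d., and soft covering shows that the true source law is close to the
  idealised one once the rates exceed I(U;A) and I(V;A).

  For the equivocation, Eve is given s. Bounding H(E,Z,S) by a cross entropy yields
  H(A|E,Z) \<ge> H(A,E) - log |S| - n H(E|U) - L, up to o(n), where L is the average divergence between
  Eve's output given (s,j) and the law p(z|q). Averaging over \<kappa> and Jensen's inequality give
  L \<le> E log (1 + p(z|t) / (K p(z|q))) for K values of \<kappa>, that is max 0 (k I(T;Z|Q) - rate of \<kappa>)
  per source letter.

  Extra channel uses provide slack in the decoding constraints unless I(T;Y) = 0, a case in which no
  communication is needed.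
\<close>

section \<open>Expectations over finitely supported distributions\<close>

text \<open>Binning can be avoided because the source and channel codebooks are drawn independently
  but share the index (s,j): a wrong index passes the test on Bob's side information and the test on
  his channel output with a product of probabilities. The rates of s, j and \<kappa> together then
  only have to stay below I(V;B) + k I(T;Y), while covering asks for I(V;A) from s and j. Since V -
  A - B is a Markov chain, the gap I(V;A) - I(V;B) is I(V;A|B), the quantity in the second
  hypothesis.

  On Eve's side an outer rate I(U;A) gives H(A,E) - I(U;A) - H(E|U) = H(A|U,E), because U - A - E is
  a Markov chain. The bracket of the theorem is then accounted for by the outer rate in excess of
  I(U;A) together with the average divergence L.

  The coding argument is written for arbitrary finitely supported kernels, so that words of length n
  are just another alphabet. Typicality appears only where its thresholds are evaluated for
  words.\<close>

definition pexp :: "'a pmf \<Rightarrow> ('a \<Rightarrow> real) \<Rightarrow> real" where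
  "pexp p f = measure_pmf.expectation p f"

lemma pexp_eq_sum:
  assumes "finite A" "set_pmf p \<subseteq> A"
  shows "pexp p f = (\<Sum>x\<in>A. pmf p x * f x)"
  unfolding pexp_def using assms by (subst integral_measure_pmf[of A]) auto

lemma finite_set_bind_pmf [simp]:
  "finite (set_pmf p) \<Longrightarrow> (\<And>x. x \<in> set_pmf p \<Longrightarrow> finite (set_pmf (f x)))
    \<Longrightarrow> finite (set_pmf (bind_pmf p f))"
  by (simp add: set_bind_pmf)

lemma finite_set_map_pmf [simp]: "finite (set_pmf p) \<Longrightarrow> finite (set_pmf (map_pmf f p))"
  by simp

lemma pexp_return [simp]: "pexp (return_pmf x) f = f x"
  by (simp add: pexp_def)

lemma pexp_map [simp]: "pexp (map_pmf g p) f = pexp p (\<lambda>x. f (g x))"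
  by (simp add: pexp_def)

lemma pexp_bind:
  assumes "finite (set_pmf p)" "\<And>x. x \<in> set_pmf p \<Longrightarrow> finite (set_pmf (f x))"
  shows "pexp (bind_pmf p f) h = pexp p (\<lambda>x. pexp (f x) h)"
  unfolding pexp_def
  using assms by (subst pmf_expectation_bind[of "set_pmf p"]) (auto simp: integral_measure_pmf[of "set_pmf p"])

lemma pexp_const [simp]: "pexp p (\<lambda>_. c) = c"
  by (simp add: pexp_def)

lemma pexp_cong: "(\<And>x. x \<in> set_pmf p \<Longrightarrow> f x = g x) \<Longrightarrow> pexp p f = pexp p g"
  unfolding pexp_def by (intro integral_cong_AE) (auto simp: AE_measure_pmf_iff)

lemma pexp_add: "finite (set_pmf p) \<Longrightarrow> pexp p (\<lambda>x. f x + g x) = pexp p f + pexp p g"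
  by (simp add: pexp_def integrable_measure_pmf_finite)

lemma pexp_diff: "finite (set_pmf p) \<Longrightarrow> pexp p (\<lambda>x. f x - g x) = pexp p f - pexp p g"
  by (simp add: pexp_def integrable_measure_pmf_finite)

lemma pexp_minus: "pexp p (\<lambda>x. - f x) = - pexp p f"
  by (simp add: pexp_def)

lemma pexp_cmult: "pexp p (\<lambda>x. c * f x) = c * pexp p f"
  by (simp add: pexp_def)

lemma pexp_multc: "pexp p (\<lambda>x. f x * c) = pexp p f * c"
  by (simp add: pexp_def)

lemma pexp_divide: "pexp p (\<lambda>x. f x / c) = pexp p f / c"
  by (simp add: pexp_def)

lemma pexp_sum: "finite (set_pmf p) \<Longrightarrow> pexp p (\<lambda>x. \<Sum>i\<in>I. f i x) = (\<Sum>i\<in>I. pexp p (f i))"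
  unfolding pexp_def by (rule Bochner_Integration.integral_sum) (auto intro: integrable_measure_pmf_finite)

lemma pexp_mono:
  assumes "finite (set_pmf p)" "\<And>x. x \<in> set_pmf p \<Longrightarrow> f x \<le> g x"
  shows "pexp p f \<le> pexp p g"
  unfolding pexp_def using assms
  by (intro integral_mono_AE) (auto simp: AE_measure_pmf_iff integrable_measure_pmf_finite)

lemma pexp_nonneg: "(\<And>x. x \<in> set_pmf p \<Longrightarrow> 0 \<le> f x) \<Longrightarrow> 0 \<le> pexp p f"
  unfolding pexp_def by (intro integral_nonneg_AE) (auto simp: AE_measure_pmf_iff)

lemma pexp_le_const:
  "finite (set_pmf p) \<Longrightarrow> (\<And>x. x \<in> set_pmf p \<Longrightarrow> f x \<le> c) \<Longrightarrow> pexp p f \<le> c"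
  using pexp_mono[of p f "\<lambda>_. c"] by simp

lemma pexp_ge_const:
  "finite (set_pmf p) \<Longrightarrow> (\<And>x. x \<in> set_pmf p \<Longrightarrow> c \<le> f x) \<Longrightarrow> c \<le> pexp p f"
  using pexp_mono[of p "\<lambda>_. c" f] by simp

lemma pexp_commute:
  assumes "finite (set_pmf p)" "finite (set_pmf q)"
  shows "pexp p (\<lambda>x. pexp q (f x)) = pexp q (\<lambda>y. pexp p (\<lambda>x. f x y))"
  using assms sum.swap[of "\<lambda>x y. pmf p x * (pmf q y * f x y)" "set_pmf q" "set_pmf p"]
  by (simp add: pexp_eq_sum[of "set_pmf p" p] pexp_eq_sum[of "set_pmf q" q] sum_distrib_left
      algebra_simps)

text \<open>Passes from an average over codebooks to one codebook: the minimum over the support does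
  not exceed the mean.\<close>

lemma pexp_witness:
  assumes "finite (set_pmf p)" "pexp p f \<le> c"
  obtains x where "x \<in> set_pmf p" "f x \<le> c"
proof -
  have "\<exists>x\<in>set_pmf p. f x \<le> c"
  proof (rule ccontr)
    assume *: "\<not> ?thesis"
    define m where "m = Min (f ` set_pmf p)"
    have "m \<in> f ` set_pmf p"
      unfolding m_def using assms(1) by (intro Min_in) (auto simp: set_pmf_not_empty)
    hence "c < m" using * by auto
    moreover have "m \<le> pexp p f"
      using assms(1) by (intro pexp_ge_const) (auto simp: m_def)
    ultimately show False using assms(2) by simp
  qed
  thus ?thesis using that by blast
qed

lemma pexp_pmf_of_set:
  "finite S \<Longrightarrow> S \<noteq> {} \<Longrightarrow> pexp (pmf_of_set S) f = (\<Sum>x\<in>S. f x) / card S"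
  by (simp add: pexp_def integral_pmf_of_set)

lemma pmf_bind_pexp: "pmf (bind_pmf p k) y = pexp p (\<lambda>x. pmf (k x) y)"
  by (simp add: pexp_def pmf_bind)

lemma pexp_pmf_weight:
  assumes "finite (set_pmf p)"
  shows "pexp p f = (\<Sum>x\<in>set_pmf p. pmf p x * f x)"
  using assms by (intro pexp_eq_sum) auto

text \<open>Jensen through the tangent of the logarithm at the mean \<open>m\<close>: log x lies
  below log m + (x/m - 1)/ln 2, and the linear correction averages to 0.\<close>

lemma pexp_log_le:
  assumes "finite (set_pmf p)" "\<And>x. x \<in> set_pmf p \<Longrightarrow> 0 < f x"
  shows "pexp p (\<lambda>x. log 2 (f x)) \<le> log 2 (pexp p f)"
proof -
  define m where "m = pexp p f"
  have "0 < Min (f ` set_pmf p)"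
    using assms by (auto simp: set_pmf_not_empty)
  also have "\<dots> \<le> m"
    unfolding m_def using assms(1) by (intro pexp_ge_const) auto
  finally have m: "0 < m" .
  have "pexp p (\<lambda>x. log 2 (f x)) \<le> pexp p (\<lambda>x. log 2 m + (f x / m - 1) / ln 2)"
  proof (rule pexp_mono[OF assms(1)])
    fix x assume x: "x \<in> set_pmf p"
    have "ln (f x / m) \<le> f x / m - 1"
      using assms(2)[OF x] m by (intro ln_le_minus_one) auto
    thus "log 2 (f x) \<le> log 2 m + (f x / m - 1) / ln 2"
      using assms(2)[OF x] m by (simp add: log_def ln_div field_simps)
  qed
  also have "\<dots> = log 2 m"
    using m assms(1) by (simp add: pexp_add pexp_divide pexp_diff m_def[symmetric])
  finally show ?thesis by (simp add: m_def)
qed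

section \<open>Independent families, empirical means and random superposition codebooks\<close>

lemma finite_set_Pi_pmf [simp]:
  "finite A \<Longrightarrow> (\<And>x. x \<in> A \<Longrightarrow> finite (set_pmf (p x))) \<Longrightarrow> finite (set_pmf (Pi_pmf A d p))"
  by (simp add: set_Pi_pmf finite_PiE_dflt)

text \<open>Conditions on one member of an independent family; in the resolvability bound it
  separates the codeword that is sent from all others.\<close>

lemma pexp_Pi_split:
  assumes "finite A" "i \<in> A" "\<And>x. x \<in> A \<Longrightarrow> finite (set_pmf (p x))"
  shows "pexp (Pi_pmf A d p) F = pexp (p i) (\<lambda>x. pexp (Pi_pmf (A - {i}) d p) (\<lambda>f. F (f(i := x))))"
proof -
  have "Pi_pmf A d p = Pi_pmf (insert i (A - {i})) d p"
    using assms by (simp add: insert_absorb)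
  also have "\<dots> = bind_pmf (p i) (\<lambda>x. map_pmf (\<lambda>f. f(i := x)) (Pi_pmf (A - {i}) d p))"
    using assms by (subst Pi_pmf_insert') (auto simp: map_pmf_def)
  finally have eq: "Pi_pmf A d p = bind_pmf (p i) (\<lambda>x. map_pmf (\<lambda>f. f(i := x)) (Pi_pmf (A - {i}) d p))" .
  show ?thesis
    unfolding eq using assms
    by (subst pexp_bind) (auto intro!: finite_imageI finite_set_Pi_pmf)
qed

lemma pexp_Pi_single:
  assumes "finite A" "i \<in> A" "\<And>x. x \<in> A \<Longrightarrow> finite (set_pmf (p x))"
  shows "pexp (Pi_pmf A d p) (\<lambda>f. h (f i)) = pexp (p i) h"
  using assms by (subst pexp_Pi_split[of A i]) auto

lemma pexp_Pi_pair:
  assumes "finite A" "i \<in> A" "j \<in> A" "i \<noteq> j" "\<And>x. x \<in> A \<Longrightarrow> finite (set_pmf (p x))"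
  shows "pexp (Pi_pmf A d p) (\<lambda>f. h (f i) (f j)) = pexp (p i) (\<lambda>x. pexp (p j) (h x))"
  using assms by (subst pexp_Pi_split[of A i], auto intro!: pexp_cong) (subst pexp_Pi_single, auto)

text \<open>After expanding the square, pairs of distinct indices factor by independence and only
  the N diagonal pairs see the second moment, which therefore enters with a factor 1/N. This is how
  codebook size beats a likelihood ratio.\<close>

lemma pexp_Pi_mean_square_le:
  assumes fin: "finite (set_pmf p)" and N: "0 < N"
  shows "pexp (Pi_pmf {..<N} d (\<lambda>_. p)) (\<lambda>f. ((\<Sum>i<N. g (f i)) / real N)\<^sup>2)
    \<le> (pexp p g)\<^sup>2 + pexp p (\<lambda>x. (g x)\<^sup>2) / real N"
proof -
  let ?P = "Pi_pmf {..<N} d (\<lambda>_. p)"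
  have fP: "finite (set_pmf ?P)" using fin by simp
  have term_eq: "pexp ?P (\<lambda>f. g (f i) * g (f j)) = (if i = j then pexp p (\<lambda>x. (g x)\<^sup>2) else (pexp p g)\<^sup>2)"
    if "i < N" "j < N" for i j
  proof (cases "i = j")
    case True
    thus ?thesis using that fin pexp_Pi_single[of "{..<N}" i "\<lambda>_. p" d "\<lambda>x. g x * g x"]
      by (simp add: power2_eq_square)
  next
    case False
    thus ?thesis using that fin pexp_Pi_pair[of "{..<N}" i j "\<lambda>_. p" d "\<lambda>x y. g x * g y"]
      by (simp add: power2_eq_square pexp_cmult pexp_multc)
  qed
  have "pexp ?P (\<lambda>f. (\<Sum>i<N. g (f i))\<^sup>2) = (\<Sum>i<N. \<Sum>j<N. pexp ?P (\<lambda>f. g (f i) * g (f j)))"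
    by (simp add: power2_eq_square sum_product pexp_sum[OF fP])
  also have "\<dots> = (\<Sum>i<N. \<Sum>j<N. (if i = j then pexp p (\<lambda>x. (g x)\<^sup>2) else (pexp p g)\<^sup>2))"
    by (intro sum.cong refl) (auto simp: term_eq)
  \<comment> \<open>The square of the mean is added on the diagonal too, which replaces N(N-1) by
    N^2; being a square, it can only increase the sum.\<close>
  also have "\<dots> \<le> (\<Sum>i<N. \<Sum>j<N. ((if i = j then pexp p (\<lambda>x. (g x)\<^sup>2) else 0) + (pexp p g)\<^sup>2))"
    by (intro sum_mono) auto
  also have "\<dots> = real N * pexp p (\<lambda>x. (g x)\<^sup>2) + (real N)\<^sup>2 * (pexp p g)\<^sup>2"
    by (simp add: sum.distrib power2_eq_square algebra_simps)
  finally have "pexp ?P (\<lambda>f. (\<Sum>i<N. g (f i))\<^sup>2) / (real N)\<^sup>2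
      \<le> (real N * pexp p (\<lambda>x. (g x)\<^sup>2) + (real N)\<^sup>2 * (pexp p g)\<^sup>2) / (real N)\<^sup>2"
    by (intro divide_right_mono) auto
  also have "\<dots> = (pexp p g)\<^sup>2 + pexp p (\<lambda>x. (g x)\<^sup>2) / real N"
    using N by (simp add: field_simps power2_eq_square)
  finally show ?thesis by (simp add: power_divide pexp_divide)
qed

text \<open>Each of the N indices carries its own independent cloud centre u and M satellites drawn
  independently given u. The value \<open>undefined\<close> is only taken outside the index
  ranges.\<close>

definition superposition_code :: "nat \<Rightarrow> nat \<Rightarrow> 'u pmf \<Rightarrow> ('u \<Rightarrow> 'v pmf) \<Rightarrow> (nat \<Rightarrow> 'u \<times> (nat \<Rightarrow> 'v)) pmf" where
  "superposition_code N M p k = Pi_pmf {..<N} undefined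
     (\<lambda>_. bind_pmf p (\<lambda>u. map_pmf (Pair u) (Pi_pmf {..<M} undefined (\<lambda>_. k u))))"

context
  fixes N M :: nat and p :: "'u pmf" and k :: "'u \<Rightarrow> 'v pmf"
  assumes fin: "finite (set_pmf p)" "\<And>u. finite (set_pmf (k u))"
begin

lemma finite_superposition_code: "finite (set_pmf (superposition_code N M p k))"
  using fin by (simp add: superposition_code_def)

lemma superposition_code_single:
  assumes "s < N" "j < M"
  shows "pexp (superposition_code N M p k) (\<lambda>C. h (fst (C s)) (snd (C s) j)) = pexp p (\<lambda>u. pexp (k u) (h u))"
  unfolding superposition_code_def using assms fin
  by (subst pexp_Pi_single[where h = "\<lambda>x. h (fst x) (snd x j)"])
     (auto simp: pexp_bind intro!: pexp_cong pexp_Pi_single)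

text \<open>Satellites of one cloud are independent only given the common centre; a wrong inner word
  is therefore measured against the output law given u.\<close>

lemma superposition_code_same:
  assumes "s < N" "j < M" "j' < M" "j \<noteq> j'"
  shows "pexp (superposition_code N M p k) (\<lambda>C. h (fst (C s)) (snd (C s) j) (snd (C s) j'))
    = pexp p (\<lambda>u. pexp (k u) (\<lambda>v. pexp (k u) (h u v)))"
  unfolding superposition_code_def using assms fin
  by (subst pexp_Pi_single[where h = "\<lambda>x. h (fst x) (snd x j) (snd x j')"])
     (auto simp: pexp_bind intro!: pexp_cong pexp_Pi_pair)

text \<open>Satellites of different clouds are fully independent, so a wrong outer word is measured
  against the unconditional output law.\<close>

lemma superposition_code_diff:
  assumes "s < N" "s' < N" "s \<noteq> s'" "j < M" "j' < M"
  shows "pexp (superposition_code N M p k) (\<lambda>C. h (fst (C s)) (snd (C s) j) (fst (C s')) (snd (C s') j'))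
    = pexp p (\<lambda>u. pexp (k u) (\<lambda>v. pexp p (\<lambda>u'. pexp (k u') (h u v u'))))"
proof -
  let ?b = "bind_pmf p (\<lambda>u. map_pmf (Pair u) (Pi_pmf {..<M} undefined (\<lambda>_. k u)))"
  have *: "pexp ?b (\<lambda>x. f (fst x) (snd x i)) = pexp p (\<lambda>u. pexp (k u) (f u))" if "i < M" for f i
    using fin that by (auto simp: pexp_bind intro!: pexp_cong pexp_Pi_single)
  show ?thesis
    unfolding superposition_code_def using assms fin
    by (subst pexp_Pi_pair[where h = "\<lambda>x x'. h (fst x) (snd x j) (fst x') (snd x' j')"])
       (auto simp: * *[where f = "\<lambda>u v. pexp p (\<lambda>u'. pexp (k u') (h u v u'))"])
qed

end

section \<open>Soft covering and resolvability\<close>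

definition code_mixture :: "nat \<Rightarrow> nat \<Rightarrow> ('v \<Rightarrow> 'a pmf) \<Rightarrow> (nat \<Rightarrow> 'u \<times> (nat \<Rightarrow> 'v)) \<Rightarrow> 'a pmf" where
  "code_mixture N M k C = bind_pmf (pmf_of_set ({..<N} \<times> {..<M})) (\<lambda>(s, j). k (snd (C s) j))"

lemma pmf_code_mixture:
  assumes "0 < N" "0 < M"
  shows "pmf (code_mixture N M k C) a = (\<Sum>s<N. (\<Sum>j<M. pmf (k (snd (C s) j)) a) / real M) / real N"
proof -
  have "{..<N} \<times> {..<M} \<noteq> {}" using assms by auto
  thus ?thesis
    by (simp add: code_mixture_def pmf_bind_pexp pexp_pmf_of_set case_prod_unfold
        sum.cartesian_product' sum_divide_distrib mult.commute)
qed

lemma of_bool_not_eq: "of_bool (\<not> P) = (1 - of_bool P :: real)"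
  by simp

text \<open>Only the mass missing from the mixture is bounded, since this is what a change of
  measure pays for. Emissions are truncated to triples satisfying \<open>G\<close>, which costs the
  first term. The truncated mixture has a variance which, relative to the square of
  \<open>pmf pA a\<close>, is at most \<open>\<gamma>1 / N + \<gamma>2 / (N * M)\<close>, one
  summand for each layer: clouds fluctuate among N centres, satellites among all N * M
  words.\<close>

lemma soft_covering:
  fixes pU :: "'u pmf" and kV :: "'u \<Rightarrow> 'v pmf" and kA :: "'v \<Rightarrow> 'a pmf"
  assumes fin: "finite (set_pmf pU)" "\<And>u. finite (set_pmf (kV u))" "\<And>v. finite (set_pmf (kA v))"
    and N: "0 < N" and M: "0 < M" and \<gamma>: "0 \<le> \<gamma>1" "0 \<le> \<gamma>2" and \<eta>: "0 < \<eta>"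
    and pA: "pA = bind_pmf pU (\<lambda>u. bind_pmf (kV u) kA)"
    and G1: "\<And>u v a. u \<in> set_pmf pU \<Longrightarrow> v \<in> set_pmf (kV u) \<Longrightarrow> a \<in> set_pmf (kA v) \<Longrightarrow> G u v a \<Longrightarrow>
        pmf (bind_pmf (kV u) kA) a \<le> \<gamma>1 * pmf pA a"
    and G2: "\<And>u v a. u \<in> set_pmf pU \<Longrightarrow> v \<in> set_pmf (kV u) \<Longrightarrow> a \<in> set_pmf (kA v) \<Longrightarrow> G u v a \<Longrightarrow>
        pmf (kA v) a \<le> \<gamma>2 * pmf pA a"
  shows "pexp (superposition_code N M pU kV)
      (\<lambda>C. \<Sum>a\<in>set_pmf pA. max 0 (pmf pA a - pmf (code_mixture N M kA C) a))
    \<le> pexp pU (\<lambda>u. pexp (kV u) (\<lambda>v. pexp (kA v) (\<lambda>a. of_bool (\<not> G u v a)))) + \<eta>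
       + (\<gamma>1 / real N + \<gamma>2 / (real N * real M)) / \<eta>"
proof -
  let ?S = "superposition_code N M pU kV"
  let ?K = "\<gamma>1 / real N + \<gamma>2 / (real N * real M)"
  have finA: "finite (set_pmf pA)" using fin by (simp add: pA)
  have finS: "finite (set_pmf ?S)" using fin by (intro finite_superposition_code)
  define g where "g a u v = pmf (kA v) a * of_bool (G u v a)" for a u v
  define m where "m a = pexp pU (\<lambda>u. pexp (kV u) (g a u))" for a
  have g0: "0 \<le> g a u v" for a u v by (simp add: g_def)
  have pA_pexp: "pmf pA a = pexp pU (\<lambda>u. pexp (kV u) (\<lambda>v. pmf (kA v) a))" for a
    by (simp add: pA pmf_bind_pexp)
  have m_le: "m a \<le> pmf pA a" for a
    unfolding m_def pA_pexp using fin by (intro pexp_mono) (auto simp: g_def)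
  have letter: "pexp ?S (\<lambda>C. max 0 (pmf pA a - pmf (code_mixture N M kA C) a))
      \<le> (pmf pA a - m a) + \<eta> * pmf pA a + pmf pA a * ?K / \<eta>" if a: "a \<in> set_pmf pA" for a
  proof -
    define P where "P = pmf pA a"
    have P: "0 < P" using a by (simp add: P_def pmf_positive)
    \<comment> \<open>\<open>X\<close> is the contribution of one cloud and \<open>Y\<close> the
      mean over the N independent clouds, so the mean-square bound is applied twice: to the
      satellites given their centre, then to the clouds.\<close>
    define X where "X x = (\<Sum>j<M. g a (fst x) (snd x j)) / real M" for x :: "'u \<times> (nat \<Rightarrow> 'v)"
    define Y where "Y C = (\<Sum>s<N. X (C s)) / real N" for C :: "nat \<Rightarrow> 'u \<times> (nat \<Rightarrow> 'v)"
    let ?b = "bind_pmf pU (\<lambda>u. map_pmf (Pair u) (Pi_pmf {..<M} undefined (\<lambda>_. kV u)))"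
    have finb: "finite (set_pmf ?b)" using fin by simp
    have EY: "pexp ?S Y = m a"
    proof -
      have "pexp ?S Y = (\<Sum>s<N. (\<Sum>j<M. pexp ?S (\<lambda>C. g a (fst (C s)) (snd (C s) j))) / real M) / real N"
        unfolding Y_def[abs_def] X_def by (simp add: pexp_divide pexp_sum[OF finS])
      also have "\<dots> = (\<Sum>s<N. (\<Sum>j<M. m a) / real M) / real N"
        unfolding m_def by (intro arg_cong2[of _ _ _ _ "(/)"] sum.cong refl
            superposition_code_single[OF fin(1,2), where h = "g a"]) auto
      finally show ?thesis using N M by simp
    qed
    have EX: "pexp ?b X = m a"
    proof -
      have "pexp ?b X = pexp pU (\<lambda>u. (\<Sum>j<M. pexp (Pi_pmf {..<M} undefined (\<lambda>_. kV u)) (\<lambda>f. g a u (f j))) / real M)"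
        using fin by (simp add: pexp_bind X_def pexp_divide pexp_sum)
      also have "\<dots> = pexp pU (\<lambda>u. (\<Sum>j<M. pexp (kV u) (g a u)) / real M)"
        using fin by (intro pexp_cong arg_cong2[of _ _ _ _ "(/)"] sum.cong refl pexp_Pi_single) auto
      also have "\<dots> = m a"
        using M by (simp add: m_def)
      finally show ?thesis .
    qed
    have EX2: "pexp ?b (\<lambda>x. (X x)\<^sup>2) \<le> P\<^sup>2 * (\<gamma>1 + \<gamma>2 / real M)"
    proof -
      have "pexp ?b (\<lambda>x. (X x)\<^sup>2)
          = pexp pU (\<lambda>u. pexp (Pi_pmf {..<M} undefined (\<lambda>_. kV u)) (\<lambda>f. ((\<Sum>j<M. g a u (f j)) / real M)\<^sup>2))"
        using fin by (simp add: pexp_bind X_def)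
      also have "\<dots> \<le> pexp pU (\<lambda>u. (pexp (kV u) (g a u))\<^sup>2 + pexp (kV u) (\<lambda>v. (g a u v)\<^sup>2) / real M)"
        using fin M by (intro pexp_mono pexp_Pi_mean_square_le)
      also have "\<dots> \<le> pexp pU (\<lambda>u. pexp (kV u) (\<lambda>v. pmf (kA v) a) * (\<gamma>1 * P)
          + pexp (kV u) (\<lambda>v. \<gamma>2 * P * pmf (kA v) a) / real M)"
      proof (rule pexp_mono[OF fin(1)], intro add_mono divide_right_mono)
        fix u assume u: "u \<in> set_pmf pU"
        have le1: "pexp (kV u) (g a u) \<le> pexp (kV u) (\<lambda>v. pmf (kA v) a)"
          using fin by (intro pexp_mono) (auto simp: g_def)
        \<comment> \<open>The bound provided by \<open>G1\<close> does not involve v, so one good v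
          in the support is enough; without any, the truncated weight is 0.\<close>
        have le2: "pexp (kV u) (g a u) \<le> \<gamma>1 * P"
        proof (cases "\<exists>v\<in>set_pmf (kV u). a \<in> set_pmf (kA v) \<and> G u v a")
          case True
          hence "pmf (bind_pmf (kV u) kA) a \<le> \<gamma>1 * P"
            using G1 u by (auto simp: P_def)
          thus ?thesis using le1 by (simp add: pmf_bind_pexp)
        next
          case False
          hence "pexp (kV u) (g a u) = pexp (kV u) (\<lambda>_. 0)"
            by (intro pexp_cong) (auto simp: g_def set_pmf_iff)
          thus ?thesis using P \<gamma> by simp
        qed
        show "(pexp (kV u) (g a u))\<^sup>2 \<le> pexp (kV u) (\<lambda>v. pmf (kA v) a) * (\<gamma>1 * P)"
          unfolding power2_eq_square using le1 le2 P \<gamma>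
          by (intro mult_mono) (auto intro!: pexp_nonneg g0)
        show "pexp (kV u) (\<lambda>v. (g a u v)\<^sup>2) \<le> pexp (kV u) (\<lambda>v. \<gamma>2 * P * pmf (kA v) a)"
        proof (intro pexp_mono fin(2))
          fix v assume v: "v \<in> set_pmf (kV u)"
          show "(g a u v)\<^sup>2 \<le> \<gamma>2 * P * pmf (kA v) a"
          proof (cases "a \<in> set_pmf (kA v) \<and> G u v a")
            case True
            thus ?thesis using G2[OF u v] unfolding g_def power2_eq_square P_def
              by (auto intro!: mult_right_mono)
          next
            case False
            thus ?thesis using P \<gamma> by (auto simp: g_def set_pmf_iff)
          qed
        qed
      qed simp_all
      also have "\<dots> = P\<^sup>2 * (\<gamma>1 + \<gamma>2 / real M)"
        using fin by (simp add: pexp_add pexp_multc pexp_cmult pexp_divide pA_pexp[symmetric] P_def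
            power2_eq_square field_simps)
      finally show ?thesis .
    qed
    have "pexp ?S (\<lambda>C. (Y C)\<^sup>2) \<le> (pexp ?b X)\<^sup>2 + pexp ?b (\<lambda>x. (X x)\<^sup>2) / real N"
      unfolding Y_def superposition_code_def using finb N by (rule pexp_Pi_mean_square_le)
    also have "\<dots> \<le> (m a)\<^sup>2 + P\<^sup>2 * (\<gamma>1 + \<gamma>2 / real M) / real N"
      unfolding EX using EX2 by (intro add_mono divide_right_mono) auto
    finally have EY2: "pexp ?S (\<lambda>C. (Y C)\<^sup>2) - (m a)\<^sup>2 \<le> P\<^sup>2 * ?K"
      using N M by (simp add: field_simps)
    have var: "pexp ?S (\<lambda>C. (m a - Y C)\<^sup>2) = pexp ?S (\<lambda>C. (Y C)\<^sup>2) - (m a)\<^sup>2"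
    proof -
      have "pexp ?S (\<lambda>C. (m a - Y C)\<^sup>2) = pexp ?S (\<lambda>C. (m a)\<^sup>2 - 2 * m a * Y C + (Y C)\<^sup>2)"
        by (simp add: power2_diff algebra_simps)
      also have "\<dots> = (m a)\<^sup>2 - 2 * m a * m a + pexp ?S (\<lambda>C. (Y C)\<^sup>2)"
        by (simp add: pexp_add pexp_diff finS pexp_cmult EY)
      finally show ?thesis by (simp add: power2_eq_square)
    qed
    have "pexp ?S (\<lambda>C. max 0 (pmf pA a - pmf (code_mixture N M kA C) a))
        \<le> pexp ?S (\<lambda>C. (P - m a) + \<eta> * P + (m a - Y C)\<^sup>2 / (\<eta> * P))"
    proof (intro pexp_mono finS)
      fix C
      have "Y C \<le> pmf (code_mixture N M kA C) a"
        unfolding pmf_code_mixture[OF N M] Y_def X_def g_def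
        by (intro divide_right_mono sum_mono) (auto simp: mult_left_le)
      \<comment> \<open>The inequality x \<le> c + x^2/c for c > 0, in place of Cauchy-Schwarz: the
        variance enters linearly, without a square root, and \<eta> remains free to be
        balanced.\<close>
      moreover have "m a - Y C \<le> \<eta> * P + (m a - Y C)\<^sup>2 / (\<eta> * P)"
      proof (cases "m a - Y C \<le> \<eta> * P")
        case True
        thus ?thesis using P \<eta> by (smt (verit) divide_nonneg_pos mult_pos_pos zero_le_power2)
      next
        case False
        moreover have "0 < \<eta> * P" using P \<eta> by simp
        ultimately have "(m a - Y C) * (\<eta> * P) \<le> (m a - Y C)\<^sup>2"
          unfolding power2_eq_square by (intro mult_left_mono) auto
        hence "m a - Y C \<le> (m a - Y C)\<^sup>2 / (\<eta> * P)"
          using \<open>0 < \<eta> * P\<close> by (simp add: pos_le_divide_eq)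
        thus ?thesis using \<open>0 < \<eta> * P\<close> by simp
      qed
      moreover have "0 \<le> (P - m a) + \<eta> * P + (m a - Y C)\<^sup>2 / (\<eta> * P)"
        using m_le[of a] P \<eta> by (auto simp: P_def intro!: add_nonneg_nonneg)
      ultimately show "max 0 (pmf pA a - pmf (code_mixture N M kA C) a)
          \<le> (P - m a) + \<eta> * P + (m a - Y C)\<^sup>2 / (\<eta> * P)"
        by (simp add: P_def)
    qed
    also have "\<dots> = (P - m a) + \<eta> * P + (pexp ?S (\<lambda>C. (Y C)\<^sup>2) - (m a)\<^sup>2) / (\<eta> * P)"
      by (simp add: pexp_add finS pexp_divide var)
    also have "\<dots> \<le> (P - m a) + \<eta> * P + P\<^sup>2 * ?K / (\<eta> * P)"
      using EY2 P \<eta> by (intro add_left_mono divide_right_mono) auto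
    also have "P\<^sup>2 * ?K / (\<eta> * P) = P * ?K / \<eta>"
      using P by (simp add: power2_eq_square)
    finally show ?thesis by (simp add: P_def)
  qed
  \<comment> \<open>Summed over a, the truncated mass is the probability that \<open>G\<close>
    fails.\<close>
  have miss: "(\<Sum>a\<in>set_pmf pA. pmf pA a - m a)
      = pexp pU (\<lambda>u. pexp (kV u) (\<lambda>v. pexp (kA v) (\<lambda>a. of_bool (\<not> G u v a))))"
  proof -
    have "(\<Sum>a\<in>set_pmf pA. pmf pA a - m a)
        = (\<Sum>a\<in>set_pmf pA. pexp pU (\<lambda>u. pexp (kV u) (\<lambda>v. pmf (kA v) a * of_bool (\<not> G u v a))))"
      unfolding m_def pA_pexp of_bool_not_eq using fin
      by (simp add: pexp_diff[symmetric] g_def right_diff_distrib)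
    also have "\<dots> = pexp pU (\<lambda>u. pexp (kV u) (\<lambda>v. \<Sum>a\<in>set_pmf pA. pmf (kA v) a * of_bool (\<not> G u v a)))"
      using fin by (simp add: pexp_sum)
    also have "\<dots> = pexp pU (\<lambda>u. pexp (kV u) (\<lambda>v. pexp (kA v) (\<lambda>a. of_bool (\<not> G u v a))))"
      using finA by (intro pexp_cong pexp_eq_sum[symmetric]) (auto simp: pA)
    finally show ?thesis .
  qed
  have one: "(\<Sum>a\<in>set_pmf pA. pmf pA a) = 1"
    using finA by (intro sum_pmf_eq_1) auto
  have "pexp ?S (\<lambda>C. \<Sum>a\<in>set_pmf pA. max 0 (pmf pA a - pmf (code_mixture N M kA C) a))
      = (\<Sum>a\<in>set_pmf pA. pexp ?S (\<lambda>C. max 0 (pmf pA a - pmf (code_mixture N M kA C) a)))"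
    by (rule pexp_sum[OF finS])
  also have "\<dots> \<le> (\<Sum>a\<in>set_pmf pA. (pmf pA a - m a) + \<eta> * pmf pA a + pmf pA a * ?K / \<eta>)"
    by (intro sum_mono letter)
  also have "\<dots> = (\<Sum>a\<in>set_pmf pA. pmf pA a - m a) + \<eta> * (\<Sum>a\<in>set_pmf pA. pmf pA a)
      + (\<Sum>a\<in>set_pmf pA. pmf pA a) * ?K / \<eta>"
    by (simp only: sum.distrib sum_distrib_left sum_distrib_right sum_divide_distrib)
  finally show ?thesis by (simp only: miss one mult_1_right mult_1_left)
qed

text \<open>Fix the codeword t that is sent. Its own share of the mixture is
  \<open>pmf (W t) z / N\<close>; the other N - 1 words are independent of it and each has mean
  \<open>pmf r z\<close>. Jensen over those others puts this mean inside the logarithm.\<close>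

lemma resolvability_divergence:
  fixes p :: "'t pmf" and W :: "'t \<Rightarrow> 'z pmf"
  assumes fin: "finite (set_pmf p)" "\<And>t. finite (set_pmf (W t))" and N: "0 < N"
    and r: "r = bind_pmf p W"
    and \<zeta>: "\<And>C. \<zeta> C = bind_pmf (pmf_of_set {..<N}) (\<lambda>\<kappa>. W (C \<kappa>))"
  shows "pexp (Pi_pmf {..<N} d (\<lambda>_. p)) (\<lambda>C. pexp (\<zeta> C) (\<lambda>z. log 2 (pmf (\<zeta> C) z / pmf r z)))
    \<le> pexp p (\<lambda>t. pexp (W t) (\<lambda>z. log 2 (1 + pmf (W t) z / (real N * pmf r z))))"
proof -
  let ?P = "Pi_pmf {..<N} d (\<lambda>_. p)"
  have ne: "{..<N} \<noteq> {}" using N by auto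
  have finP: "finite (set_pmf ?P)" using fin by simp
  have pmf\<zeta>: "pmf (\<zeta> C) z = (\<Sum>\<kappa><N. pmf (W (C \<kappa>)) z) / real N" for C z
    using N ne by (simp add: \<zeta> pmf_bind_pexp pexp_pmf_of_set)
  define B where "B = pexp p (\<lambda>t. pexp (W t) (\<lambda>z. log 2 (1 + pmf (W t) z / (real N * pmf r z))))"
  have codeword: "pexp ?P (\<lambda>C. pexp (W (C \<kappa>)) (\<lambda>z. log 2 (pmf (\<zeta> C) z / pmf r z))) \<le> B" if \<kappa>: "\<kappa> < N" for \<kappa>
  proof -
    let ?P' = "Pi_pmf ({..<N} - {\<kappa>}) d (\<lambda>_. p)"
    have finP': "finite (set_pmf ?P')" using fin by simp
    have "pexp ?P (\<lambda>C. pexp (W (C \<kappa>)) (\<lambda>z. log 2 (pmf (\<zeta> C) z / pmf r z)))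
        = pexp p (\<lambda>t. pexp ?P' (\<lambda>C. pexp (W t) (\<lambda>z. log 2 (pmf (\<zeta> (C(\<kappa> := t))) z / pmf r z))))"
      using \<kappa> fin by (subst pexp_Pi_split[of "{..<N}" \<kappa>]) auto
    \<comment> \<open>The average over the other codewords is moved inside the one over z, so that
      Jensen acts on it alone.\<close>
    also have "\<dots> = pexp p (\<lambda>t. pexp (W t) (\<lambda>z. pexp ?P' (\<lambda>C. log 2 (pmf (\<zeta> (C(\<kappa> := t))) z / pmf r z))))"
      using fin finP' by (intro pexp_cong pexp_commute) auto
    also have "\<dots> \<le> B"
      unfolding B_def
    proof (intro pexp_mono fin)
      fix t z assume t: "t \<in> set_pmf p" and z: "z \<in> set_pmf (W t)"
      have rz: "0 < pmf r z" using t z by (auto simp: r intro!: pmf_positive)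
      have Wz: "0 < pmf (W t) z" using z by (rule pmf_positive)
      have expand: "pmf (\<zeta> (C(\<kappa> := t))) z = (pmf (W t) z + (\<Sum>i\<in>{..<N} - {\<kappa>}. pmf (W (C i)) z)) / real N" for C
        unfolding pmf\<zeta> using \<kappa> by (subst sum.remove[of _ \<kappa>]) (auto intro!: arg_cong2[of _ _ _ _ "(/)"] sum.cong)
      have pos: "0 < pmf (\<zeta> (C(\<kappa> := t))) z / pmf r z" for C
        unfolding expand using rz Wz N by (intro divide_pos_pos add_pos_nonneg sum_nonneg) auto
      have "pexp ?P' (\<lambda>C. log 2 (pmf (\<zeta> (C(\<kappa> := t))) z / pmf r z))
          \<le> log 2 (pexp ?P' (\<lambda>C. pmf (\<zeta> (C(\<kappa> := t))) z / pmf r z))"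
        by (intro pexp_log_le finP' pos)
      also have "pexp ?P' (\<lambda>C. pmf (\<zeta> (C(\<kappa> := t))) z / pmf r z)
          = (pmf (W t) z + (\<Sum>i\<in>{..<N} - {\<kappa>}. pexp ?P' (\<lambda>C. pmf (W (C i)) z))) / real N / pmf r z"
        unfolding expand by (simp add: pexp_divide pexp_add finP' pexp_sum)
      also have "(\<Sum>i\<in>{..<N} - {\<kappa>}. pexp ?P' (\<lambda>C. pmf (W (C i)) z)) = (\<Sum>i\<in>{..<N} - {\<kappa>}. pmf r z)"
        using fin by (intro sum.cong refl) (simp add: pexp_Pi_single[where h = "\<lambda>t. pmf (W t) z"] r pmf_bind_pexp)
      also have "\<dots> = (real N - 1) * pmf r z"
        using \<kappa> by (simp add: of_nat_diff)
      \<comment> \<open>Here (N - 1)/N is bounded by 1.\<close>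
      also have "log 2 ((pmf (W t) z + (real N - 1) * pmf r z) / real N / pmf r z)
          \<le> log 2 (1 + pmf (W t) z / (real N * pmf r z))"
      proof -
        have "0 < (pmf (W t) z + (real N - 1) * pmf r z) / real N / pmf r z"
          using rz Wz N by (intro divide_pos_pos add_pos_nonneg mult_nonneg_nonneg) auto
        moreover have "(pmf (W t) z + (real N - 1) * pmf r z) / real N / pmf r z
            \<le> 1 + pmf (W t) z / (real N * pmf r z)"
          using rz N by (simp add: field_simps)
        ultimately show ?thesis by simp
      qed
      finally show "pexp ?P' (\<lambda>C. log 2 (pmf (\<zeta> (C(\<kappa> := t))) z / pmf r z))
          \<le> log 2 (1 + pmf (W t) z / (real N * pmf r z))" .
    qed
    finally show ?thesis .
  qed
  have "pexp ?P (\<lambda>C. pexp (\<zeta> C) (\<lambda>z. log 2 (pmf (\<zeta> C) z / pmf r z)))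
      = pexp ?P (\<lambda>C. (\<Sum>\<kappa><N. pexp (W (C \<kappa>)) (\<lambda>z. log 2 (pmf (\<zeta> C) z / pmf r z))) / real N)"
    by (rule pexp_cong, subst (1) \<zeta>, subst pexp_bind) (use fin N ne in \<open>auto simp: pexp_pmf_of_set\<close>)
  also have "\<dots> = (\<Sum>\<kappa><N. pexp ?P (\<lambda>C. pexp (W (C \<kappa>)) (\<lambda>z. log 2 (pmf (\<zeta> C) z / pmf r z)))) / real N"
    by (simp add: pexp_divide pexp_sum finP)
  also have "\<dots> \<le> (\<Sum>\<kappa><N. B) / real N"
    by (intro divide_right_mono sum_mono codeword) auto
  finally show ?thesis using N by (simp add: B_def)
qed

section \<open>Entropy\<close>

lemma ent_pexp: "finite (set_pmf P) \<Longrightarrow> ent P = - pexp P (\<lambda>x. log 2 (pmf P x))"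
  by (simp add: ent_def pexp_eq_sum[of "set_pmf P"])

lemma ent_map_pexp:
  "finite (set_pmf J) \<Longrightarrow> ent (map_pmf X J) = - pexp J (\<lambda>w. log 2 (pmf (map_pmf X J) (X w)))"
  by (simp add: ent_pexp)

lemma pmf_map_self_pos: "w \<in> set_pmf J \<Longrightarrow> 0 < pmf (map_pmf X J) (X w)"
  by (rule pmf_positive) simp

text \<open>Entropy depends only on the partition into level sets. This allows tuples to be
  reordered and trivial components to be dropped.\<close>

lemma ent_map_eq:
  assumes "finite (set_pmf J)" "\<And>w w'. X w = X w' \<longleftrightarrow> X' w = X' w'"
  shows "ent (map_pmf X J) = ent (map_pmf X' J)"
proof -
  have "X -` {X w} = X' -` {X' w}" for w
  proof (rule set_eqI)
    show "y \<in> X -` {X w} \<longleftrightarrow> y \<in> X' -` {X' w}" for y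
      unfolding vimage_singleton_eq by (rule assms(2))
  qed
  thus ?thesis using assms(1) by (simp add: ent_map_pexp pmf_map)
qed

lemma ent_map_mono:
  assumes "finite (set_pmf J)" "\<And>w w'. X' w = X' w' \<Longrightarrow> X w = X w'"
  shows "ent (map_pmf X J) \<le> ent (map_pmf X' J)"
proof -
  have "pexp J (\<lambda>w. log 2 (pmf (map_pmf X' J) (X' w))) \<le> pexp J (\<lambda>w. log 2 (pmf (map_pmf X J) (X w)))"
  proof (rule pexp_mono[OF assms(1)])
    fix w assume w: "w \<in> set_pmf J"
    have "pmf (map_pmf X' J) (X' w) \<le> pmf (map_pmf X J) (X w)"
      unfolding pmf_map
    proof (rule measure_pmf.finite_measure_mono)
      show "X' -` {X' w} \<subseteq> X -` {X w}"
      proof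
        show "y \<in> X -` {X w}" if "y \<in> X' -` {X' w}" for y
          using that unfolding vimage_singleton_eq by (rule assms(2))
      qed
    qed simp
    thus "log 2 (pmf (map_pmf X' J) (X' w)) \<le> log 2 (pmf (map_pmf X J) (X w))"
      using pmf_map_self_pos[OF w, of X'] by simp
  qed
  thus ?thesis using assms(1) by (simp add: ent_map_pexp)
qed

text \<open>Stated for a positive weight of mass at most 1 instead of a distribution, because the
  equivocation bound compares with a weight assembled from several factors.\<close>

lemma gibbs:
  assumes fin: "finite (set_pmf P)" and Q: "\<And>x. x \<in> set_pmf P \<Longrightarrow> 0 < Q x" "(\<Sum>x\<in>set_pmf P. Q x) \<le> 1"
  shows "0 \<le> pexp P (\<lambda>x. log 2 (pmf P x / Q x))"
proof -
  have P: "0 < pmf P x" if "x \<in> set_pmf P" for x using that by (rule pmf_positive)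
  have "pexp P (\<lambda>x. Q x / pmf P x) = (\<Sum>x\<in>set_pmf P. Q x)"
    unfolding pexp_pmf_weight[OF fin] using P by (intro sum.cong refl) (simp add: order_less_imp_not_eq2)
  moreover have "0 < (\<Sum>x\<in>set_pmf P. Q x)"
    using fin Q by (intro sum_pos) (auto simp: set_pmf_not_empty)
  ultimately have "log 2 (pexp P (\<lambda>x. Q x / pmf P x)) \<le> 0" using Q by simp
  moreover have "pexp P (\<lambda>x. log 2 (Q x / pmf P x)) \<le> log 2 (pexp P (\<lambda>x. Q x / pmf P x))"
    using P Q by (intro pexp_log_le fin) simp
  ultimately have "pexp P (\<lambda>x. log 2 (Q x / pmf P x)) \<le> 0" by linarith
  moreover have "pexp P (\<lambda>x. log 2 (Q x / pmf P x)) = - pexp P (\<lambda>x. log 2 (pmf P x / Q x))"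
    unfolding pexp_minus[symmetric] using P Q by (intro pexp_cong) (simp add: log_divide_pos)
  ultimately show ?thesis by simp
qed

lemma gibbs_pmf:
  assumes fin: "finite (set_pmf P)" and sub: "set_pmf P \<subseteq> set_pmf Q"
  shows "0 \<le> pexp P (\<lambda>x. log 2 (pmf P x / pmf Q x))"
proof (rule gibbs[OF fin])
  show "0 < pmf Q x" if "x \<in> set_pmf P" for x using that sub by (auto intro: pmf_positive)
  have "(\<Sum>x\<in>set_pmf P. pmf Q x) = measure_pmf.prob Q (set_pmf P)"
    using fin by (simp add: measure_measure_pmf_finite)
  thus "(\<Sum>x\<in>set_pmf P. pmf Q x) \<le> 1" by simp
qed

text \<open>The equality case: ln x \<le> x - 1 is strict except at x = 1, so zero divergence forces
  equal masses on the support of \<open>P\<close>.\<close>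

lemma gibbs_pmf_eq:
  assumes fin: "finite (set_pmf P)" and sub: "set_pmf P \<subseteq> set_pmf Q"
    and zero: "pexp P (\<lambda>x. log 2 (pmf P x / pmf Q x)) = 0"
  shows "P = Q"
proof -
  have P: "0 < pmf P x" if "x \<in> set_pmf P" for x using that by (rule pmf_positive)
  have Q: "0 < pmf Q x" if "x \<in> set_pmf P" for x using that sub by (auto intro: pmf_positive)
  \<comment> \<open>The gap in ln x \<le> x - 1 at the ratio of the two masses; it is nonnegative
    and its mean turns out to be at most 0.\<close>
  define h where "h x = pmf Q x / pmf P x - 1 - ln (pmf Q x / pmf P x)" for x
  have h0: "0 \<le> h x" if "x \<in> set_pmf P" for x
    unfolding h_def using ln_le_minus_one[of "pmf Q x / pmf P x"] P[OF that] Q[OF that] by simp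
  have "pexp P (\<lambda>x. pmf Q x / pmf P x) = (\<Sum>x\<in>set_pmf P. pmf Q x)"
    unfolding pexp_pmf_weight[OF fin] using P by (intro sum.cong refl) (simp add: order_less_imp_not_eq2)
  also have "\<dots> = measure_pmf.prob Q (set_pmf P)"
    using fin by (simp add: measure_measure_pmf_finite)
  finally have "pexp P (\<lambda>x. pmf Q x / pmf P x) \<le> 1" by simp
  moreover have "pexp P (\<lambda>x. ln (pmf Q x / pmf P x)) = - ln 2 * pexp P (\<lambda>x. log 2 (pmf P x / pmf Q x))"
    unfolding pexp_cmult[symmetric] using P Q by (intro pexp_cong) (simp add: log_def ln_div)
  ultimately have "pexp P h \<le> 0"
    unfolding h_def by (simp add: pexp_diff fin zero)
  hence "(\<Sum>x\<in>set_pmf P. pmf P x * h x) = 0"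
    unfolding pexp_pmf_weight[OF fin] using h0 by (intro antisym sum_nonneg) auto
  hence hz: "h x = 0" if "x \<in> set_pmf P" for x
  proof -
    have "pmf P x * h x = 0"
      using \<open>(\<Sum>x\<in>set_pmf P. pmf P x * h x) = 0\<close> fin h0 that
      by (subst (asm) sum_nonneg_eq_0_iff) auto
    thus ?thesis using P[OF that] by simp
  qed
  have eq: "pmf Q x = pmf P x" if "x \<in> set_pmf P" for x
  proof -
    have "pmf Q x / pmf P x = 1"
      using hz[OF that] P[OF that] Q[OF that] by (intro ln_eq_minus_one) (auto simp: h_def)
    thus ?thesis using P[OF that] by simp
  qed
  \<comment> \<open>Two different distributions cannot be ordered pointwise, so \<open>Q\<close>
    would be smaller at some point, and that point lies in the support of \<open>P\<close>.\<close>
  show ?thesis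
  proof (rule ccontr)
    assume "P \<noteq> Q"
    then obtain x where "pmf Q x < pmf P x" using pmf_neq_exists_less[of Q P] by auto
    moreover from this have "x \<in> set_pmf P" by (smt (verit) pmf_nonneg set_pmf_iff)
    ultimately show False using eq by simp
  qed
qed

text \<open>Off the support of the first marginal the second marginal serves as default. All
  conditionals then stay inside the second projection of the support of \<open>P\<close>, so
  finiteness, and later the index range of the encoder, hold for every argument.\<close>

definition cond_kernel :: "('x \<times> 'y) pmf \<Rightarrow> 'x \<Rightarrow> 'y pmf" where
  "cond_kernel P x = (if x \<in> fst ` set_pmf P then map_pmf snd (cond_pmf P {w. fst w = x}) else map_pmf snd P)"

lemma pmf_cond_kernel: "pmf (map_pmf fst P) x * pmf (cond_kernel P x) y = pmf P (x, y)"
proof (cases "x \<in> fst ` set_pmf P")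
  case True
  hence ne: "set_pmf P \<inter> {w. fst w = x} \<noteq> {}" by auto
  have "pmf (cond_kernel P x) y = measure_pmf.prob (cond_pmf P {w. fst w = x}) (snd -` {y})"
    using True by (simp add: cond_kernel_def pmf_map)
  also have "\<dots> = measure_pmf.prob (cond_pmf P {w. fst w = x}) {(x, y)}"
    using set_cond_pmf[OF ne] by (intro measure_pmf.finite_measure_eq_AE) (auto simp: AE_measure_pmf_iff)
  also have "\<dots> = pmf P (x, y) / measure_pmf.prob P {w. fst w = x}"
    using ne by (simp add: measure_pmf_single pmf_cond)
  finally have "pmf (cond_kernel P x) y = pmf P (x, y) / measure_pmf.prob P {w. fst w = x}" .
  moreover have "pmf (map_pmf fst P) x = measure_pmf.prob P {w. fst w = x}"
    by (simp add: pmf_map vimage_def)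
  moreover have "0 < pmf (map_pmf fst P) x"
    using True by (intro pmf_positive) auto
  ultimately show ?thesis by simp
next
  case False
  hence "x \<notin> set_pmf (map_pmf fst P)" "(x, y) \<notin> set_pmf P" by force+
  hence "pmf (map_pmf fst P) x = 0" "pmf P (x, y) = 0" by (simp_all only: set_pmf_iff not_not)
  thus ?thesis by simp
qed

lemma pmf_bind_Pair: "pmf (bind_pmf p (\<lambda>x. map_pmf (Pair x) (k x))) (x, y) = pmf p x * pmf (k x) y"
proof -
  have *: "pmf (map_pmf (Pair x') (k x')) (x, y) = indicator {x} x' * pmf (k x) y" for x'
  proof (cases "x' = x")
    case True
    thus ?thesis using pmf_map_inj'[of "Pair x" "k x" y] by (simp add: inj_def)
  next
    case False
    hence "(x, y) \<notin> Pair x' ` set_pmf (k x')" by auto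
    thus ?thesis using False by (simp add: pmf_map_outside)
  qed
  show ?thesis
    unfolding pmf_bind * by (simp add: measure_pmf_single)
qed

lemma bind_cond_kernel: "bind_pmf (map_pmf fst P) (\<lambda>x. map_pmf (Pair x) (cond_kernel P x)) = P"
proof (rule pmf_eqI)
  fix w :: "'a \<times> 'b"
  show "pmf (bind_pmf (map_pmf fst P) (\<lambda>x. map_pmf (Pair x) (cond_kernel P x))) w = pmf P w"
    by (cases w) (simp only: pmf_bind_Pair pmf_cond_kernel)
qed

lemma set_cond_kernel: "set_pmf (cond_kernel P x) \<subseteq> snd ` set_pmf P"
proof (cases "x \<in> fst ` set_pmf P")
  case True
  hence "set_pmf P \<inter> {w. fst w = x} \<noteq> {}" by auto
  thus ?thesis using True by (auto simp: cond_kernel_def)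
qed (auto simp: cond_kernel_def)

lemma finite_cond_kernel [simp]: "finite (set_pmf P) \<Longrightarrow> finite (set_pmf (cond_kernel P x))"
  by (meson finite_imageI finite_subset set_cond_kernel)

text \<open>Any kernel that generates Y from X computes the conditional entropy. The Markov
  structure of the model can thus be read off from the kernels by which it is built.\<close>

lemma cond_ent_kernel:
  assumes fin: "finite (set_pmf J)"
    and K: "map_pmf (\<lambda>w. (X w, Y w)) J = bind_pmf (map_pmf X J) (\<lambda>x. map_pmf (Pair x) (K x))"
  shows "cond_ent J Y X = - pexp J (\<lambda>w. log 2 (pmf (K (X w)) (Y w)))"
proof -
  have "cond_ent J Y X = ent (map_pmf (\<lambda>w. (X w, Y w)) J) - ent (map_pmf X J)"
    unfolding cond_ent_def using fin by (intro arg_cong2[of _ _ _ _ "(-)"] ent_map_eq refl) auto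
  also have "\<dots> = - pexp J (\<lambda>w. log 2 (pmf (map_pmf (\<lambda>w. (X w, Y w)) J) (X w, Y w)) - log 2 (pmf (map_pmf X J) (X w)))"
    using fin by (simp add: ent_map_pexp pexp_diff)
  also have "pexp J (\<lambda>w. log 2 (pmf (map_pmf (\<lambda>w. (X w, Y w)) J) (X w, Y w)) - log 2 (pmf (map_pmf X J) (X w)))
      = pexp J (\<lambda>w. log 2 (pmf (K (X w)) (Y w)))"
  proof (rule pexp_cong)
    fix w assume w: "w \<in> set_pmf J"
    have "pmf (map_pmf (\<lambda>w. (X w, Y w)) J) (X w, Y w) = pmf (map_pmf X J) (X w) * pmf (K (X w)) (Y w)"
      unfolding K by (rule pmf_bind_Pair)
    moreover have "0 < pmf (map_pmf (\<lambda>w. (X w, Y w)) J) (X w, Y w)" "0 < pmf (map_pmf X J) (X w)"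
      using w pmf_map_self_pos[of w J "\<lambda>w. (X w, Y w)"] pmf_map_self_pos[of w J X] by auto
    ultimately show "log 2 (pmf (map_pmf (\<lambda>w. (X w, Y w)) J) (X w, Y w)) - log 2 (pmf (map_pmf X J) (X w))
        = log 2 (pmf (K (X w)) (Y w))"
      by (simp add: log_mult zero_less_mult_iff)
  qed
  finally show ?thesis .
qed

text \<open>\<open>Q\<close> keeps the pair (Z, X) and redraws Y from its law given Z, which makes X
  - Z - Y a Markov chain; conditional mutual information is the divergence from this law.\<close>

lemma cmi_eq_divergence:
  fixes J :: "'w pmf" and X :: "'w \<Rightarrow> 'x" and Y :: "'w \<Rightarrow> 'y" and Z :: "'w \<Rightarrow> 'z"
  assumes fin: "finite (set_pmf J)"
  defines "P \<equiv> map_pmf (\<lambda>w. ((Z w, X w), Y w)) J"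
  defines "Q \<equiv> bind_pmf (map_pmf (\<lambda>w. (Z w, X w)) J)
      (\<lambda>zx. map_pmf (Pair zx) (cond_kernel (map_pmf (\<lambda>w. (Z w, Y w)) J) (fst zx)))"
  shows "cmi J X Y Z = pexp P (\<lambda>x. log 2 (pmf P x / pmf Q x))" and "set_pmf P \<subseteq> set_pmf Q"
proof -
  let ?K = "cond_kernel (map_pmf (\<lambda>w. (Z w, Y w)) J)"
  have K: "pmf (map_pmf Z J) z * pmf (?K z) y = pmf (map_pmf (\<lambda>w. (Z w, Y w)) J) (z, y)" for z y
    using pmf_cond_kernel[of "map_pmf (\<lambda>w. (Z w, Y w)) J" z y] by (simp add: map_pmf_comp)
  have Q: "pmf Q ((z, x), y) = pmf (map_pmf (\<lambda>w. (Z w, X w)) J) (z, x) * pmf (?K z) y" for x y z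
    unfolding Q_def by (simp add: pmf_bind_Pair)
  have pos: "0 < pmf (map_pmf (\<lambda>w. (Z w, X w)) J) (Z w, X w)" "0 < pmf (map_pmf Z J) (Z w)"
    "0 < pmf (map_pmf (\<lambda>w. (Z w, Y w)) J) (Z w, Y w)" "0 < pmf P ((Z w, X w), Y w)" if "w \<in> set_pmf J" for w
    using that pmf_map_self_pos[OF that, of "\<lambda>w. (Z w, X w)"] pmf_map_self_pos[OF that, of Z]
      pmf_map_self_pos[OF that, of "\<lambda>w. (Z w, Y w)"] pmf_map_self_pos[OF that, of "\<lambda>w. ((Z w, X w), Y w)"]
    by (simp_all add: P_def)
  have Kpos: "0 < pmf (?K (Z w)) (Y w)" if "w \<in> set_pmf J" for w
    using pos(2,3)[OF that] K[of "Z w" "Y w"] by (smt (verit) pmf_nonneg zero_less_mult_pos)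
  have "cmi J X Y Z = ent (map_pmf (\<lambda>w. (Z w, X w)) J) - ent (map_pmf Z J)
      - (ent (map_pmf (\<lambda>w. ((Z w, X w), Y w)) J) - ent (map_pmf (\<lambda>w. (Z w, Y w)) J))"
    unfolding cmi_def cond_ent_def using fin
    by (intro arg_cong2[of _ _ _ _ "(-)"] ent_map_eq refl) auto
  also have "\<dots> = pexp J (\<lambda>w. log 2 (pmf (map_pmf Z J) (Z w)) - log 2 (pmf (map_pmf (\<lambda>w. (Z w, X w)) J) (Z w, X w))
      + log 2 (pmf P ((Z w, X w), Y w)) - log 2 (pmf (map_pmf (\<lambda>w. (Z w, Y w)) J) (Z w, Y w)))"
    using fin by (simp add: ent_map_pexp pexp_add pexp_diff P_def)
  also have "\<dots> = pexp J (\<lambda>w. log 2 (pmf P ((Z w, X w), Y w) / pmf Q ((Z w, X w), Y w)))"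
    unfolding Q K[symmetric] using pos Kpos
    by (intro pexp_cong) (simp add: log_mult_pos log_divide_pos)
  finally show "cmi J X Y Z = pexp P (\<lambda>x. log 2 (pmf P x / pmf Q x))"
    by (simp add: P_def)
  show "set_pmf P \<subseteq> set_pmf Q"
  proof
    fix x assume "x \<in> set_pmf P"
    then obtain w where w: "w \<in> set_pmf J" "x = ((Z w, X w), Y w)" by (auto simp: P_def)
    hence "0 < pmf Q x" using Q pos Kpos by simp
    thus "x \<in> set_pmf Q" by (simp add: set_pmf_iff)
  qed
qed

lemma cmi_nonneg:
  assumes "finite (set_pmf J)"
  shows "0 \<le> cmi J X Y Z"
  unfolding cmi_eq_divergence(1)[OF assms]
  using assms by (intro gibbs_pmf cmi_eq_divergence(2)) (simp_all only: finite_set_map_pmf)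

text \<open>Equality in the Gibbs inequality; it serves the degenerate case in which Bob's channel
  carries no information.\<close>

lemma cmi_zero_imp_cond_indep:
  assumes "finite (set_pmf J)" "cmi J X Y Z = 0"
  shows "map_pmf (\<lambda>w. ((Z w, X w), Y w)) J = bind_pmf (map_pmf (\<lambda>w. (Z w, X w)) J)
      (\<lambda>zx. map_pmf (Pair zx) (cond_kernel (map_pmf (\<lambda>w. (Z w, Y w)) J) (fst zx)))"
proof (rule gibbs_pmf_eq)
  show "finite (set_pmf (map_pmf (\<lambda>w. ((Z w, X w), Y w)) J))"
    using assms(1) by (rule finite_set_map_pmf)
qed (rule cmi_eq_divergence(2)[OF assms(1)], simp only: cmi_eq_divergence(1)[OF assms(1), symmetric] assms(2))

text \<open>With S = \<sigma>(I) given to Eve, H(A|S,E,Z) = H(A,S,E,Z) - H(S,E,Z). The first entropy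
  is at least H(A,E) + H(Z|A,E,I), the last term being the entropy of \<open>\<zeta>\<close>. The
  second is at most the cross entropy to the weight \<open>R s e * pmf (\<rho> s) z / N\<close>,
  whose three factors give the three subtracted terms once the entropy of \<open>\<zeta>\<close> is
  merged with the factor \<open>\<rho>\<close>.\<close>

lemma equivocation_bound:
  fixes pAE :: "('a \<times> 'e) pmf" and enc :: "'a \<Rightarrow> 'i pmf" and \<zeta> :: "'i \<Rightarrow> 'z pmf" and \<sigma> :: "'i \<Rightarrow> nat"
    and R :: "nat \<Rightarrow> 'e \<Rightarrow> real" and \<rho> :: "nat \<Rightarrow> 'z pmf"
  assumes fin: "finite (set_pmf pAE)" "\<And>a. finite (set_pmf (enc a))" "\<And>i. finite (set_pmf (\<zeta> i))"
      "\<And>s. finite (set_pmf (\<rho> s))"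
    and \<sigma>: "\<And>a i. i \<in> set_pmf (enc a) \<Longrightarrow> \<sigma> i < N"
    and R: "\<And>s e. 0 < R s e" "\<And>s. (\<Sum>e\<in>snd ` set_pmf pAE. R s e) \<le> 1"
    and \<rho>: "\<And>a i. i \<in> set_pmf (enc a) \<Longrightarrow> set_pmf (\<zeta> i) \<subseteq> set_pmf (\<rho> (\<sigma> i))"
    and \<Gamma>: "\<Gamma> = bind_pmf pAE (\<lambda>(a, e). bind_pmf (enc a) (\<lambda>i. map_pmf (\<lambda>z. (a, e, i, z)) (\<zeta> i)))"
  shows "ent pAE - log 2 (real N) - pexp \<Gamma> (\<lambda>(a, e, i, z). - log 2 (R (\<sigma> i) e))
      - pexp \<Gamma> (\<lambda>(a, e, i, z). log 2 (pmf (\<zeta> i) z / pmf (\<rho> (\<sigma> i)) z))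
    \<le> cond_ent \<Gamma> (\<lambda>(a, e, i, z). a) (\<lambda>(a, e, i, z). (e, z))"
proof -
  define A :: "'a \<times> 'e \<times> 'i \<times> 'z \<Rightarrow> 'a" where "A = (\<lambda>(a, e, i, z). a)"
  define E :: "'a \<times> 'e \<times> 'i \<times> 'z \<Rightarrow> 'e" where "E = (\<lambda>(a, e, i, z). e)"
  define I :: "'a \<times> 'e \<times> 'i \<times> 'z \<Rightarrow> 'i" where "I = (\<lambda>(a, e, i, z). i)"
  define Z :: "'a \<times> 'e \<times> 'i \<times> 'z \<Rightarrow> 'z" where "Z = (\<lambda>(a, e, i, z). z)"
  define S where "S w = \<sigma> (I w)" for w
  note defs = A_def E_def I_def Z_def
  have fin\<Gamma>: "finite (set_pmf \<Gamma>)" using fin by (auto simp: \<Gamma> case_prod_unfold)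
  have supp: "S w < N" "E w \<in> snd ` set_pmf pAE" "Z w \<in> set_pmf (\<rho> (S w))" "Z w \<in> set_pmf (\<zeta> (I w))"
    if "w \<in> set_pmf \<Gamma>" for w
    using that \<sigma> \<rho> by (auto simp: \<Gamma> defs S_def image_iff)
       (metis snd_conv, blast)
  have mapAE: "map_pmf (\<lambda>w. (A w, E w)) \<Gamma> = pAE"
    unfolding \<Gamma> defs
    by (simp add: map_bind_pmf case_prod_unfold map_pmf_comp map_pmf_const bind_return_pmf')
  have "0 \<le> cmi \<Gamma> A S (\<lambda>w. (E w, Z w))" by (rule cmi_nonneg[OF fin\<Gamma>])
  hence 1: "cond_ent \<Gamma> A (\<lambda>w. (S w, E w, Z w)) \<le> cond_ent \<Gamma> A (\<lambda>w. (E w, Z w))"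
    by (simp add: cmi_def)
  \<comment> \<open>Conditioning on the index as well leaves only the randomness of
    \<open>\<zeta>\<close> in Z.\<close>
  have "0 \<le> cmi \<Gamma> Z I (\<lambda>w. (A w, E w))" by (rule cmi_nonneg[OF fin\<Gamma>])
  hence 2: "cond_ent \<Gamma> Z (\<lambda>w. (I w, A w, E w)) \<le> cond_ent \<Gamma> Z (\<lambda>w. (A w, E w))"
    by (simp add: cmi_def)
  have 3: "cond_ent \<Gamma> Z (\<lambda>w. (I w, A w, E w)) = - pexp \<Gamma> (\<lambda>w. log 2 (pmf (\<zeta> (I w)) (Z w)))"
  proof -
    have "map_pmf (\<lambda>w. ((I w, A w, E w), Z w)) \<Gamma>
        = bind_pmf (map_pmf (\<lambda>w. (I w, A w, E w)) \<Gamma>) (\<lambda>x. map_pmf (Pair x) (\<zeta> (fst x)))"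
      unfolding \<Gamma> defs
      by (simp add: map_bind_pmf case_prod_unfold map_pmf_comp map_pmf_const bind_return_pmf' bind_assoc_pmf
          bind_map_pmf bind_return_pmf)
    from cond_ent_kernel[OF fin\<Gamma> this] show ?thesis by simp
  qed
  have 4: "ent (map_pmf (\<lambda>w. (Z w, A w, E w)) \<Gamma>) \<le> ent (map_pmf (\<lambda>w. (A w, S w, E w, Z w)) \<Gamma>)"
    by (rule ent_map_mono[OF fin\<Gamma>]) auto
  have 5: "ent (map_pmf (\<lambda>w. (S w, E w, Z w)) \<Gamma>)
      \<le> log 2 (real N) + pexp \<Gamma> (\<lambda>w. - log 2 (R (S w) (E w))) + pexp \<Gamma> (\<lambda>w. - log 2 (pmf (\<rho> (S w)) (Z w)))"
  proof -
    let ?P = "map_pmf (\<lambda>w. (S w, E w, Z w)) \<Gamma>"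
    \<comment> \<open>The comparison weight: s uniform, then e and z separately given s.\<close>
    define Q where "Q = (\<lambda>(s, e, z). R s e * pmf (\<rho> s) z / real N)"
    let ?D = "Sigma {..<N} (\<lambda>s. (snd ` set_pmf pAE) \<times> set_pmf (\<rho> s))"
    have sub: "set_pmf ?P \<subseteq> ?D" using supp by auto
    have Npos: "0 < N" using supp(1) set_pmf_not_empty[of \<Gamma>] by fastforce
    have "0 \<le> pexp ?P (\<lambda>x. log 2 (pmf ?P x / Q x))"
    proof (rule gibbs)
      show "finite (set_pmf ?P)" using fin\<Gamma> by simp
      show "0 < Q x" if "x \<in> set_pmf ?P" for x
        using that sub Npos R(1) by (auto simp: Q_def intro!: divide_pos_pos mult_pos_pos pmf_positive)
      have "(\<Sum>x\<in>set_pmf ?P. Q x) \<le> (\<Sum>x\<in>?D. Q x)"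
        using fin sub R(1) by (intro sum_mono2) (auto simp: Q_def less_imp_le)
      also have "\<dots> = (\<Sum>s<N. \<Sum>(e, z)\<in>(snd ` set_pmf pAE) \<times> set_pmf (\<rho> s). R s e * pmf (\<rho> s) z / real N)"
        using sum.Sigma[of "{..<N}" "\<lambda>s. (snd ` set_pmf pAE) \<times> set_pmf (\<rho> s)" "\<lambda>s (e, z). R s e * pmf (\<rho> s) z / real N"] fin
        by (simp add: Q_def case_prod_unfold)
      also have "\<dots> = (\<Sum>s<N. (\<Sum>e\<in>snd ` set_pmf pAE. R s e) * (\<Sum>z\<in>set_pmf (\<rho> s). pmf (\<rho> s) z) / real N)"
        by (simp add: sum_product sum.cartesian_product sum_divide_distrib case_prod_unfold)
      also have "\<dots> = (\<Sum>s<N. (\<Sum>e\<in>snd ` set_pmf pAE. R s e) / real N)"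
        using fin by (simp add: sum_pmf_eq_1)
      also have "\<dots> \<le> (\<Sum>s<N. 1 / real N)"
        using R(2) by (intro sum_mono divide_right_mono) auto
      finally show "(\<Sum>x\<in>set_pmf ?P. Q x) \<le> 1" using Npos by simp
    qed
    also have "pexp ?P (\<lambda>x. log 2 (pmf ?P x / Q x))
        = pexp \<Gamma> (\<lambda>w. log 2 (pmf ?P (S w, E w, Z w)) + log 2 (real N) + (- log 2 (R (S w) (E w)))
            + (- log 2 (pmf (\<rho> (S w)) (Z w))))"
      unfolding pexp_map
    proof (rule pexp_cong)
      fix w assume w: "w \<in> set_pmf \<Gamma>"
      have "0 < pmf ?P (S w, E w, Z w)" using pmf_map_self_pos[OF w, of "\<lambda>w. (S w, E w, Z w)"] by simp
      moreover have "0 < pmf (\<rho> (S w)) (Z w)" using supp[OF w] by (simp add: pmf_positive)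
      ultimately show "log 2 (pmf ?P (S w, E w, Z w) / Q (S w, E w, Z w)) = log 2 (pmf ?P (S w, E w, Z w)) + log 2 (real N)
          + (- log 2 (R (S w) (E w))) + (- log 2 (pmf (\<rho> (S w)) (Z w)))"
        using R(1)[of "S w" "E w"] Npos by (simp add: Q_def log_divide_pos log_mult_pos)
    qed
    finally show ?thesis
      using fin\<Gamma> by (simp add: pexp_add pexp_diff pexp_minus ent_map_pexp)
  qed
  have 6: "pexp \<Gamma> (\<lambda>w. log 2 (pmf (\<zeta> (I w)) (Z w) / pmf (\<rho> (S w)) (Z w)))
      = pexp \<Gamma> (\<lambda>w. log 2 (pmf (\<zeta> (I w)) (Z w))) + pexp \<Gamma> (\<lambda>w. - log 2 (pmf (\<rho> (S w)) (Z w)))"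
    unfolding pexp_add[OF fin\<Gamma>, symmetric] using supp
    by (intro pexp_cong) (simp add: log_divide_pos pmf_positive)
  have "ent pAE - log 2 (real N) - pexp \<Gamma> (\<lambda>w. - log 2 (R (S w) (E w)))
      - pexp \<Gamma> (\<lambda>w. log 2 (pmf (\<zeta> (I w)) (Z w) / pmf (\<rho> (S w)) (Z w)))
    \<le> cond_ent \<Gamma> A (\<lambda>w. (E w, Z w))"
    using 1 2 3 4 5 unfolding 6 by (simp add: cond_ent_def mapAE)
  thus ?thesis
    unfolding defs S_def by (simp add: case_prod_unfold)
qed

section \<open>One-shot coding\<close>

lemma superposition_code_support:
  assumes "C \<in> set_pmf (superposition_code N M p k)" "s < N" "j < M"
  shows "fst (C s) \<in> set_pmf p" "snd (C s) j \<in> set_pmf (k (fst (C s)))"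
proof -
  have "C s \<in> set_pmf (bind_pmf p (\<lambda>u. map_pmf (Pair u) (Pi_pmf {..<M} undefined (\<lambda>_. k u))))"
    using assms(1,2) unfolding superposition_code_def by (auto simp: set_Pi_pmf PiE_dflt_def)
  thus "fst (C s) \<in> set_pmf p" "snd (C s) j \<in> set_pmf (k (fst (C s)))"
    using assms(3) by (auto simp: set_Pi_pmf PiE_dflt_def)
qed

context
  fixes N M :: nat and pU :: "'u pmf" and kV :: "'u \<Rightarrow> 'v pmf" and k :: "'v \<Rightarrow> 'b pmf"
    and T :: "'u \<Rightarrow> 'v \<Rightarrow> 'b \<Rightarrow> bool" and f :: "'v \<Rightarrow> 'b \<Rightarrow> real" and \<tau> :: real
  assumes fin: "finite (set_pmf pU)" "\<And>u. finite (set_pmf (kV u))" "\<And>v. finite (set_pmf (k v))"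
    and f: "\<And>v b. 0 \<le> f v b" "\<And>u b. pexp (kV u) (\<lambda>v. f v b) \<le> pmf (bind_pmf (kV u) k) b"
    and \<tau>: "0 < \<tau>"
begin

text \<open>Given the output b, the wrong word is independent of it. Passing the test means that
  \<open>f\<close> is at least \<tau> times the output law at b, while the mean of \<open>f\<close>
  over wrong words is at most that law, so Markov's inequality gives 1/\<tau>. The likelihood
  \<open>f\<close> is kept apart from the kernel \<open>k\<close> because in the channel layer a
  satellite is a family of words: \<open>k\<close> averages over the family, \<open>f\<close> looks
  at one member.\<close>

lemma wrong_outer_codeword:
  assumes s: "s < N" "s' < N" "s \<noteq> s'" "j < M" "j' < M"
    and T: "\<And>u v b. T u v b \<Longrightarrow> \<tau> * pmf (bind_pmf pU (\<lambda>u. bind_pmf (kV u) k)) b \<le> f v b"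
  shows "pexp (superposition_code N M pU kV)
      (\<lambda>C. pexp (k (snd (C s) j)) (\<lambda>b. of_bool (T (fst (C s')) (snd (C s') j') b))) \<le> 1 / \<tau>"
proof -
  let ?r = "bind_pmf pU (\<lambda>u. bind_pmf (kV u) k)"
  have "pexp (superposition_code N M pU kV)
      (\<lambda>C. pexp (k (snd (C s) j)) (\<lambda>b. of_bool (T (fst (C s')) (snd (C s') j') b)))
    = pexp pU (\<lambda>u. pexp (kV u) (\<lambda>v. pexp pU (\<lambda>u'. pexp (kV u') (\<lambda>v'. pexp (k v) (\<lambda>b. of_bool (T u' v' b))))))"
    by (rule superposition_code_diff[OF fin(1,2) s, where h = "\<lambda>u v u' v'. pexp (k v) (\<lambda>b. of_bool (T u' v' b))"])
  also have "\<dots> = pexp pU (\<lambda>u. pexp (kV u) (\<lambda>v. pexp (k v) (\<lambda>b. pexp pU (\<lambda>u'. pexp (kV u') (\<lambda>v'. of_bool (T u' v' b))))))"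
    using fin by (simp add: pexp_commute[of "kV _" "k _"] pexp_commute[of pU "k _"])
  also have "\<dots> \<le> 1 / \<tau>"
  proof (rule pexp_le_const[OF fin(1)], rule pexp_le_const[OF fin(2)], rule pexp_le_const[OF fin(3)])
    fix u v b assume "u \<in> set_pmf pU" "v \<in> set_pmf (kV u)" "b \<in> set_pmf (k v)"
    hence r: "0 < pmf ?r b" by (intro pmf_positive) auto
    have "pexp pU (\<lambda>u'. pexp (kV u') (\<lambda>v'. of_bool (T u' v' b)))
        \<le> pexp pU (\<lambda>u'. pexp (kV u') (\<lambda>v'. f v' b / (\<tau> * pmf ?r b)))"
      using T f(1) r \<tau> fin by (intro pexp_mono) (auto simp: of_bool_def pos_le_divide_eq)
    also have "\<dots> = pexp pU (\<lambda>u'. pexp (kV u') (\<lambda>v'. f v' b)) / (\<tau> * pmf ?r b)"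
      by (simp add: pexp_divide)
    also have "\<dots> \<le> pmf ?r b / (\<tau> * pmf ?r b)"
    proof (rule divide_right_mono)
      show "pexp pU (\<lambda>u'. pexp (kV u') (\<lambda>v'. f v' b)) \<le> pmf ?r b"
        unfolding pmf_bind_pexp[of pU] using fin f(2) by (intro pexp_mono)
    qed (use r \<tau> in auto)
    also have "\<dots> = 1 / \<tau>" using r by simp
    finally show "pexp pU (\<lambda>u'. pexp (kV u') (\<lambda>v'. of_bool (T u' v' b))) \<le> 1 / \<tau>" .
  qed
  finally show ?thesis .
qed

text \<open>The same argument inside one cloud, where output and wrong word are independent given
  the centre.\<close>

lemma wrong_inner_codeword:
  assumes s: "s < N" "j < M" "j' < M" "j \<noteq> j'"
    and T: "\<And>u v b. T u v b \<Longrightarrow> \<tau> * pmf (bind_pmf (kV u) k) b \<le> f v b"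
  shows "pexp (superposition_code N M pU kV)
      (\<lambda>C. pexp (k (snd (C s) j)) (\<lambda>b. of_bool (T (fst (C s)) (snd (C s) j') b))) \<le> 1 / \<tau>"
proof -
  have "pexp (superposition_code N M pU kV)
      (\<lambda>C. pexp (k (snd (C s) j)) (\<lambda>b. of_bool (T (fst (C s)) (snd (C s) j') b)))
    = pexp pU (\<lambda>u. pexp (kV u) (\<lambda>v. pexp (kV u) (\<lambda>v'. pexp (k v) (\<lambda>b. of_bool (T u v' b)))))"
    by (rule superposition_code_same[OF fin(1,2) s, where h = "\<lambda>u v v'. pexp (k v) (\<lambda>b. of_bool (T u v' b))"])
  also have "\<dots> = pexp pU (\<lambda>u. pexp (kV u) (\<lambda>v. pexp (k v) (\<lambda>b. pexp (kV u) (\<lambda>v'. of_bool (T u v' b)))))"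
    using fin by (simp add: pexp_commute[of "kV _" "k _"])
  also have "\<dots> \<le> 1 / \<tau>"
  proof (rule pexp_le_const[OF fin(1)], rule pexp_le_const[OF fin(2)], rule pexp_le_const[OF fin(3)])
    fix u v b assume "u \<in> set_pmf pU" "v \<in> set_pmf (kV u)" "b \<in> set_pmf (k v)"
    hence r: "0 < pmf (bind_pmf (kV u) k) b" by (intro pmf_positive) auto
    have "pexp (kV u) (\<lambda>v'. of_bool (T u v' b)) \<le> pexp (kV u) (\<lambda>v'. f v' b / (\<tau> * pmf (bind_pmf (kV u) k) b))"
      using T f(1) r \<tau> fin by (intro pexp_mono) (auto simp: of_bool_def pos_le_divide_eq)
    also have "\<dots> = pexp (kV u) (\<lambda>v'. f v' b) / (\<tau> * pmf (bind_pmf (kV u) k) b)"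
      by (simp add: pexp_divide)
    also have "\<dots> \<le> pmf (bind_pmf (kV u) k) b / (\<tau> * pmf (bind_pmf (kV u) k) b)"
      using f(2) r \<tau> by (intro divide_right_mono) auto
    also have "\<dots> = 1 / \<tau>" using r by simp
    finally show "pexp (kV u) (\<lambda>v'. of_bool (T u v' b)) \<le> 1 / \<tau>" .
  qed
  finally show ?thesis .
qed

end

text \<open>Only points where \<open>P\<close> exceeds \<open>M\<close> can raise the expectation,
  and since g \<le> 1 their excess is charged at most once; hence a one-sided deficit
  suffices.\<close>

lemma pexp_change_of_measure:
  assumes fin: "finite (set_pmf P)" "finite (set_pmf M)" and g: "\<And>a. 0 \<le> g a" "\<And>a. g a \<le> 1"
  shows "pexp P g \<le> pexp M g + (\<Sum>a\<in>set_pmf P. max 0 (pmf P a - pmf M a))"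
proof -
  have "pexp P g = (\<Sum>a\<in>set_pmf P. pmf P a * g a)" by (rule pexp_pmf_weight[OF fin(1)])
  also have "\<dots> \<le> (\<Sum>a\<in>set_pmf P. pmf M a * g a + max 0 (pmf P a - pmf M a))"
  proof (rule sum_mono)
    fix a
    have "(pmf P a - pmf M a) * g a \<le> max 0 (pmf P a - pmf M a) * 1"
      using g by (intro mult_mono) auto
    thus "pmf P a * g a \<le> pmf M a * g a + max 0 (pmf P a - pmf M a)" by (simp add: algebra_simps)
  qed
  also have "\<dots> = (\<Sum>a\<in>set_pmf P. pmf M a * g a) + (\<Sum>a\<in>set_pmf P. max 0 (pmf P a - pmf M a))"
    by (rule sum.distrib)
  also have "(\<Sum>a\<in>set_pmf P. pmf M a * g a) \<le> (\<Sum>a\<in>set_pmf P \<union> set_pmf M. pmf M a * g a)"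
    using fin g by (intro sum_mono2) auto
  also have "\<dots> = pexp M g" using fin by (intro pexp_eq_sum[symmetric]) auto
  finally show ?thesis by simp
qed

lemma cond_ent_cong_map:
  assumes "map_pmf (\<lambda>w. (X w, Y w)) J = map_pmf (\<lambda>w. (X' w, Y' w)) J'"
  shows "cond_ent J X Y = cond_ent J' X' Y'"
proof -
  have "map_pmf snd (map_pmf (\<lambda>w. (X w, Y w)) J) = map_pmf snd (map_pmf (\<lambda>w. (X' w, Y' w)) J')"
    by (simp only: assms)
  hence "map_pmf Y J = map_pmf Y' J'" by (simp add: map_pmf_comp)
  thus ?thesis by (simp add: cond_ent_def assms)
qed

text \<open>Free of assumptions, so that the same derived laws can be interpreted for single letters
  and for words. Variables are generated in the order of random coding: centre, satellite, source,
  side information.\<close>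

locale source_model =
  fixes pU :: "'u pmf" and kV :: "'u \<Rightarrow> 'v pmf" and kA :: "'v \<Rightarrow> 'a pmf" and kBE :: "'a \<Rightarrow> ('b \<times> 'e) pmf"
begin

definition "kAU u = bind_pmf (kV u) kA"
definition "pA = bind_pmf pU kAU"
definition "kB v = bind_pmf (kA v) (\<lambda>a. map_pmf fst (kBE a))"
definition "kBU u = bind_pmf (kV u) kB"
definition "pB = bind_pmf pU kBU"
definition "kEU u = bind_pmf (kV u) (\<lambda>v. bind_pmf (kA v) (\<lambda>a. map_pmf snd (kBE a)))"
definition "src = bind_pmf pU (\<lambda>u. bind_pmf (kV u) (\<lambda>v. bind_pmf (kA v) (\<lambda>a. map_pmf (\<lambda>(b, e). (u, v, a, b, e)) (kBE a))))"
definition "pABE = bind_pmf pA (\<lambda>a. map_pmf (Pair a) (kBE a))"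
definition "pAE = map_pmf (\<lambda>(a, b, e). (a, e)) pABE"

end

locale channel_model =
  fixes pQ :: "'q pmf" and kT :: "'q \<Rightarrow> 't pmf" and kYZ :: "'t \<Rightarrow> ('y \<times> 'z) pmf"
begin

definition "kY t = map_pmf fst (kYZ t)"
definition "kYQ q = bind_pmf (kT q) kY"
definition "pY = bind_pmf pQ kYQ"
definition "kZ t = map_pmf snd (kYZ t)"
definition "kZQ q = bind_pmf (kT q) kZ"
definition "chn = bind_pmf pQ (\<lambda>q. bind_pmf (kT q) (\<lambda>t. map_pmf (\<lambda>(y, z). (q, t, y, z)) (kYZ t)))"

end

locale wiretap_model = source_model pU kV kA kBE + channel_model pQ kT kYZ
  for pU :: "'u pmf" and kV :: "'u \<Rightarrow> 'v pmf" and kA :: "'v \<Rightarrow> 'a pmf" and kBE :: "'a \<Rightarrow> ('b \<times> 'e) pmf"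
    and pQ :: "'q pmf" and kT :: "'q \<Rightarrow> 't pmf" and kYZ :: "'t \<Rightarrow> ('y \<times> 'z) pmf"
begin

text \<open>The encoder outputs t; in the application the prefix channel p(x|t) is absorbed into
  \<open>kYZ\<close>.\<close>

definition "code_law enc = bind_pmf pABE (\<lambda>(a, b, e). bind_pmf (enc a) (\<lambda>t. map_pmf (\<lambda>(y, z). (a, b, e, y, z)) (kYZ t)))"

end

section \<open>The one-shot code: thresholds, codebooks and error events\<close>

locale one_shot = wiretap_model pU kV kA kBE pQ kT kYZ
  for pU :: "'u pmf" and kV :: "'u \<Rightarrow> 'v pmf" and kA :: "'v \<Rightarrow> 'a pmf" and kBE :: "'a \<Rightarrow> ('b \<times> 'e) pmf"
    and pQ :: "'q pmf" and kT :: "'q \<Rightarrow> 't pmf" and kYZ :: "'t \<Rightarrow> ('y \<times> 'z) pmf" +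
  fixes NS N2 NK :: nat and \<gamma>1 \<gamma>2 \<tau>b1 \<tau>b2 \<tau>y1 \<tau>y2 h :: real
    and Gd :: "'v \<Rightarrow> 'a \<Rightarrow> 'b \<Rightarrow> bool"
  assumes fin: "finite (set_pmf pU)" "\<And>u. finite (set_pmf (kV u))" "\<And>v. finite (set_pmf (kA v))"
      "\<And>a. finite (set_pmf (kBE a))"
    and fin': "finite (set_pmf pQ)" "\<And>q. finite (set_pmf (kT q))" "\<And>t. finite (set_pmf (kYZ t))"
    and N: "0 < NS" "0 < N2" "0 < NK"
    and pos: "0 \<le> \<gamma>1" "0 \<le> \<gamma>2" "0 < \<tau>b1" "0 < \<tau>b2" "0 < \<tau>y1" "0 < \<tau>y2" "0 \<le> h"
begin

text \<open>\<open>G1\<close> is what soft covering needs and is charged to the deficit;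
  \<open>G2\<close> is what decoding, equivocation and distortion need and is carried along by the
  change of measure.\<close>

definition "G1 u v a \<longleftrightarrow> pmf (kAU u) a \<le> \<gamma>1 * pmf pA a \<and> pmf (kA v) a \<le> \<gamma>2 * pmf pA a"
definition "testB u v b \<longleftrightarrow> \<tau>b1 * pmf pB b \<le> pmf (kB v) b \<and> \<tau>b2 * pmf (kBU u) b \<le> pmf (kB v) b"
definition "G2 u v a b e \<longleftrightarrow> testB u v b \<and> 2 powr (- h) \<le> pmf (kEU u) e \<and> Gd v a b"
definition "testY q t y \<longleftrightarrow> \<tau>y1 * pmf pY y \<le> pmf (kY t) y \<and> \<tau>y2 * pmf (kYQ q) y \<le> pmf (kY t) y"

definition "src_code = superposition_code NS N2 pU kV"
text \<open>A channel satellite is a whole family of NK words, so the local randomness \<kappa>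
  requires no third layer.\<close>

definition "chn_code = superposition_code NS N2 pQ (\<lambda>q. Pi_pmf {..<NK} undefined (\<lambda>_. kT q))"
definition "Idx = {..<NS} \<times> {..<N2}"
definition "unifK = pmf_of_set {..<NK}"

definition cloud :: "(nat \<Rightarrow> 'c \<times> (nat \<Rightarrow> 'd)) \<Rightarrow> nat \<times> nat \<Rightarrow> 'c" where "cloud C i = fst (C (fst i))"
definition sat :: "(nat \<Rightarrow> 'c \<times> (nat \<Rightarrow> 'd)) \<Rightarrow> nat \<times> nat \<Rightarrow> 'd" where "sat C i = snd (C (fst i)) (snd i)"

definition "pass C D i \<kappa> b y \<longleftrightarrow> testB (cloud C i) (sat C i) b \<and> testY (cloud D i) (sat D i \<kappa>) y"
definition "confused C D i b y \<longleftrightarrow> (\<exists>i'\<in>Idx - {i}. \<exists>\<kappa>'<NK. pass C D i' \<kappa>' b y)"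
text \<open>A single event for distortion and equivocation. Through \<open>G2\<close> it contains
  the failure of Eve's symbol to be likely given the centre, although Bob's decoder never sees that
  symbol.\<close>

definition "bad C D i \<kappa> a b e y \<longleftrightarrow> \<not> G2 (cloud C i) (sat C i) a b e
   \<or> \<not> testY (cloud D i) (sat D i \<kappa>) y \<or> confused C D i b y"
text \<open>Only a and i stay free: their joint law is what differs between the true and the
  idealised model, while the rest is generated from them by the same kernels in both.\<close>

definition "bad_prob C D a i = pexp (kBE a) (\<lambda>(b, e). pexp unifK (\<lambda>\<kappa>. pexp (kY (sat D i \<kappa>))
   (\<lambda>y. of_bool (bad C D i \<kappa> a b e y))))"

lemma set_unifK: "set_pmf unifK = {..<NK}"
  unfolding unifK_def using N by (subst set_pmf_of_set) auto

lemma fin_derived [simp]: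
  "finite (set_pmf (kAU u))" "finite (set_pmf pA)" "finite (set_pmf (kB v))" "finite (set_pmf (kBU u))"
  "finite (set_pmf pB)" "finite (set_pmf (kEU u))" "finite (set_pmf (kY t))" "finite (set_pmf (kYQ q))"
  "finite (set_pmf pY)" "finite (set_pmf (kZ t))" "finite (set_pmf (kZQ q))"
  "finite (set_pmf src)" "finite (set_pmf chn)" "finite (set_pmf pABE)"
  "finite (set_pmf src_code)" "finite (set_pmf chn_code)" "finite Idx" "finite (set_pmf unifK)"
  using fin fin' N
  by (auto simp: kAU_def pA_def kB_def kBU_def pB_def kEU_def kY_def kYQ_def pY_def kZ_def kZQ_def src_def
      chn_def pABE_def src_code_def chn_code_def Idx_def set_unifK finite_superposition_code)

lemmas [simp] = fin fin'

lemma Idx_ne: "Idx \<noteq> {}" using N by (auto simp: Idx_def)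

lemma finite_unif_Idx [simp]: "finite (set_pmf (pmf_of_set Idx))"
  using Idx_ne by simp

lemma pexp_unifK_Pi:
  "pexp (Pi_pmf {..<NK} undefined (\<lambda>_. kT q)) (\<lambda>w. pexp unifK (\<lambda>\<kappa>. g (w \<kappa>))) = pexp (kT q) g"
proof -
  have "pexp (Pi_pmf {..<NK} undefined (\<lambda>_. kT q)) (\<lambda>w. pexp unifK (\<lambda>\<kappa>. g (w \<kappa>)))
      = pexp unifK (\<lambda>\<kappa>. pexp (Pi_pmf {..<NK} undefined (\<lambda>_. kT q)) (\<lambda>w. g (w \<kappa>)))"
    by (intro pexp_commute) simp_all
  also have "\<dots> = pexp unifK (\<lambda>\<kappa>. pexp (kT q) g)"
    by (intro pexp_cong pexp_Pi_single) (auto simp: set_unifK)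
  finally show ?thesis by simp
qed

lemma source_confusion:
  assumes "i \<in> Idx" "i' \<in> Idx" "i' \<noteq> i"
  shows "pexp src_code (\<lambda>C. pexp (kB (sat C i)) (\<lambda>b. of_bool (testB (cloud C i') (sat C i') b)))
    \<le> (if fst i = fst i' then 1 / \<tau>b2 else 1 / \<tau>b1)"
proof (cases "fst i = fst i'")
  case True
  hence "snd i \<noteq> snd i'" using assms by (auto simp: prod_eq_iff)
  thus ?thesis unfolding src_code_def sat_def cloud_def using True assms pos
    by (auto simp: Idx_def testB_def kBU_def pmf_bind_pexp
        intro!: wrong_inner_codeword[where f = "\<lambda>v b. pmf (kB v) b"])
next
  case False
  thus ?thesis unfolding src_code_def sat_def cloud_def using assms pos
    by (auto simp: Idx_def testB_def pB_def kBU_def[abs_def] pmf_bind_pexp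
        intro!: wrong_outer_codeword[where f = "\<lambda>v b. pmf (kB v) b"])
qed

text \<open>Bob tests individual words, whereas the word sent is a uniform member of its family. The
  whole family is taken as the satellite, \<open>kW\<close> as its emission kernel, and the
  likelihood of member \<kappa>' as \<open>f\<close>.\<close>

lemma channel_confusion:
  assumes "i \<in> Idx" "i' \<in> Idx" "i' \<noteq> i" "\<kappa>' < NK"
  shows "pexp chn_code (\<lambda>D. pexp unifK (\<lambda>\<kappa>. pexp (kY (sat D i \<kappa>)) (\<lambda>y. of_bool (testY (cloud D i') (sat D i' \<kappa>') y))))
    \<le> (if fst i = fst i' then 1 / \<tau>y2 else 1 / \<tau>y1)"
proof -
  define kW where "kW w = bind_pmf unifK (\<lambda>\<kappa>. kY (w \<kappa>))" for w
  let ?P = "\<lambda>q. Pi_pmf {..<NK} undefined (\<lambda>_. kT q)"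
  define f where "f w y = pmf (kY (w \<kappa>')) y" for w y
  have finW: "finite (set_pmf (kW w))" for w by (simp add: kW_def)
  have finP: "finite (set_pmf (?P q))" for q by simp
  have f0: "0 \<le> f w y" for w y by (simp add: f_def)
  have kYQ: "bind_pmf (?P q) kW = kYQ q" for q
  proof (rule pmf_eqI)
    fix y
    show "pmf (bind_pmf (?P q) kW) y = pmf (kYQ q) y"
      by (simp add: pmf_bind_pexp kW_def kYQ_def pexp_unifK_Pi[where g = "\<lambda>t. pmf (kY t) y"])
  qed
  \<comment> \<open>Averaged over the family, the likelihood of one member is already
    \<open>kYQ q\<close>, so the requirement on \<open>f\<close> holds with equality.\<close>
  have fle: "pexp (?P q) (\<lambda>w. f w y) \<le> pmf (bind_pmf (?P q) kW) y" for q y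
    unfolding kYQ f_def using assms(4)
    by (simp add: kYQ_def pmf_bind_pexp pexp_Pi_single[where h = "\<lambda>t. pmf (kY t) y"])
  have eq: "pexp unifK (\<lambda>\<kappa>. pexp (kY (w \<kappa>)) g) = pexp (kW w) g" for w g
    by (simp add: kW_def pexp_bind)
  show ?thesis
  proof (cases "fst i = fst i'")
    case True
    hence ne: "snd i \<noteq> snd i'" using assms by (auto simp: prod_eq_iff)
    have "pexp chn_code (\<lambda>D. pexp (kW (snd (D (fst i)) (snd i))) (\<lambda>y. of_bool (testY (fst (D (fst i))) (snd (D (fst i)) (snd i') \<kappa>') y)))
        \<le> 1 / \<tau>y2"
      unfolding chn_code_def using assms pos ne True
      by (intro wrong_inner_codeword[OF fin'(1) finP finW f0 fle, where T = "\<lambda>q w y. testY q (w \<kappa>') y"])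
         (auto simp: Idx_def testY_def kYQ f_def)
    thus ?thesis using True by (simp add: eq sat_def cloud_def)
  next
    case False
    have "pexp chn_code (\<lambda>D. pexp (kW (snd (D (fst i)) (snd i))) (\<lambda>y. of_bool (testY (fst (D (fst i'))) (snd (D (fst i')) (snd i') \<kappa>') y)))
        \<le> 1 / \<tau>y1"
      unfolding chn_code_def using assms pos False
      by (intro wrong_outer_codeword[OF fin'(1) finP finW f0 fle, where T = "\<lambda>q w y. testY q (w \<kappa>') y"])
         (auto simp: Idx_def testY_def kYQ pY_def f_def)
    thus ?thesis using False by (simp add: eq sat_def cloud_def)
  qed
qed

end

section \<open>Error probability averaged over the codebooks\<close>

context one_shot begin

text \<open>The second term vanishes when there is a single inner word; in that case the inner rates may have no slack.\<close>
definition "confusion_bound = real NS * real N2 * real NK / (\<tau>b1 * \<tau>y1) + (real N2 - 1) * real NK / (\<tau>b2 * \<tau>y2)"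

text \<open>At most N2 - 1 wrong indices share the cloud of i; for those outside, the number NS * N2
  of all indices is used as a bound.\<close>

lemma confusion_sum:
  assumes i: "i \<in> Idx"
  shows "(\<Sum>i'\<in>Idx - {i}. \<Sum>\<kappa>'<NK. (if fst i = fst i' then 1 / \<tau>b2 else 1 / \<tau>b1) * (if fst i = fst i' then 1 / \<tau>y2 else 1 / \<tau>y1))
    \<le> confusion_bound"
proof -
  let ?S = "{i'\<in>Idx - {i}. fst i = fst i'}" and ?D = "{i'\<in>Idx - {i}. fst i \<noteq> fst i'}"
  have "(\<Sum>i'\<in>Idx - {i}. \<Sum>\<kappa>'<NK. (if fst i = fst i' then 1 / \<tau>b2 else 1 / \<tau>b1) * (if fst i = fst i' then 1 / \<tau>y2 else 1 / \<tau>y1))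
      = (\<Sum>i'\<in>Idx - {i}. if fst i = fst i' then real NK * (1 / (\<tau>b2 * \<tau>y2)) else real NK * (1 / (\<tau>b1 * \<tau>y1)))"
    by (intro sum.cong) auto
  also have "\<dots> = real (card ?S) * (real NK * (1 / (\<tau>b2 * \<tau>y2))) + real (card ?D) * (real NK * (1 / (\<tau>b1 * \<tau>y1)))"
    by (subst sum.If_cases) (auto simp: Int_def Collect_conj_eq[symmetric] Diff_eq intro!: arg_cong2[of _ _ _ _ "(+)"] arg_cong2[of _ _ _ _ "(*)"])
  also have "\<dots> \<le> (real N2 - 1) * (real NK * (1 / (\<tau>b2 * \<tau>y2))) + (real NS * real N2) * (real NK * (1 / (\<tau>b1 * \<tau>y1)))"
  proof (intro add_mono mult_right_mono)
    have "?S \<subseteq> Pair (fst i) ` ({..<N2} - {snd i})"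
      by (auto simp: Idx_def prod_eq_iff image_iff)
    hence "card ?S \<le> card (Pair (fst i) ` ({..<N2} - {snd i}))" by (intro card_mono) auto
    also have "\<dots> \<le> card ({..<N2} - {snd i})" by (intro card_image_le) auto
    also have "\<dots> = N2 - 1" using i by (auto simp: Idx_def)
    finally show "real (card ?S) \<le> real N2 - 1" using N by linarith
    have "card ?D \<le> card Idx" by (intro card_mono) auto
    thus "real (card ?D) \<le> real NS * real N2" by (simp add: Idx_def flip: of_nat_mult)
  qed (use pos in auto)
  finally show ?thesis by (simp add: confusion_bound_def)
qed

text \<open>A union bound over wrong pairs (i', \<kappa>'). Given the index, b and y are
  independent, so each joint test factors into a term depending on C and a term depending on D,
  which can then be averaged separately.\<close>

lemma bad_prob_le:
  "pexp (kA (sat C i)) (\<lambda>a. bad_prob C D a i)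
    \<le> pexp (kA (sat C i)) (\<lambda>a. pexp (kBE a) (\<lambda>(b, e). of_bool (\<not> G2 (cloud C i) (sat C i) a b e)))
     + pexp unifK (\<lambda>\<kappa>. pexp (kY (sat D i \<kappa>)) (\<lambda>y. of_bool (\<not> testY (cloud D i) (sat D i \<kappa>) y)))
     + (\<Sum>i'\<in>Idx - {i}. \<Sum>\<kappa>'<NK. pexp (kB (sat C i)) (\<lambda>b. of_bool (testB (cloud C i') (sat C i') b))
          * pexp unifK (\<lambda>\<kappa>. pexp (kY (sat D i \<kappa>)) (\<lambda>y. of_bool (testY (cloud D i') (sat D i' \<kappa>') y))))"
  (is "_ \<le> ?X + ?Y + ?Z")
proof -
  define tb :: "nat \<times> nat \<Rightarrow> 'b \<Rightarrow> real" where "tb i' b = of_bool (testB (cloud C i') (sat C i') b)" for i' b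
  define ty :: "nat \<times> nat \<Rightarrow> nat \<Rightarrow> 'y \<Rightarrow> real" where "ty i' \<kappa>' y = of_bool (testY (cloud D i') (sat D i' \<kappa>') y)" for i' \<kappa>' y
  have t0: "0 \<le> tb i' b * ty i' \<kappa>' y" for i' \<kappa>' b y by (simp add: tb_def ty_def)
  have pt: "of_bool (bad C D i \<kappa> a b e y) \<le> of_bool (\<not> G2 (cloud C i) (sat C i) a b e)
      + of_bool (\<not> testY (cloud D i) (sat D i \<kappa>) y) + (\<Sum>i'\<in>Idx - {i}. \<Sum>\<kappa>'<NK. tb i' b * ty i' \<kappa>' y)"
    for \<kappa> a b e y
  proof (cases "confused C D i b y")
    case True
    then obtain i' \<kappa>' where "i' \<in> Idx - {i}" "\<kappa>' < NK" "pass C D i' \<kappa>' b y"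
      by (auto simp: confused_def)
    hence "1 \<le> tb i' b * ty i' \<kappa>' y" by (simp add: pass_def tb_def ty_def)
    also have "\<dots> \<le> (\<Sum>\<kappa>'<NK. tb i' b * ty i' \<kappa>' y)"
      using \<open>\<kappa>' < NK\<close> by (intro member_le_sum t0) auto
    also have "\<dots> \<le> (\<Sum>i'\<in>Idx - {i}. \<Sum>\<kappa>'<NK. tb i' b * ty i' \<kappa>' y)"
      using \<open>i' \<in> Idx - {i}\<close> by (intro member_le_sum sum_nonneg t0) auto
    finally have "1 \<le> (\<Sum>i'\<in>Idx - {i}. \<Sum>\<kappa>'<NK. tb i' b * ty i' \<kappa>' y)" .
    moreover have "of_bool (bad C D i \<kappa> a b e y) \<le> (1::real)" by simp
    ultimately show ?thesis by (smt (verit) zero_less_eq_of_bool)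
  next
    case False
    have "0 \<le> (\<Sum>i'\<in>Idx - {i}. \<Sum>\<kappa>'<NK. tb i' b * ty i' \<kappa>' y)" by (intro sum_nonneg t0)
    thus ?thesis using False by (auto simp: bad_def of_bool_def)
  qed
  have "pexp (kA (sat C i)) (\<lambda>a. bad_prob C D a i)
      \<le> pexp (kA (sat C i)) (\<lambda>a. pexp (kBE a) (\<lambda>(b, e). pexp unifK (\<lambda>\<kappa>. pexp (kY (sat D i \<kappa>))
      (\<lambda>y. of_bool (\<not> G2 (cloud C i) (sat C i) a b e)
      + of_bool (\<not> testY (cloud D i) (sat D i \<kappa>) y) + (\<Sum>i'\<in>Idx - {i}. \<Sum>\<kappa>'<NK. tb i' b * ty i' \<kappa>' y)))))"
    unfolding bad_prob_def case_prod_unfold using pt by (intro pexp_mono) auto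
  also have "\<dots> = ?X + ?Y + (\<Sum>i'\<in>Idx - {i}. \<Sum>\<kappa>'<NK. pexp (kA (sat C i)) (\<lambda>a. pexp (kBE a) (\<lambda>(b, e). tb i' b))
          * pexp unifK (\<lambda>\<kappa>. pexp (kY (sat D i \<kappa>)) (\<lambda>y. ty i' \<kappa>' y)))"
    by (simp add: case_prod_unfold pexp_add pexp_sum pexp_cmult pexp_multc)
  also have "\<dots> = ?X + ?Y + (\<Sum>i'\<in>Idx - {i}. \<Sum>\<kappa>'<NK. pexp (kB (sat C i)) (tb i')
          * pexp unifK (\<lambda>\<kappa>. pexp (kY (sat D i \<kappa>)) (ty i' \<kappa>')))"
    unfolding kB_def by (simp add: pexp_bind case_prod_unfold)
  finally show ?thesis unfolding tb_def[abs_def] ty_def[abs_def] .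
qed

lemma pexp_src_code_single:
  assumes "i \<in> Idx"
  shows "pexp src_code (\<lambda>C. g (cloud C i) (sat C i)) = pexp pU (\<lambda>u. pexp (kV u) (g u))"
  unfolding src_code_def cloud_def sat_def using assms
  by (intro superposition_code_single) (auto simp: Idx_def)

lemma pexp_chn_code_single:
  assumes "i \<in> Idx"
  shows "pexp chn_code (\<lambda>D. g (cloud D i) (sat D i)) = pexp pQ (\<lambda>q. pexp (Pi_pmf {..<NK} undefined (\<lambda>_. kT q)) (g q))"
  unfolding chn_code_def cloud_def sat_def using assms
  by (intro superposition_code_single) (auto simp: Idx_def)

text \<open>In the idealised model the index is independent of both codebooks. It can be averaged
  last, and each fixed index sees exactly the random-coding laws.\<close>

lemma ideal_bad_le:
  "pexp src_code (\<lambda>C. pexp chn_code (\<lambda>D. pexp (pmf_of_set Idx) (\<lambda>i. pexp (kA (sat C i)) (\<lambda>a. bad_prob C D a i))))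
    \<le> pexp src (\<lambda>(u, v, a, b, e). of_bool (\<not> G2 u v a b e)) + pexp chn (\<lambda>(q, t, y, z). of_bool (\<not> testY q t y))
      + confusion_bound" (is "_ \<le> ?B")
proof -
  have index: "pexp src_code (\<lambda>C. pexp chn_code (\<lambda>D. pexp (kA (sat C i)) (\<lambda>a. bad_prob C D a i))) \<le> ?B"
    if i: "i \<in> Idx" for i
  proof -
    let ?X = "\<lambda>C. pexp (kA (sat C i)) (\<lambda>a. pexp (kBE a) (\<lambda>(b, e). of_bool (\<not> G2 (cloud C i) (sat C i) a b e)))"
    let ?Y = "\<lambda>D. pexp unifK (\<lambda>\<kappa>. pexp (kY (sat D i \<kappa>)) (\<lambda>y. of_bool (\<not> testY (cloud D i) (sat D i \<kappa>) y)))"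
    let ?FB = "\<lambda>i' C. pexp (kB (sat C i)) (\<lambda>b. of_bool (testB (cloud C i') (sat C i') b))"
    let ?FY = "\<lambda>i' \<kappa>' D. pexp unifK (\<lambda>\<kappa>. pexp (kY (sat D i \<kappa>)) (\<lambda>y. of_bool (testY (cloud D i') (sat D i' \<kappa>') y)))"
    have "pexp src_code (\<lambda>C. pexp chn_code (\<lambda>D. pexp (kA (sat C i)) (\<lambda>a. bad_prob C D a i)))
        \<le> pexp src_code (\<lambda>C. pexp chn_code (\<lambda>D. ?X C + ?Y D + (\<Sum>i'\<in>Idx - {i}. \<Sum>\<kappa>'<NK. ?FB i' C * ?FY i' \<kappa>' D)))"
      by (rule pexp_mono, simp, rule pexp_mono, simp, rule bad_prob_le)
    also have "\<dots> = pexp src_code ?X + pexp chn_code ?Y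
        + (\<Sum>i'\<in>Idx - {i}. \<Sum>\<kappa>'<NK. pexp src_code (?FB i') * pexp chn_code (?FY i' \<kappa>'))"
      by (simp add: pexp_add pexp_sum pexp_cmult pexp_multc)
    also have "(\<Sum>i'\<in>Idx - {i}. \<Sum>\<kappa>'<NK. pexp src_code (?FB i') * pexp chn_code (?FY i' \<kappa>'))
        \<le> (\<Sum>i'\<in>Idx - {i}. \<Sum>\<kappa>'<NK. (if fst i = fst i' then 1 / \<tau>b2 else 1 / \<tau>b1) * (if fst i = fst i' then 1 / \<tau>y2 else 1 / \<tau>y1))"
    proof (intro sum_mono mult_mono)
      fix i' \<kappa>' assume *: "i' \<in> Idx - {i}" "\<kappa>' \<in> {..<NK}"
      show "pexp src_code (?FB i') \<le> (if fst i = fst i' then 1 / \<tau>b2 else 1 / \<tau>b1)"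
        using * i by (intro source_confusion) auto
      show "pexp chn_code (?FY i' \<kappa>') \<le> (if fst i = fst i' then 1 / \<tau>y2 else 1 / \<tau>y1)"
        using * i by (intro channel_confusion) auto
    qed (use pos in \<open>auto intro!: pexp_nonneg\<close>)
    also have "\<dots> \<le> confusion_bound" by (rule confusion_sum[OF i])
    also have "pexp src_code ?X = pexp src (\<lambda>(u, v, a, b, e). of_bool (\<not> G2 u v a b e))"
      by (subst pexp_src_code_single[OF i, where g = "\<lambda>u v. pexp (kA v) (\<lambda>a. pexp (kBE a) (\<lambda>(b, e). of_bool (\<not> G2 u v a b e)))"])
         (simp add: src_def pexp_bind case_prod_unfold)
    also have "pexp chn_code ?Y = pexp chn (\<lambda>(q, t, y, z). of_bool (\<not> testY q t y))"
      by (subst pexp_chn_code_single[OF i, where g = "\<lambda>q w. pexp unifK (\<lambda>\<kappa>. pexp (kY (w \<kappa>)) (\<lambda>y. of_bool (\<not> testY q (w \<kappa>) y)))"])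
         (simp add: chn_def pexp_bind case_prod_unfold kY_def
            pexp_unifK_Pi[where g = "\<lambda>t. pexp (kYZ t) (\<lambda>x. of_bool (\<not> testY _ t (fst x)))"])
    finally show ?thesis by simp
  qed
  have "pexp src_code (\<lambda>C. pexp chn_code (\<lambda>D. pexp (pmf_of_set Idx) (\<lambda>i. pexp (kA (sat C i)) (\<lambda>a. bad_prob C D a i))))
      = pexp (pmf_of_set Idx) (\<lambda>i. pexp src_code (\<lambda>C. pexp chn_code (\<lambda>D. pexp (kA (sat C i)) (\<lambda>a. bad_prob C D a i))))"
    by (subst pexp_commute[of "pmf_of_set Idx" src_code], simp, simp,
        subst pexp_commute[of "pmf_of_set Idx" chn_code]) simp_all
  also have "\<dots> \<le> ?B"
    using Idx_ne by (intro pexp_le_const index) auto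
  finally show ?thesis .
qed

section \<open>Likelihood encoder and leakage\<close>

definition "deficit C = (\<Sum>a\<in>set_pmf pA. max 0 (pmf pA a - pmf (code_mixture NS N2 kA C) a))"

text \<open>The likelihood encoder: the posterior distribution of the index given the source word, under the
  idealised law in which the index is uniform and the source word is emitted by the codeword.\<close>
definition enc_idx :: "(nat \<Rightarrow> 'u \<times> (nat \<Rightarrow> 'v)) \<Rightarrow> 'a \<Rightarrow> (nat \<times> nat) pmf" where
  "enc_idx C = cond_kernel (bind_pmf (pmf_of_set Idx) (\<lambda>i. map_pmf (\<lambda>a. (a, i)) (kA (sat C i))))"

lemma set_enc_idx: "set_pmf (enc_idx C a) \<subseteq> Idx"
  unfolding enc_idx_def using Idx_ne by (intro order.trans[OF set_cond_kernel]) auto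

lemma finite_enc_idx [simp]: "finite (set_pmf (enc_idx C a))"
  using set_enc_idx by (rule finite_subset) simp

text \<open>Fed with the mixture law, the posterior encoder reproduces the idealised joint law of
  source word and index exactly; replacing the mixture by \<open>pA\<close> costs the deficit and
  nothing else.\<close>

lemma enc_idx_change_of_measure:
  assumes f: "\<And>a i. 0 \<le> f a i" "\<And>a i. f a i \<le> 1"
  shows "pexp pA (\<lambda>a. pexp (enc_idx C a) (f a))
    \<le> deficit C + pexp (pmf_of_set Idx) (\<lambda>i. pexp (kA (sat C i)) (\<lambda>a. f a i))"
proof -
  let ?J = "bind_pmf (pmf_of_set Idx) (\<lambda>i. map_pmf (\<lambda>a. (a, i)) (kA (sat C i)))"
  let ?M = "code_mixture NS N2 kA C"
  have M: "map_pmf fst ?J = ?M"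
    by (simp add: code_mixture_def Idx_def sat_def map_bind_pmf map_pmf_comp case_prod_unfold)
  have finM: "finite (set_pmf ?M)" unfolding M[symmetric] by (simp add: Idx_ne)
  have "pexp ?M (\<lambda>a. pexp (enc_idx C a) (f a)) = pexp (bind_pmf ?M (\<lambda>a. map_pmf (Pair a) (enc_idx C a))) (\<lambda>(a, i). f a i)"
    using finM by (subst pexp_bind) auto
  also have "bind_pmf ?M (\<lambda>a. map_pmf (Pair a) (enc_idx C a)) = ?J"
    unfolding M[symmetric] enc_idx_def by (rule bind_cond_kernel)
  also have "pexp ?J (\<lambda>(a, i). f a i) = pexp (pmf_of_set Idx) (\<lambda>i. pexp (kA (sat C i)) (\<lambda>a. f a i))"
    by (subst pexp_bind) (auto simp: Idx_ne)
  finally have eq: "pexp ?M (\<lambda>a. pexp (enc_idx C a) (f a)) = \<dots>" .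
  have "pexp pA (\<lambda>a. pexp (enc_idx C a) (f a)) \<le> pexp ?M (\<lambda>a. pexp (enc_idx C a) (f a)) + deficit C"
    unfolding deficit_def using f finM
    by (intro pexp_change_of_measure pexp_nonneg pexp_le_const) auto
  thus ?thesis by (simp add: eq)
qed

definition "eve_out D i = bind_pmf unifK (\<lambda>\<kappa>. kZ (sat D i \<kappa>))"
definition "divergence D i = pexp (eve_out D i) (\<lambda>z. log 2 (pmf (eve_out D i) z / pmf (kZQ (cloud D i)) z))"
definition "leakage = pexp chn (\<lambda>(q, t, y, z). log 2 (1 + pmf (kZ t) z / (real NK * pmf (kZQ q) z)))"

lemma finite_eve_out [simp]: "finite (set_pmf (eve_out D i))"
  by (simp add: eve_out_def)

lemma chn_code_support:
  assumes "D \<in> set_pmf chn_code" "i \<in> Idx"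
  shows "cloud D i \<in> set_pmf pQ" "\<kappa> < NK \<Longrightarrow> sat D i \<kappa> \<in> set_pmf (kT (cloud D i))"
  using superposition_code_support[OF assms(1)[unfolded chn_code_def], of "fst i" "snd i"] assms(2)
  by (auto simp: Idx_def cloud_def sat_def set_Pi_pmf PiE_dflt_def)

lemma set_eve_out:
  assumes "D \<in> set_pmf chn_code" "i \<in> Idx"
  shows "set_pmf (eve_out D i) \<subseteq> set_pmf (kZQ (cloud D i))"
  using chn_code_support(2)[OF assms] by (auto simp: eve_out_def kZQ_def set_unifK)

lemma divergence_nonneg:
  assumes "D \<in> set_pmf chn_code" "i \<in> Idx"
  shows "0 \<le> divergence D i"
  unfolding divergence_def using set_eve_out[OF assms] by (intro gibbs_pmf) simp_all

text \<open>Given a centre q, the family of words is i.i.d. from \<open>kT q\<close>, so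
  resolvability applies within the cloud, with target \<open>kZQ q\<close>.\<close>

lemma expected_divergence_le:
  assumes i: "i \<in> Idx"
  shows "pexp chn_code (\<lambda>D. divergence D i) \<le> leakage"
proof -
  define \<zeta> where "\<zeta> w = bind_pmf unifK (\<lambda>\<kappa>. kZ (w \<kappa>))" for w
  have "pexp chn_code (\<lambda>D. divergence D i)
      = pexp chn_code (\<lambda>D. pexp (\<zeta> (sat D i)) (\<lambda>z. log 2 (pmf (\<zeta> (sat D i)) z / pmf (kZQ (cloud D i)) z)))"
    by (simp add: divergence_def eve_out_def \<zeta>_def)
  also have "\<dots> = pexp pQ (\<lambda>q. pexp (Pi_pmf {..<NK} undefined (\<lambda>_. kT q)) (\<lambda>w. pexp (\<zeta> w) (\<lambda>z. log 2 (pmf (\<zeta> w) z / pmf (kZQ q) z))))"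
    by (rule pexp_chn_code_single[OF i, where g = "\<lambda>q w. pexp (\<zeta> w) (\<lambda>z. log 2 (pmf (\<zeta> w) z / pmf (kZQ q) z))"])
  also have "\<dots> \<le> pexp pQ (\<lambda>q. pexp (kT q) (\<lambda>t. pexp (kZ t) (\<lambda>z. log 2 (1 + pmf (kZ t) z / (real NK * pmf (kZQ q) z)))))"
    using N by (intro pexp_mono resolvability_divergence) (auto simp: kZQ_def \<zeta>_def unifK_def)
  also have "\<dots> = leakage"
    by (simp add: leakage_def chn_def pexp_bind case_prod_unfold kZ_def)
  finally show ?thesis .
qed

end

section \<open>Decoding and equivocation for a fixed pair of codebooks\<close>

context one_shot begin

definition "err \<eta> = pexp src (\<lambda>(u, v, a, b, e). of_bool (\<not> G1 u v a)) + \<eta>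
   + (\<gamma>1 / real NS + \<gamma>2 / (real NS * real N2)) / \<eta>
   + (pexp src (\<lambda>(u, v, a, b, e). of_bool (\<not> G2 u v a b e)) + pexp chn (\<lambda>(q, t, y, z). of_bool (\<not> testY q t y))
      + confusion_bound)"

definition "actual_bad C D = pexp pA (\<lambda>a. pexp (enc_idx C a) (bad_prob C D a))"

definition "enc_word C D a = bind_pmf (enc_idx C a) (\<lambda>i. map_pmf (sat D i) unifK)"

lemma expected_deficit_le:
  assumes "0 < \<eta>"
  shows "pexp src_code deficit \<le> pexp src (\<lambda>(u, v, a, b, e). of_bool (\<not> G1 u v a)) + \<eta>
     + (\<gamma>1 / real NS + \<gamma>2 / (real NS * real N2)) / \<eta>"
proof -
  have "pexp src_code deficit \<le> pexp pU (\<lambda>u. pexp (kV u) (\<lambda>v. pexp (kA v) (\<lambda>a. of_bool (\<not> G1 u v a)))) + \<eta>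
     + (\<gamma>1 / real NS + \<gamma>2 / (real NS * real N2)) / \<eta>"
    unfolding deficit_def src_code_def using N pos assms
    by (intro soft_covering) (auto simp: pA_def kAU_def[abs_def] G1_def)
  thus ?thesis by (simp add: src_def pexp_bind case_prod_unfold)
qed

lemma finite_enc_word [simp]: "finite (set_pmf (enc_word C D a))"
  by (simp add: enc_word_def)

text \<open>Holds for every source word, including those of probability zero; this later fixes the
  length of the encoder output without exception.\<close>

lemma set_enc_word:
  assumes "D \<in> set_pmf chn_code"
  shows "set_pmf (enc_word C D a) \<subseteq> (\<Union>q\<in>set_pmf pQ. set_pmf (kT q))"
proof
  fix t assume "t \<in> set_pmf (enc_word C D a)"
  then obtain i \<kappa> where "i \<in> set_pmf (enc_idx C a)" "\<kappa> < NK" "t = sat D i \<kappa>"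
    by (auto simp: enc_word_def set_unifK)
  moreover from this have "i \<in> Idx" using set_enc_idx by auto
  ultimately show "t \<in> (\<Union>q\<in>set_pmf pQ. set_pmf (kT q))"
    using chn_code_support[OF assms, of i] by auto
qed

lemma bad_prob_bounds: "0 \<le> bad_prob C D a i" "bad_prob C D a i \<le> 1"
  unfolding bad_prob_def case_prod_unfold
  by (auto intro!: pexp_nonneg pexp_le_const)

text \<open>Bob wants only the index (s,j), so any \<kappa> may witness the test. Outside the bad
  event the true index passes and no other does.\<close>

lemma decoding:
  assumes "i \<in> Idx" "\<kappa> < NK" "\<not> bad C D i \<kappa> a b e y"
  shows "(SOME i. i \<in> Idx \<and> (\<exists>\<kappa><NK. pass C D i \<kappa> b y)) = i"
proof (rule some_equality)
  show "i \<in> Idx \<and> (\<exists>\<kappa><NK. pass C D i \<kappa> b y)"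
    using assms by (auto simp: bad_def pass_def G2_def)
  show "i' = i" if "i' \<in> Idx \<and> (\<exists>\<kappa><NK. pass C D i' \<kappa> b y)" for i'
    using that assms by (auto simp: bad_def confused_def)
qed

lemma pexp_code_law:
  "pexp (code_law (enc_word C D)) g = pexp pA (\<lambda>a. pexp (kBE a) (\<lambda>(b, e). pexp (enc_idx C a) (\<lambda>i.
     pexp unifK (\<lambda>\<kappa>. pexp (kYZ (sat D i \<kappa>)) (\<lambda>(y, z). g (a, b, e, y, z))))))"
  by (simp add: code_law_def pABE_def enc_word_def pexp_bind case_prod_unfold)

text \<open>Where the index is decoded correctly, an unacceptable reconstruction is itself a case of
  \<open>bad\<close>, because \<open>Gd\<close> is part of \<open>G2\<close>.\<close>

lemma decoding_error_le:
  "pexp (code_law (enc_word C D)) (\<lambda>(a, b, e, y, z).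
      of_bool (\<not> Gd (sat C (SOME i. i \<in> Idx \<and> (\<exists>\<kappa><NK. pass C D i \<kappa> b y))) a b)) \<le> actual_bad C D"
proof -
  let ?i = "\<lambda>b y. SOME i. i \<in> Idx \<and> (\<exists>\<kappa><NK. pass C D i \<kappa> b y)"
  have "pexp (code_law (enc_word C D)) (\<lambda>(a, b, e, y, z). of_bool (\<not> Gd (sat C (?i b y)) a b))
      \<le> pexp pA (\<lambda>a. pexp (kBE a) (\<lambda>(b, e). pexp (enc_idx C a) (\<lambda>i.
     pexp unifK (\<lambda>\<kappa>. pexp (kYZ (sat D i \<kappa>)) (\<lambda>(y, z). of_bool (bad C D i \<kappa> a b e y))))))"
    unfolding pexp_code_law case_prod_unfold
  proof (intro pexp_mono)
    fix a be i \<kappa> yz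
    assume "i \<in> set_pmf (enc_idx C a)" "\<kappa> \<in> set_pmf unifK"
    hence *: "i \<in> Idx" "\<kappa> < NK" using set_enc_idx by (auto simp: set_unifK)
    show "of_bool (\<not> Gd (sat C (?i (fst (snd (a, fst be, snd be, fst yz, snd yz)))
         (fst (snd (snd (snd (a, fst be, snd be, fst yz, snd yz)))))))
         (fst (a, fst be, snd be, fst yz, snd yz)) (fst (snd (a, fst be, snd be, fst yz, snd yz))))
       \<le> (of_bool (bad C D i \<kappa> a (fst be) (snd be) (fst yz)) :: real)"
      using decoding[OF *, of C D a "fst be" "snd be" "fst yz"]
      by (cases "bad C D i \<kappa> a (fst be) (snd be) (fst yz)") (auto simp: bad_def G2_def)
  qed simp_all
  also have "\<dots> = actual_bad C D"
    unfolding actual_bad_def bad_prob_def case_prod_unfold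
    by (subst pexp_commute[of "kBE _" "enc_idx C _"]) (simp_all add: kY_def)
  finally show ?thesis .
qed

text \<open>The equivocation bound with S the outer index. The cross entropy of Eve's side
  information is at most 1 + h where her symbol is likely given the centre, and at most 1 plus the
  logarithm of the number of its values in any case; the latter is charged to the bad event.\<close>

lemma equivocation_le:
  assumes D: "D \<in> set_pmf chn_code"
  shows "ent pAE - log 2 (real NS) - (1 + h + actual_bad C D * log 2 (real (card (snd ` set_pmf pAE))))
      - pexp pA (\<lambda>a. pexp (enc_idx C a) (divergence D))
    \<le> cond_ent (code_law (enc_word C D)) (\<lambda>(a, b, e, y, z). a) (\<lambda>(a, b, e, y, z). (e, z))"
proof -
  let ?SE = "snd ` set_pmf pAE"
  define c where "c = real (card ?SE)"
  have finAE: "finite (set_pmf pAE)" by (simp add: pAE_def)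
  have "card ?SE \<noteq> 0" using finAE by (simp add: set_pmf_not_empty)
  hence c: "1 \<le> c" by (simp add: c_def)
  \<comment> \<open>Mixing with the uniform law keeps the cross entropy finite where the true law leaves the support of the
    idealised one, at the price of one bit.\<close>
  define R where "R s e = pmf (kEU (fst (C s))) e / 2 + 1 / (2 * c)" for s :: nat and e
  define \<rho> where "\<rho> s = kZQ (fst (D s))" for s :: nat
  define \<Gamma> where "\<Gamma> = bind_pmf pAE (\<lambda>(a, e). bind_pmf (enc_idx C a) (\<lambda>i. map_pmf (\<lambda>z. (a, e, i, z)) (eve_out D i)))"
  have pexp\<Gamma>: "pexp \<Gamma> g = pexp pA (\<lambda>a. pexp (enc_idx C a) (\<lambda>i. pexp (kBE a) (\<lambda>(b, e). pexp (eve_out D i) (\<lambda>z. g (a, e, i, z)))))" for g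
    unfolding \<Gamma>_def pAE_def pABE_def case_prod_unfold
    by (subst pexp_commute[of "enc_idx C _" "kBE _"]) (simp_all add: pexp_bind map_bind_pmf map_pmf_comp bind_map_pmf)
  have "ent pAE - log 2 (real NS) - pexp \<Gamma> (\<lambda>(a, e, i, z). - log 2 (R (fst i) e))
      - pexp \<Gamma> (\<lambda>(a, e, i, z). log 2 (pmf (eve_out D i) z / pmf (\<rho> (fst i)) z))
    \<le> cond_ent \<Gamma> (\<lambda>(a, e, i, z). a) (\<lambda>(a, e, i, z). (e, z))"
  proof (rule equivocation_bound[where \<sigma> = fst and enc = "enc_idx C"])
    show "fst i < NS" if "i \<in> set_pmf (enc_idx C a)" for a i
      using that set_enc_idx[of C a] by (auto simp: Idx_def)
    show "0 < R s e" for s e using c by (simp add: R_def add_nonneg_pos)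
    show "(\<Sum>e\<in>?SE. R s e) \<le> 1" for s
    proof -
      have "(\<Sum>e\<in>?SE. R s e) = (\<Sum>e\<in>?SE. pmf (kEU (fst (C s))) e) / 2 + c * (1 / (2 * c))"
        by (simp add: R_def sum.distrib sum_divide_distrib c_def)
      also have "(\<Sum>e\<in>?SE. pmf (kEU (fst (C s))) e) = measure_pmf.prob (kEU (fst (C s))) ?SE"
        using finAE by (simp add: measure_measure_pmf_finite)
      also have "\<dots> \<le> 1" by simp
      finally show ?thesis using c by simp
    qed
    show "set_pmf (eve_out D i) \<subseteq> set_pmf (\<rho> (fst i))" if "i \<in> set_pmf (enc_idx C a)" for a i
      using set_eve_out[OF D, of i] that set_enc_idx[of C a] by (auto simp: \<rho>_def cloud_def)
  qed (simp_all add: finAE \<rho>_def \<Gamma>_def)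
  moreover have "pexp \<Gamma> (\<lambda>(a, e, i, z). log 2 (pmf (eve_out D i) z / pmf (\<rho> (fst i)) z))
      = pexp pA (\<lambda>a. pexp (enc_idx C a) (divergence D))"
    by (simp add: pexp\<Gamma> divergence_def[abs_def] \<rho>_def cloud_def case_prod_unfold)
  moreover have "pexp \<Gamma> (\<lambda>(a, e, i, z). - log 2 (R (fst i) e)) \<le> 1 + h + actual_bad C D * log 2 c"
  proof -
    have "pexp \<Gamma> (\<lambda>(a, e, i, z). - log 2 (R (fst i) e))
        \<le> pexp pA (\<lambda>a. pexp (enc_idx C a) (\<lambda>i. 1 + h + bad_prob C D a i * log 2 c))"
      unfolding pexp\<Gamma>
    proof (rule pexp_mono, simp, rule pexp_mono, simp)
      fix a i
      \<comment> \<open>If e is unlikely given the centre, every \<kappa> and y is bad, so the inner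
        probability equals 1 and pays for the full logarithm.\<close>
      have R_le: "- log 2 (R (fst i) e) \<le> 1 + h + pexp unifK (\<lambda>\<kappa>. pexp (kY (sat D i \<kappa>))
         (\<lambda>y. of_bool (bad C D i \<kappa> a b e y))) * log 2 c" for b e
      proof (cases "2 powr (- h) \<le> pmf (kEU (cloud C i)) e")
        case True
        have "2 powr (- h - 1) \<le> R (fst i) e"
          using True c by (auto simp: R_def cloud_def powr_diff intro!: add_increasing2)
        hence "- h - 1 \<le> log 2 (R (fst i) e)"
          by (smt (verit) le_log_iff powr_gt_zero)
        moreover have "0 \<le> pexp unifK (\<lambda>\<kappa>. pexp (kY (sat D i \<kappa>)) (\<lambda>y. of_bool (bad C D i \<kappa> a b e y))) * log 2 c"
          using c by (intro mult_nonneg_nonneg pexp_nonneg) auto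
        ultimately show ?thesis by linarith
      next
        case False
        hence "bad C D i \<kappa> a b e y" for \<kappa> y by (simp add: bad_def G2_def)
        hence one: "pexp unifK (\<lambda>\<kappa>. pexp (kY (sat D i \<kappa>)) (\<lambda>y. of_bool (bad C D i \<kappa> a b e y))) = 1" by simp
        have "log 2 (1 / (2 * c)) \<le> log 2 (R (fst i) e)"
          using c by (subst log_le_cancel_iff) (auto simp: R_def add_nonneg_pos)
        moreover have "log 2 (1 / (2 * c)) = - 1 - log 2 c"
          using c by (simp add: log_divide_pos log_mult_pos)
        ultimately show ?thesis unfolding one using pos by simp
      qed
      have "pexp (kBE a) (\<lambda>(b, e). pexp (eve_out D i) (\<lambda>z. case (a, e, i, z) of (a, e, i, z) \<Rightarrow> - log 2 (R (fst i) e)))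
          \<le> pexp (kBE a) (\<lambda>(b, e). 1 + h + pexp unifK (\<lambda>\<kappa>. pexp (kY (sat D i \<kappa>))
         (\<lambda>y. of_bool (bad C D i \<kappa> a b e y))) * log 2 c)"
        using R_le by (intro pexp_mono) auto
      also have "\<dots> = 1 + h + bad_prob C D a i * log 2 c"
        by (simp add: bad_prob_def case_prod_unfold pexp_add pexp_multc)
      finally show "pexp (kBE a) (\<lambda>(b, e). pexp (eve_out D i) (\<lambda>z. case (a, e, i, z) of (a, e, i, z) \<Rightarrow> - log 2 (R (fst i) e)))
          \<le> 1 + h + bad_prob C D a i * log 2 c" .
    qed
    also have "\<dots> = 1 + h + actual_bad C D * log 2 c"
      by (simp add: actual_bad_def pexp_add pexp_multc)
    finally show ?thesis .
  qed
  \<comment> \<open>The two laws agree on (a, e, z); \<open>\<Gamma>\<close> merely keeps the index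
    in place of b and y.\<close>
  moreover have "cond_ent (code_law (enc_word C D)) (\<lambda>(a, b, e, y, z). a) (\<lambda>(a, b, e, y, z). (e, z))
      = cond_ent \<Gamma> (\<lambda>(a, e, i, z). a) (\<lambda>(a, e, i, z). (e, z))"
    by (rule cond_ent_cong_map)
       (simp add: code_law_def \<Gamma>_def pAE_def enc_word_def eve_out_def kZ_def map_bind_pmf bind_map_pmf
          map_pmf_comp bind_assoc_pmf case_prod_unfold)
  ultimately show ?thesis unfolding c_def by linarith
qed

text \<open>One codebook has to be good for two criteria, of which only the error has a vanishing average. It is
  chosen to minimise the leakage plus a large multiple M of the error.\<close>
theorem one_shot_coding:
  assumes \<eta>: "0 < \<eta>" and M: "0 < M"
  obtains enc dec where "\<And>a. set_pmf (enc a) \<subseteq> (\<Union>q\<in>set_pmf pQ. set_pmf (kT q))"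
    "pexp (code_law enc) (\<lambda>(a, b, e, y, z). of_bool (\<not> Gd (dec y b) a b)) \<le> err \<eta> + leakage / M"
    "ent pAE - log 2 (real NS) - (1 + h + (err \<eta> + leakage / M) * log 2 (real (card (snd ` set_pmf pAE))))
      - (M * err \<eta> + leakage) \<le> cond_ent (code_law enc) (\<lambda>(a, b, e, y, z). a) (\<lambda>(a, b, e, y, z). (e, z))"
proof -
  define ideal where "ideal C D = pexp (pmf_of_set Idx) (\<lambda>i. pexp (kA (sat C i)) (\<lambda>a. bad_prob C D a i))" for C D
  define leak where "leak C D = pexp pA (\<lambda>a. pexp (enc_idx C a) (divergence D))" for C D
  \<comment> \<open>The index encoder depends on C alone, so D can be averaged for fixed C, a and i.
    The leakage is thus bounded directly under the true source law, without a change of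
    measure.\<close>
  have E_leak: "pexp src_code (\<lambda>C. pexp chn_code (leak C)) \<le> leakage"
  proof (rule pexp_le_const)
    fix C
    have "pexp chn_code (leak C) = pexp pA (\<lambda>a. pexp (enc_idx C a) (\<lambda>i. pexp chn_code (\<lambda>D. divergence D i)))"
      unfolding leak_def
      by (subst pexp_commute[of chn_code pA], simp, simp, subst pexp_commute[of chn_code "enc_idx C _"]) simp_all
    also have "\<dots> \<le> leakage"
    proof (rule pexp_le_const, simp, rule pexp_le_const, simp)
      fix a i assume "i \<in> set_pmf (enc_idx C a)"
      hence "i \<in> Idx" using set_enc_idx by auto
      thus "pexp chn_code (\<lambda>D. divergence D i) \<le> leakage" by (rule expected_divergence_le)
    qed
    finally show "pexp chn_code (leak C) \<le> leakage" .
  qed simp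
  have E_ideal: "pexp src_code deficit + pexp src_code (\<lambda>C. pexp chn_code (ideal C)) \<le> err \<eta>"
    unfolding err_def ideal_def using expected_deficit_le[OF \<eta>] ideal_bad_le by (intro add_mono)
  have "pexp src_code (\<lambda>C. pexp chn_code (\<lambda>D. M * (deficit C + ideal C D) + leak C D))
      = M * (pexp src_code deficit + pexp src_code (\<lambda>C. pexp chn_code (ideal C))) + pexp src_code (\<lambda>C. pexp chn_code (leak C))"
    by (simp add: pexp_add pexp_cmult)
  also have "\<dots> \<le> M * err \<eta> + leakage"
    using E_leak E_ideal M by (intro add_mono mult_left_mono) auto
  finally obtain C where "pexp chn_code (\<lambda>D. M * (deficit C + ideal C D) + leak C D) \<le> M * err \<eta> + leakage"
    by (rule pexp_witness[rotated]) auto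
  then obtain D where D: "D \<in> set_pmf chn_code" and CD: "M * (deficit C + ideal C D) + leak C D \<le> M * err \<eta> + leakage"
    by (rule pexp_witness[rotated]) auto
  \<comment> \<open>Both summands are nonnegative; dropping one bounds the other.\<close>
  have "0 \<le> leak C D"
    unfolding leak_def using set_enc_idx by (intro pexp_nonneg divergence_nonneg D) auto
  hence "deficit C + ideal C D \<le> (M * err \<eta> + leakage) / M"
    using CD M by (simp add: pos_le_divide_eq mult.commute)
  also have "\<dots> = err \<eta> + leakage / M" using M by (simp add: field_simps)
  finally have small: "deficit C + ideal C D \<le> err \<eta> + leakage / M" .
  have "actual_bad C D \<le> deficit C + ideal C D"
    unfolding actual_bad_def ideal_def by (rule enc_idx_change_of_measure) (rule bad_prob_bounds)+
  with small have bad: "actual_bad C D \<le> err \<eta> + leakage / M" by simp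
  have "0 \<le> deficit C + ideal C D"
    unfolding deficit_def ideal_def
    by (intro add_nonneg_nonneg sum_nonneg pexp_nonneg bad_prob_bounds) auto
  hence leak: "leak C D \<le> M * err \<eta> + leakage"
    using CD M by (smt (verit) mult_nonneg_nonneg)
  have "card (snd ` set_pmf pAE) \<noteq> 0" by (simp add: pAE_def set_pmf_not_empty)
  hence "0 \<le> log 2 (real (card (snd ` set_pmf pAE)))" by simp
  hence bad': "actual_bad C D * log 2 (real (card (snd ` set_pmf pAE)))
      \<le> (err \<eta> + leakage / M) * log 2 (real (card (snd ` set_pmf pAE)))"
    using bad by (intro mult_right_mono)
  show ?thesis
  proof (rule that[of "enc_word C D" "\<lambda>y b. sat C (SOME i. i \<in> Idx \<and> (\<exists>\<kappa><NK. pass C D i \<kappa> b y))"])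
    show "set_pmf (enc_word C D a) \<subseteq> (\<Union>q\<in>set_pmf pQ. set_pmf (kT q))" for a
      by (rule set_enc_word[OF D])
    show "pexp (code_law (enc_word C D)) (\<lambda>(a, b, e, y, z).
        of_bool (\<not> Gd (sat C (SOME i. i \<in> Idx \<and> (\<exists>\<kappa><NK. pass C D i \<kappa> b y))) a b)) \<le> err \<eta> + leakage / M"
      using decoding_error_le[of C D] bad by simp
    show "ent pAE - log 2 (real NS) - (1 + h + (err \<eta> + leakage / M) * log 2 (real (card (snd ` set_pmf pAE))))
      - (M * err \<eta> + leakage) \<le> cond_ent (code_law (enc_word C D)) (\<lambda>(a, b, e, y, z). a) (\<lambda>(a, b, e, y, z). (e, z))"
      using equivocation_le[OF D, of C] bad' leak unfolding leak_def by linarith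
  qed
qed

end

section \<open>Memoryless extensions and typicality\<close>

fun kern_list :: "('x \<Rightarrow> 'y pmf) \<Rightarrow> 'x list \<Rightarrow> 'y list pmf" where
  "kern_list K [] = return_pmf []"
| "kern_list K (x # xs) = bind_pmf (K x) (\<lambda>y. map_pmf ((#) y) (kern_list K xs))"

lemma iid_list_Suc: "iid_list (Suc n) p = bind_pmf p (\<lambda>x. map_pmf ((#) x) (iid_list n p))"
  by (simp add: map_pmf_def)

text \<open>An i.i.d. word is a constant kernel applied to a word of units, so facts about kernels
  cover both cases.\<close>

lemma iid_list_eq_kern_list: "iid_list n p = kern_list (\<lambda>_. p) (replicate n ())"
  by (induction n) (simp_all add: map_pmf_def)

lemma chan_list_eq_kern_list: "chan_list W xs = map_pmf (\<lambda>l. (map fst l, map snd l)) (kern_list W xs)"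
  by (induction xs)
     (simp_all add: map_bind_pmf bind_map_pmf map_pmf_comp case_prod_unfold map_pmf_def[symmetric] comp_def)

lemma map_kern_list: "map_pmf (map f) (kern_list K xs) = kern_list (\<lambda>x. map_pmf f (K x)) xs"
proof (induction xs)
  case (Cons x xs)
  have "map_pmf (map f) (kern_list K (x # xs)) = bind_pmf (K x) (\<lambda>y. map_pmf ((#) (f y)) (map_pmf (map f) (kern_list K xs)))"
    by (simp add: map_bind_pmf map_pmf_comp)
  thus ?case by (simp add: Cons bind_map_pmf)
qed simp

lemma map_iid_list: "map_pmf (map f) (iid_list n p) = iid_list n (map_pmf f p)"
  by (simp add: iid_list_eq_kern_list map_kern_list)

lemma kern_list_map: "kern_list K (map f xs) = kern_list (\<lambda>x. K (f x)) xs"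
  by (induction xs) simp_all

lemma bind_kern_list: "bind_pmf (kern_list K xs) (kern_list L) = kern_list (\<lambda>x. bind_pmf (K x) L) xs"
proof (induction xs)
  case (Cons x xs)
  have "bind_pmf (kern_list K (x # xs)) (kern_list L)
      = bind_pmf (K x) (\<lambda>y. bind_pmf (kern_list K xs) (\<lambda>ys. bind_pmf (L y) (\<lambda>z. map_pmf ((#) z) (kern_list L ys))))"
    by (simp add: bind_assoc_pmf bind_map_pmf)
  also have "\<dots> = bind_pmf (K x) (\<lambda>y. bind_pmf (L y) (\<lambda>z. map_pmf ((#) z) (bind_pmf (kern_list K xs) (kern_list L))))"
    by (subst (2) bind_commute_pmf) (simp add: map_bind_pmf)
  finally show ?case by (simp add: Cons bind_assoc_pmf)
qed (simp add: bind_return_pmf)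

lemma bind_iid_list: "bind_pmf (iid_list n p) (kern_list L) = iid_list n (bind_pmf p L)"
  by (simp add: iid_list_eq_kern_list bind_kern_list)

text \<open>Exchanges a pair of words for a word of pairs. Repeated use turns a chain of letterwise
  kernels into one i.i.d. word.\<close>

lemma bind_iid_kern_list:
  "bind_pmf (iid_list n p) (\<lambda>xs. bind_pmf (kern_list L xs) (F xs))
   = bind_pmf (iid_list n (bind_pmf p (\<lambda>x. map_pmf (Pair x) (L x)))) (\<lambda>l. F (map fst l) (map snd l))"
proof (induction n arbitrary: F)
  case (Suc n)
  have "bind_pmf (iid_list (Suc n) p) (\<lambda>xs. bind_pmf (kern_list L xs) (F xs))
      = bind_pmf p (\<lambda>x. bind_pmf (iid_list n p) (\<lambda>xs. bind_pmf (L x) (\<lambda>y. bind_pmf (kern_list L xs) (\<lambda>ys. F (x # xs) (y # ys)))))"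
    by (simp add: bind_assoc_pmf bind_map_pmf bind_return_pmf)
  also have "\<dots> = bind_pmf p (\<lambda>x. bind_pmf (L x) (\<lambda>y. bind_pmf (iid_list n p) (\<lambda>xs. bind_pmf (kern_list L xs) (\<lambda>ys. F (x # xs) (y # ys)))))"
    by (subst (2) bind_commute_pmf) simp
  also have "\<dots> = bind_pmf p (\<lambda>x. bind_pmf (L x) (\<lambda>y.
      bind_pmf (iid_list n (bind_pmf p (\<lambda>x. map_pmf (Pair x) (L x)))) (\<lambda>l. F (x # map fst l) (y # map snd l))))"
    by (subst Suc) simp
  finally show ?case by (simp add: bind_assoc_pmf bind_map_pmf bind_return_pmf)
qed (simp add: bind_return_pmf)

lemma finite_kern_list [simp]: "(\<And>x. finite (set_pmf (K x))) \<Longrightarrow> finite (set_pmf (kern_list K xs))"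
  by (induction xs) auto

lemma finite_iid_list [simp]: "finite (set_pmf p) \<Longrightarrow> finite (set_pmf (iid_list n p))"
  by (simp add: iid_list_eq_kern_list)

lemma length_kern_list: "ys \<in> set_pmf (kern_list K xs) \<Longrightarrow> length ys = length xs"
  by (induction xs arbitrary: ys) auto

lemma length_iid_list: "xs \<in> set_pmf (iid_list n p) \<Longrightarrow> length xs = n"
  by (auto simp: iid_list_eq_kern_list dest: length_kern_list)

lemma set_iid_list: "xs \<in> set_pmf (iid_list n p) \<Longrightarrow> set xs \<subseteq> set_pmf p"
  by (induction n arbitrary: xs) (auto, blast)

lemma pmf_kern_list_Cons:
  "pmf (kern_list K (x # xs)) (y # ys) = pmf (K x) y * pmf (kern_list K xs) ys"
proof -
  have "kern_list K (x # xs) = map_pmf (\<lambda>(y, ys). y # ys) (bind_pmf (K x) (\<lambda>y. map_pmf (Pair y) (kern_list K xs)))"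
    by (simp add: map_bind_pmf map_pmf_comp)
  thus ?thesis
    using pmf_map_inj'[of "\<lambda>(y, ys). y # ys" "bind_pmf (K x) (\<lambda>y. map_pmf (Pair y) (kern_list K xs))" "(y, ys)"]
    by (simp add: pmf_bind_Pair inj_def)
qed

lemma pmf_kern_list:
  "pmf (kern_list K (map f l)) (map g l) = prod_list (map (\<lambda>w. pmf (K (f w)) (g w)) l)"
  by (induction l) (simp_all add: pmf_kern_list_Cons del: kern_list.simps(2))

lemma pmf_iid_list:
  "length l = n \<Longrightarrow> pmf (iid_list n p) (map g l) = prod_list (map (\<lambda>w. pmf p (g w)) l)"
  using pmf_kern_list[of "\<lambda>_. p" "\<lambda>_. ()" l g] by (simp add: iid_list_eq_kern_list map_replicate_const)

lemma prod_list_ratio: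
  assumes "\<And>w. w \<in> set l \<Longrightarrow> 0 < f w" "\<And>w. w \<in> set l \<Longrightarrow> 0 < g w"
  shows "prod_list (map f l) = 2 powr (\<Sum>w\<leftarrow>l. log 2 (f w / g w)) * prod_list (map g l)"
  using assms
proof (induction l)
  case (Cons w l)
  have "2 powr (log 2 (f w / g w)) = f w / g w" using Cons.prems by simp
  moreover have "prod_list (map f l) = 2 powr (\<Sum>w\<leftarrow>l. log 2 (f w / g w)) * prod_list (map g l)"
    using Cons by simp
  ultimately show ?case using Cons.prems(2)[of w] by (simp add: powr_add)
qed simp

section \<open>Typicality of sums\<close>

lemma pexp_iid_sum_list:
  assumes fin: "finite (set_pmf p)"
  shows "pexp (iid_list n p) (\<lambda>l. \<Sum>w\<leftarrow>l. f w) = real n * pexp p f"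
proof (induction n)
  case (Suc n)
  thus ?case unfolding iid_list_Suc using fin by (simp add: pexp_bind pexp_add algebra_simps)
qed simp

lemma pexp_iid_centered_square:
  assumes fin: "finite (set_pmf p)" and zero: "pexp p f = 0"
  shows "pexp (iid_list n p) (\<lambda>l. (\<Sum>w\<leftarrow>l. f w)\<^sup>2) = real n * pexp p (\<lambda>w. (f w)\<^sup>2)"
proof (induction n)
  case (Suc n)
  have "pexp (iid_list (Suc n) p) (\<lambda>l. (\<Sum>w\<leftarrow>l. f w)\<^sup>2)
      = pexp p (\<lambda>x. pexp (iid_list n p) (\<lambda>l. (f x)\<^sup>2 + 2 * f x * (\<Sum>w\<leftarrow>l. f w) + (\<Sum>w\<leftarrow>l. f w)\<^sup>2))"
    unfolding iid_list_Suc using fin by (simp add: pexp_bind power2_sum algebra_simps)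
  also have "\<dots> = pexp p (\<lambda>w. (f w)\<^sup>2) + real n * pexp p (\<lambda>w. (f w)\<^sup>2)"
    using fin by (simp add: pexp_add pexp_cmult pexp_iid_sum_list zero Suc)
  finally show ?case by (simp add: algebra_simps)
qed simp

definition atypical :: "'w pmf \<Rightarrow> ('w \<Rightarrow> real) \<Rightarrow> real \<Rightarrow> nat \<Rightarrow> real" where
  "atypical p f \<delta> n = pexp (iid_list n p) (\<lambda>l. of_bool (real n * \<delta> < \<bar>(\<Sum>w\<leftarrow>l. f w) - real n * pexp p f\<bar>))"

lemma atypical_nonneg: "0 \<le> atypical p f \<delta> n"
  unfolding atypical_def by (rule pexp_nonneg) simp

text \<open>Chebyshev: the variance of a sum of centred independent letters is n times that of one
  letter, so the probability is at most V/(\<delta>^2 n).\<close>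

lemma atypical_tendsto_0:
  assumes fin: "finite (set_pmf p)" and \<delta>: "0 < \<delta>"
  shows "atypical p f \<delta> \<longlonglongrightarrow> 0"
proof -
  define g where "g w = f w - pexp p f" for w
  define V where "V = pexp p (\<lambda>w. (g w)\<^sup>2)"
  have g0: "pexp p g = 0" using fin by (simp add: g_def[abs_def] pexp_diff)
  have sumg: "(\<Sum>w\<leftarrow>l. g w) = (\<Sum>w\<leftarrow>l. f w) - real (length l) * pexp p f" for l
    by (induction l) (simp_all add: g_def algebra_simps)
  have "atypical p f \<delta> n \<le> V / \<delta>\<^sup>2 / real n" if n: "0 < n" for n
  proof -
    have "atypical p f \<delta> n \<le> pexp (iid_list n p) (\<lambda>l. (\<Sum>w\<leftarrow>l. g w)\<^sup>2 / (real n * \<delta>)\<^sup>2)"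
      unfolding atypical_def
    proof (rule pexp_mono)
      fix l assume "l \<in> set_pmf (iid_list n p)"
      hence "(\<Sum>w\<leftarrow>l. g w) = (\<Sum>w\<leftarrow>l. f w) - real n * pexp p f" by (simp add: sumg length_iid_list)
      moreover have "(real n * \<delta>)\<^sup>2 \<le> x\<^sup>2" if "real n * \<delta> < \<bar>x\<bar>" for x
        using that \<delta> n by (intro abs_le_square_iff[THEN iffD1]) auto
      ultimately show "of_bool (real n * \<delta> < \<bar>(\<Sum>w\<leftarrow>l. f w) - real n * pexp p f\<bar>) \<le> (\<Sum>w\<leftarrow>l. g w)\<^sup>2 / (real n * \<delta>)\<^sup>2"
        using \<delta> n by (auto simp: of_bool_def pos_le_divide_eq)
    qed (use fin in simp)
    also have "\<dots> = real n * V / (real n * \<delta>)\<^sup>2"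
      by (simp add: pexp_divide pexp_iid_centered_square[OF fin g0] V_def)
    also have "\<dots> = V / \<delta>\<^sup>2 / real n" using n by (simp add: power2_eq_square)
    finally show ?thesis .
  qed
  hence "eventually (\<lambda>n. atypical p f \<delta> n \<le> V / \<delta>\<^sup>2 / real n) sequentially"
    by (intro eventually_sequentiallyI[of 1]) auto
  moreover have "(\<lambda>n. V / \<delta>\<^sup>2 / real n) \<longlonglongrightarrow> 0" by (rule lim_const_over_n)
  ultimately show ?thesis
    by (intro tendsto_sandwich[of "\<lambda>_. 0" "atypical p f \<delta>" sequentially "\<lambda>n. V / \<delta>\<^sup>2 / real n"])
       (auto simp: atypical_nonneg)
qed

text \<open>Outputs come as a pair of words, the format of \<open>chan_list\<close>; this lets it
  play the part of \<open>kBE\<close> or \<open>kYZ\<close> over words.\<close>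

definition kern_pair :: "('x \<Rightarrow> ('y \<times> 'z) pmf) \<Rightarrow> 'x list \<Rightarrow> ('y list \<times> 'z list) pmf" where
  "kern_pair K xs = map_pmf (\<lambda>l. (map fst l, map snd l)) (kern_list K xs)"

lemma finite_kern_pair [simp]: "(\<And>x. finite (set_pmf (K x))) \<Longrightarrow> finite (set_pmf (kern_pair K xs))"
  by (simp add: kern_pair_def)

lemma map_fst_kern_pair: "map_pmf fst (kern_pair K xs) = kern_list (\<lambda>x. map_pmf fst (K x)) xs"
  by (simp add: kern_pair_def map_pmf_comp map_kern_list)

lemma map_snd_kern_pair: "map_pmf snd (kern_pair K xs) = kern_list (\<lambda>x. map_pmf snd (K x)) xs"
  by (simp add: kern_pair_def map_pmf_comp map_kern_list)

context
  fixes n :: nat and pU :: "'u pmf" and kV :: "'u \<Rightarrow> 'v pmf" and kA :: "'v \<Rightarrow> 'a pmf" and kBE :: "'a \<Rightarrow> ('b \<times> 'e) pmf"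
begin

interpretation S: source_model pU kV kA kBE .
interpretation Sn: source_model "iid_list n pU" "kern_list kV" "kern_list kA" "kern_pair kBE" .

text \<open>Letterwise extension commutes with composition of kernels, so every derived law of the
  word model extends the corresponding law of letters.\<close>

lemma source_model_list:
  "Sn.kAU = kern_list S.kAU" "Sn.pA = iid_list n S.pA" "Sn.kB = kern_list S.kB" "Sn.kBU = kern_list S.kBU"
  "Sn.pB = iid_list n S.pB" "Sn.kEU = kern_list S.kEU"
proof -
  show kAU: "Sn.kAU = kern_list S.kAU"
    by (rule ext) (simp add: Sn.kAU_def S.kAU_def[abs_def] bind_kern_list)
  show "Sn.pA = iid_list n S.pA"
    by (simp add: Sn.pA_def S.pA_def kAU bind_iid_list)
  show kB: "Sn.kB = kern_list S.kB"
    by (rule ext) (simp add: Sn.kB_def S.kB_def[abs_def] map_fst_kern_pair bind_kern_list)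
  show kBU: "Sn.kBU = kern_list S.kBU"
    by (rule ext) (simp add: Sn.kBU_def S.kBU_def[abs_def] kB bind_kern_list)
  show "Sn.pB = iid_list n S.pB"
    by (simp add: Sn.pB_def S.pB_def kBU bind_iid_list)
  show "Sn.kEU = kern_list S.kEU"
    by (rule ext) (simp add: Sn.kEU_def S.kEU_def[abs_def] map_snd_kern_pair bind_kern_list)
qed

text \<open>The joint law is carried by one i.i.d. word of five-tuples, which reduces events about
  words to sums over its letters.\<close>

lemma source_model_src:
  "Sn.src = map_pmf (\<lambda>l. (map (\<lambda>(u, v, a, b, e). u) l, map (\<lambda>(u, v, a, b, e). v) l, map (\<lambda>(u, v, a, b, e). a) l,
      map (\<lambda>(u, v, a, b, e). b) l, map (\<lambda>(u, v, a, b, e). e) l)) (iid_list n S.src)"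
proof -
  let ?r = "\<lambda>(((u, v), a), (b, e)). (u, v, a, b, e)"
  define p1 where "p1 = bind_pmf pU (\<lambda>u. map_pmf (Pair u) (kV u))"
  define p2 where "p2 = bind_pmf p1 (\<lambda>x. map_pmf (Pair x) (kA (snd x)))"
  define p3 where "p3 = bind_pmf p2 (\<lambda>x. map_pmf (Pair x) (kBE (snd x)))"
  have src: "S.src = map_pmf ?r p3"
    by (simp add: S.src_def p3_def p2_def p1_def bind_assoc_pmf bind_map_pmf map_bind_pmf map_pmf_comp case_prod_unfold)
  have "Sn.src = bind_pmf (iid_list n pU) (\<lambda>us. bind_pmf (kern_list kV us) (\<lambda>vs. bind_pmf (kern_list kA vs) (\<lambda>as.
      bind_pmf (kern_list kBE as) (\<lambda>l. return_pmf (us, vs, as, map fst l, map snd l)))))"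
    by (simp add: Sn.src_def kern_pair_def map_pmf_def bind_assoc_pmf bind_return_pmf)
  also have "\<dots> = bind_pmf (iid_list n p1) (\<lambda>l. bind_pmf (kern_list (\<lambda>x. kA (snd x)) l) (\<lambda>as.
      bind_pmf (kern_list kBE as) (\<lambda>l'. return_pmf (map fst l, map snd l, as, map fst l', map snd l'))))"
    unfolding p1_def by (subst bind_iid_kern_list) (simp add: kern_list_map)
  also have "\<dots> = bind_pmf (iid_list n p2) (\<lambda>l. bind_pmf (kern_list (\<lambda>x. kBE (snd x)) l)
      (\<lambda>l'. return_pmf (map fst (map fst l), map snd (map fst l), map snd l, map fst l', map snd l')))"
    unfolding p2_def by (subst bind_iid_kern_list) (simp add: kern_list_map)
  also have "\<dots> = bind_pmf (iid_list n p3) (\<lambda>l. return_pmf (map fst (map fst (map fst l)), map snd (map fst (map fst l)),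
      map snd (map fst l), map fst (map snd l), map snd (map snd l)))"
    unfolding p3_def by (subst bind_iid_kern_list) simp
  also have "\<dots> = map_pmf (\<lambda>l. (map (\<lambda>(u, v, a, b, e). u) l, map (\<lambda>(u, v, a, b, e). v) l, map (\<lambda>(u, v, a, b, e). a) l,
      map (\<lambda>(u, v, a, b, e). b) l, map (\<lambda>(u, v, a, b, e). e) l)) (map_pmf (map ?r) (iid_list n p3))"
    by (simp add: map_pmf_def[symmetric] map_pmf_comp case_prod_unfold comp_def)
  finally show ?thesis by (simp only: map_iid_list src)
qed

lemma source_model_pABE:
  "Sn.pABE = map_pmf (\<lambda>l. (map (\<lambda>(a, b, e). a) l, map (\<lambda>(a, b, e). b) l, map (\<lambda>(a, b, e). e) l)) (iid_list n S.pABE)"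
proof -
  have "Sn.pABE = bind_pmf (iid_list n S.pA) (\<lambda>as. bind_pmf (kern_list kBE as) (\<lambda>l. return_pmf (as, map fst l, map snd l)))"
    by (simp add: Sn.pABE_def source_model_list kern_pair_def map_pmf_def bind_assoc_pmf bind_return_pmf)
  also have "\<dots> = bind_pmf (iid_list n S.pABE) (\<lambda>l. return_pmf (map fst l, map fst (map snd l), map snd (map snd l)))"
    unfolding S.pABE_def by (rule bind_iid_kern_list)
  finally show ?thesis by (simp add: map_pmf_def[symmetric] case_prod_unfold comp_def)
qed

end

context
  fixes n :: nat and pQ :: "'q pmf" and kT :: "'q \<Rightarrow> 't pmf" and kYZ :: "'t \<Rightarrow> ('y \<times> 'z) pmf"
begin

interpretation S: channel_model pQ kT kYZ .
interpretation Sn: channel_model "iid_list n pQ" "kern_list kT" "kern_pair kYZ" .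

lemma channel_model_list:
  "Sn.kY = kern_list S.kY" "Sn.kYQ = kern_list S.kYQ" "Sn.pY = iid_list n S.pY" "Sn.kZ = kern_list S.kZ"
  "Sn.kZQ = kern_list S.kZQ"
proof -
  show kY: "Sn.kY = kern_list S.kY"
    by (rule ext) (simp add: Sn.kY_def S.kY_def[abs_def] map_fst_kern_pair)
  show kYQ: "Sn.kYQ = kern_list S.kYQ"
    by (rule ext) (simp add: Sn.kYQ_def S.kYQ_def[abs_def] kY bind_kern_list)
  show "Sn.pY = iid_list n S.pY"
    by (simp add: Sn.pY_def S.pY_def kYQ bind_iid_list)
  show kZ: "Sn.kZ = kern_list S.kZ"
    by (rule ext) (simp add: Sn.kZ_def S.kZ_def[abs_def] map_snd_kern_pair)
  show "Sn.kZQ = kern_list S.kZQ"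
    by (rule ext) (simp add: Sn.kZQ_def S.kZQ_def[abs_def] kZ bind_kern_list)
qed

lemma channel_model_chn:
  "Sn.chn = map_pmf (\<lambda>l. (map (\<lambda>(q, t, y, z). q) l, map (\<lambda>(q, t, y, z). t) l, map (\<lambda>(q, t, y, z). y) l,
      map (\<lambda>(q, t, y, z). z) l)) (iid_list n S.chn)"
proof -
  let ?r = "\<lambda>((q, t), (y, z)). (q, t, y, z)"
  define p1 where "p1 = bind_pmf pQ (\<lambda>q. map_pmf (Pair q) (kT q))"
  define p2 where "p2 = bind_pmf p1 (\<lambda>x. map_pmf (Pair x) (kYZ (snd x)))"
  have chn: "S.chn = map_pmf ?r p2"
    by (simp add: S.chn_def p2_def p1_def bind_assoc_pmf bind_map_pmf map_bind_pmf map_pmf_comp case_prod_unfold)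
  have "Sn.chn = bind_pmf (iid_list n pQ) (\<lambda>qs. bind_pmf (kern_list kT qs) (\<lambda>ts.
      bind_pmf (kern_list kYZ ts) (\<lambda>l. return_pmf (qs, ts, map fst l, map snd l))))"
    by (simp add: Sn.chn_def kern_pair_def map_pmf_def bind_assoc_pmf bind_return_pmf)
  also have "\<dots> = bind_pmf (iid_list n p1) (\<lambda>l. bind_pmf (kern_list (\<lambda>x. kYZ (snd x)) l)
      (\<lambda>l'. return_pmf (map fst l, map snd l, map fst l', map snd l')))"
    unfolding p1_def by (subst bind_iid_kern_list) (simp add: kern_list_map)
  also have "\<dots> = bind_pmf (iid_list n p2) (\<lambda>l. return_pmf (map fst (map fst l), map snd (map fst l),
      map fst (map snd l), map snd (map snd l)))"
    unfolding p2_def by (subst bind_iid_kern_list) simp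
  also have "\<dots> = map_pmf (\<lambda>l. (map (\<lambda>(q, t, y, z). q) l, map (\<lambda>(q, t, y, z). t) l, map (\<lambda>(q, t, y, z). y) l,
      map (\<lambda>(q, t, y, z). z) l)) (map_pmf (map ?r) (iid_list n p2))"
    by (simp add: map_pmf_def[symmetric] map_pmf_comp case_prod_unfold comp_def)
  finally show ?thesis by (simp only: map_iid_list chn)
qed

end

section \<open>Coordinates and typical likelihood ratios\<close>

definition srcU :: "'u \<times> 'v \<times> 'a \<times> 'b \<times> 'e \<Rightarrow> 'u" where "srcU = (\<lambda>(u, v, a, b, e). u)"
definition srcV :: "'u \<times> 'v \<times> 'a \<times> 'b \<times> 'e \<Rightarrow> 'v" where "srcV = (\<lambda>(u, v, a, b, e). v)"
definition srcA :: "'u \<times> 'v \<times> 'a \<times> 'b \<times> 'e \<Rightarrow> 'a" where "srcA = (\<lambda>(u, v, a, b, e). a)"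
definition srcB :: "'u \<times> 'v \<times> 'a \<times> 'b \<times> 'e \<Rightarrow> 'b" where "srcB = (\<lambda>(u, v, a, b, e). b)"
definition srcE :: "'u \<times> 'v \<times> 'a \<times> 'b \<times> 'e \<Rightarrow> 'e" where "srcE = (\<lambda>(u, v, a, b, e). e)"
definition chnQ :: "'q \<times> 't \<times> 'y \<times> 'z \<Rightarrow> 'q" where "chnQ = (\<lambda>(q, t, y, z). q)"
definition chnT :: "'q \<times> 't \<times> 'y \<times> 'z \<Rightarrow> 't" where "chnT = (\<lambda>(q, t, y, z). t)"
definition chnY :: "'q \<times> 't \<times> 'y \<times> 'z \<Rightarrow> 'y" where "chnY = (\<lambda>(q, t, y, z). y)"
definition chnZ :: "'q \<times> 't \<times> 'y \<times> 'z \<Rightarrow> 'z" where "chnZ = (\<lambda>(q, t, y, z). z)"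

lemmas letter_defs = srcU_def srcV_def srcA_def srcB_def srcE_def chnQ_def chnT_def chnY_def chnZ_def

text \<open>The likelihood ratio of two product laws is 2 to the sum of the densities \<phi>, and
  typicality places this sum within n\<delta> of its mean.\<close>

lemma typical_prod_bounds:
  assumes l: "l \<in> set_pmf (iid_list n p)"
    and pos: "\<And>w. w \<in> set_pmf p \<Longrightarrow> 0 < f w" "\<And>w. w \<in> set_pmf p \<Longrightarrow> 0 < g w"
    and \<phi>: "\<phi> = (\<lambda>w. log 2 (f w / g w))"
    and typical: "\<bar>(\<Sum>w\<leftarrow>l. \<phi> w) - real n * pexp p \<phi>\<bar> \<le> real n * \<delta>"
  shows "prod_list (map f l) \<le> 2 powr (real n * (pexp p \<phi> + \<delta>)) * prod_list (map g l)"
    and "2 powr (real n * (pexp p \<phi> - \<delta>)) * prod_list (map g l) \<le> prod_list (map f l)"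
proof -
  have sub: "set l \<subseteq> set_pmf p" using l by (rule set_iid_list)
  have eq: "prod_list (map f l) = 2 powr (\<Sum>w\<leftarrow>l. \<phi> w) * prod_list (map g l)"
    unfolding \<phi> using pos sub by (intro prod_list_ratio) auto
  have g: "0 \<le> prod_list (map g l)"
    using pos(2) sub by (intro prod_list_nonneg) (auto intro: less_imp_le)
  show "prod_list (map f l) \<le> 2 powr (real n * (pexp p \<phi> + \<delta>)) * prod_list (map g l)"
    unfolding eq using typical by (intro mult_right_mono g powr_mono) (auto simp: algebra_simps abs_le_iff)
  show "2 powr (real n * (pexp p \<phi> - \<delta>)) * prod_list (map g l) \<le> prod_list (map f l)"
    unfolding eq using typical by (intro mult_right_mono g powr_mono) (auto simp: algebra_simps abs_le_iff)
qed

lemma atypical_union: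
  assumes fin: "finite (set_pmf p)"
    and P: "\<And>l. l \<in> set_pmf (iid_list n p) \<Longrightarrow>
      (\<And>\<phi>. \<phi> \<in> set \<Phi> \<Longrightarrow> \<bar>(\<Sum>w\<leftarrow>l. \<phi> w) - real n * pexp p \<phi>\<bar> \<le> real n * \<delta>) \<Longrightarrow> P l"
  shows "pexp (iid_list n p) (\<lambda>l. of_bool (\<not> P l)) \<le> (\<Sum>\<phi>\<leftarrow>\<Phi>. atypical p \<phi> \<delta> n)"
proof -
  let ?at = "\<lambda>\<phi> l. of_bool (real n * \<delta> < \<bar>(\<Sum>w\<leftarrow>l. \<phi> w) - real n * pexp p \<phi>\<bar>) :: real"
  have fin': "finite (set_pmf (iid_list n p))" using fin by simp
  have "pexp (iid_list n p) (\<lambda>l. of_bool (\<not> P l)) \<le> pexp (iid_list n p) (\<lambda>l. \<Sum>\<phi>\<leftarrow>\<Phi>. ?at \<phi> l)"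
  proof (rule pexp_mono[OF fin'])
    fix l assume l: "l \<in> set_pmf (iid_list n p)"
    show "of_bool (\<not> P l) \<le> (\<Sum>\<phi>\<leftarrow>\<Phi>. ?at \<phi> l)"
    proof (cases "P l")
      case True
      thus ?thesis by (auto intro!: sum_list_nonneg)
    next
      case False
      then obtain \<phi> where "\<phi> \<in> set \<Phi>" "\<not> \<bar>(\<Sum>w\<leftarrow>l. \<phi> w) - real n * pexp p \<phi>\<bar> \<le> real n * \<delta>"
        using P[OF l] by blast
      hence "1 \<le> ?at \<phi> l" by simp
      moreover have "?at \<phi> l \<in> set (map (\<lambda>\<phi>. ?at \<phi> l) \<Phi>)"
        unfolding set_map using \<open>\<phi> \<in> set \<Phi>\<close> by (rule imageI)
      moreover have "?at \<phi> l \<le> (\<Sum>\<phi>\<leftarrow>\<Phi>. ?at \<phi> l)"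
        using \<open>?at \<phi> l \<in> set (map (\<lambda>\<phi>. ?at \<phi> l) \<Phi>)\<close> by (intro member_le_sum_list) auto
      ultimately show ?thesis using False by simp
    qed
  qed
  also have "\<dots> = (\<Sum>\<phi>\<leftarrow>\<Phi>. atypical p \<phi> \<delta> n)"
    unfolding atypical_def by (induction \<Phi>) (simp_all add: pexp_add fin')
  finally show ?thesis .
qed

text \<open>For one bit, the logarithm of the resolvability bound becomes a positive part, the
  source of the bracket in the leakage rate.\<close>

lemma log2_one_plus_powr_le: "log 2 (1 + 2 powr x) \<le> 1 + max 0 x"
proof -
  have "1 + 2 powr x \<le> 2 * 2 powr (max 0 x)"
  proof -
    have "2 powr x \<le> 2 powr (max 0 x)" by simp
    moreover have "1 \<le> 2 powr (max 0 x)" by (simp add: ge_one_powr_ge_zero)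
    ultimately show ?thesis by linarith
  qed
  hence "log 2 (1 + 2 powr x) \<le> log 2 (2 * 2 powr (max 0 x))"
    by (subst log_le_cancel_iff) (auto simp: add_pos_nonneg)
  thus ?thesis by (simp add: log_mult_pos)
qed

section \<open>Block coding\<close>

text \<open>Rounding up preserves covering and at most doubles the size. Rate 0 gives exactly one
  word, on which the vanishing of the inner confusion term relies.\<close>

definition code_size :: "nat \<Rightarrow> real \<Rightarrow> nat" where
  "code_size n R = nat \<lceil>2 powr (real n * R)\<rceil>"

lemma code_size_bounds:
  assumes "0 \<le> R"
  shows "2 powr (real n * R) \<le> real (code_size n R)" "real (code_size n R) \<le> 2 * 2 powr (real n * R)"
    "0 < code_size n R" "R = 0 \<Longrightarrow> code_size n R = 1"
proof -
  have 1: "1 \<le> 2 powr (real n * R)" using assms by (simp add: ge_one_powr_ge_zero)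
  show "2 powr (real n * R) \<le> real (code_size n R)" unfolding code_size_def by linarith
  thus "0 < code_size n R" using 1 by linarith
  show "real (code_size n R) \<le> 2 * 2 powr (real n * R)" unfolding code_size_def using 1 by linarith
  show "R = 0 \<Longrightarrow> code_size n R = 1" by (simp add: code_size_def)
qed

section \<open>Information densities\<close>

context wiretap_model begin

text \<open>Densities of a single letter; their means are identified with entropies and mutual
  informations among the single-letter identities.\<close>

definition "dUA w = log 2 (pmf (kAU (srcU w)) (srcA w) / pmf pA (srcA w))"
definition "dVA w = log 2 (pmf (kA (srcV w)) (srcA w) / pmf pA (srcA w))"
definition "dVB w = log 2 (pmf (kB (srcV w)) (srcB w) / pmf pB (srcB w))"
definition "dVBU w = log 2 (pmf (kB (srcV w)) (srcB w) / pmf (kBU (srcU w)) (srcB w))"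
text \<open>The division by 1 gives this density the quotient shape required by
  \<open>typical_prod_bounds\<close>.\<close>

definition "dEU w = log 2 (pmf (kEU (srcU w)) (srcE w) / 1)"
definition "dTY w = log 2 (pmf (kY (chnT w)) (chnY w) / pmf pY (chnY w))"
definition "dTYQ w = log 2 (pmf (kY (chnT w)) (chnY w) / pmf (kYQ (chnQ w)) (chnY w))"
definition "dTZQ w = log 2 (pmf (kZ (chnT w)) (chnZ w) / pmf (kZQ (chnQ w)) (chnZ w))"

definition "iUA = pexp src dUA"
definition "iVA = pexp src dVA"
definition "iVB = pexp src dVB"
definition "iVBU = pexp src dVBU"
definition "hEU = - pexp src dEU"
definition "iTY = pexp chn dTY"
definition "iTYQ = pexp chn dTYQ"
definition "iTZQ = pexp chn dTZQ"

lemma src_pos: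
  assumes "w \<in> set_pmf src"
  shows "0 < pmf (kAU (srcU w)) (srcA w)" "0 < pmf pA (srcA w)" "0 < pmf (kA (srcV w)) (srcA w)"
    "0 < pmf (kB (srcV w)) (srcB w)" "0 < pmf pB (srcB w)" "0 < pmf (kBU (srcU w)) (srcB w)"
    "0 < pmf (kEU (srcU w)) (srcE w)"
proof -
  obtain u v a b e where w: "w = (u, v, a, b, e)" and m: "u \<in> set_pmf pU" "v \<in> set_pmf (kV u)" "a \<in> set_pmf (kA v)"
    "(b, e) \<in> set_pmf (kBE a)"
    using assms by (auto simp: src_def)
  have a: "a \<in> set_pmf (kAU u)" using m by (auto simp: kAU_def)
  have b: "b \<in> set_pmf (kB v)" using m by (force simp: kB_def)
  have bu: "b \<in> set_pmf (kBU u)" using m b by (auto simp: kBU_def)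
  have e: "e \<in> set_pmf (kEU u)" using m by (force simp: kEU_def)
  have "a \<in> set_pmf pA" "b \<in> set_pmf pB" using m a bu by (auto simp: pA_def pB_def)
  with a b bu e m show "0 < pmf (kAU (srcU w)) (srcA w)" "0 < pmf pA (srcA w)" "0 < pmf (kA (srcV w)) (srcA w)"
    "0 < pmf (kB (srcV w)) (srcB w)" "0 < pmf pB (srcB w)" "0 < pmf (kBU (srcU w)) (srcB w)"
    "0 < pmf (kEU (srcU w)) (srcE w)"
    by (simp_all add: w letter_defs pmf_positive)
qed

lemma chn_pos:
  assumes "w \<in> set_pmf chn"
  shows "0 < pmf (kY (chnT w)) (chnY w)" "0 < pmf pY (chnY w)" "0 < pmf (kYQ (chnQ w)) (chnY w)"
    "0 < pmf (kZ (chnT w)) (chnZ w)" "0 < pmf (kZQ (chnQ w)) (chnZ w)"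
proof -
  obtain q t y z where w: "w = (q, t, y, z)" and m: "q \<in> set_pmf pQ" "t \<in> set_pmf (kT q)" "(y, z) \<in> set_pmf (kYZ t)"
    using assms by (auto simp: chn_def)
  have y: "y \<in> set_pmf (kY t)" using m by (force simp: kY_def)
  have yq: "y \<in> set_pmf (kYQ q)" using m y by (auto simp: kYQ_def)
  have z: "z \<in> set_pmf (kZ t)" using m by (force simp: kZ_def)
  have "z \<in> set_pmf (kZQ q)" "y \<in> set_pmf pY" using m yq z by (auto simp: kZQ_def pY_def)
  with y yq z show "0 < pmf (kY (chnT w)) (chnY w)" "0 < pmf pY (chnY w)" "0 < pmf (kYQ (chnQ w)) (chnY w)"
    "0 < pmf (kZ (chnT w)) (chnZ w)" "0 < pmf (kZQ (chnQ w)) (chnZ w)"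
    by (simp_all add: w letter_defs pmf_positive)
qed

end

locale block_coding = wiretap_model pU kV kA kBE pQ kT kYZ
  for pU :: "'u::finite pmf" and kV :: "'u \<Rightarrow> 'v::finite pmf" and kA :: "'v \<Rightarrow> 'a::finite pmf"
    and kBE :: "'a \<Rightarrow> ('b::finite \<times> 'e::finite) pmf"
    and pQ :: "'q::finite pmf" and kT :: "'q \<Rightarrow> 't::finite pmf" and kYZ :: "'t \<Rightarrow> ('y::finite \<times> 'z::finite) pmf" +
  fixes dd :: "'v \<Rightarrow> 'a \<Rightarrow> 'b \<Rightarrow> real" and k \<delta> RS R2 RK :: real
  assumes \<delta>: "0 < \<delta>" and k: "0 < k" and R: "0 \<le> RS" "0 \<le> R2" "0 \<le> RK"
begin

definition "ddist w = dd (srcV w) (srcA w) (srcB w)"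

text \<open>Rounding down keeps the bandwidth at most k. The lost fraction of a channel use shifts
  the packing exponents by at most one mutual information.\<close>

definition "uses n = nat \<lfloor>k * real n\<rfloor>"
definition "good_dist n v a b \<longleftrightarrow> (\<Sum>i<n. dd (v ! i) (a ! i) (b ! i)) \<le> real n * (pexp src ddist + \<delta>)"

lemma uses_bounds: "real (uses n) \<le> k * real n" "k * real n - 1 \<le> real (uses n)"
proof -
  have "0 \<le> k * real n" using k by simp
  thus "real (uses n) \<le> k * real n" "k * real n - 1 \<le> real (uses n)"
    unfolding uses_def by linarith+
qed

lemma hEU_nonneg: "0 \<le> hEU"
proof -
  have "pexp src dEU \<le> 0"
  proof (rule pexp_le_const)
    fix w assume "w \<in> set_pmf src"
    hence "0 < pmf (kEU (srcU w)) (srcE w)" by (rule src_pos)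
    thus "dEU w \<le> 0" by (simp add: dEU_def pmf_le_1)
  qed simp
  thus ?thesis by (simp add: hEU_def)
qed

end

section \<open>Bounds at a fixed blocklength\<close>

context block_coding begin

text \<open>The 3 is the covering error, 8 and 4 come from rounding up three and two codebook sizes,
  and the remaining powers of 2 from rounding down the number of channel uses.\<close>

definition "err_rest = 3 + 8 * 2 powr \<bar>iTY\<bar> + 4 * 2 powr \<bar>iTYQ\<bar>"
definition "err_bound n = (\<Sum>\<phi>\<leftarrow>[dUA, dVA]. atypical src \<phi> \<delta> n) + (\<Sum>\<phi>\<leftarrow>[dVB, dVBU, dEU, ddist]. atypical src \<phi> \<delta> n)
   + (\<Sum>\<phi>\<leftarrow>[dTY, dTYQ]. atypical chn \<phi> \<delta> (uses n)) + err_rest * 2 powr (- (real n * \<delta>))"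
text \<open>The three terms are the bit lost in bounding the logarithm, the excess of Eve's
  information over the rate of \<kappa>, and a crude pointwise bound charged to atypical channel
  words.\<close>

definition "leak_rate n = 1 / real n + max 0 (k * (iTZQ + \<delta>) - RK)
   + k * (\<Sum>w\<in>set_pmf chn. \<bar>dTZQ w\<bar>) * atypical chn dTZQ \<delta> (uses n)"

definition "block_law n enc = bind_pmf (iid_list n pABE) (\<lambda>s. bind_pmf (enc (map fst s))
   (\<lambda>t. map_pmf (\<lambda>(y, z). (s, y, z)) (kern_pair kYZ t)))"

definition "block_error n enc dec = pexp (block_law n enc) (\<lambda>(s, y, z). of_bool (\<not> good_dist n (dec y (map (\<lambda>(a, b, e). b) s)) (map fst s) (map (\<lambda>(a, b, e). b) s)))"
definition "block_equivocation n enc = cond_ent (block_law n enc) (\<lambda>(s, y, z). map fst s) (\<lambda>(s, y, z). (map (\<lambda>(a, b, e). e) s, z))"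

context
  fixes n :: nat
  assumes n: "0 < n"
begin

abbreviation (input) "m \<equiv> uses n"

text \<open>Covering thresholds lie \<delta> above the information rates and decoding thresholds
  \<delta> below, so that typical words meet all of them.\<close>

interpretation B: one_shot "iid_list n pU" "kern_list kV" "kern_list kA" "kern_pair kBE"
  "iid_list m pQ" "kern_list kT" "kern_pair kYZ" "code_size n RS" "code_size n R2" "code_size n RK"
  "2 powr (real n * (iUA + \<delta>))" "2 powr (real n * (iVA + \<delta>))"
  "2 powr (real n * (iVB - \<delta>))" "2 powr (real n * (iVBU - \<delta>))"
  "2 powr (real m * (iTY - \<delta>))" "2 powr (real m * (iTYQ - \<delta>))" "real n * (hEU + \<delta>)" "good_dist n"
  by standard (use code_size_bounds(3) R hEU_nonneg \<delta> in auto)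

lemma pexp_Bsrc: "pexp B.src f = pexp (iid_list n src) (\<lambda>l. f (map srcU l, map srcV l, map srcA l, map srcB l, map srcE l))"
  by (simp add: source_model_src letter_defs)

lemma pexp_Bchn: "pexp B.chn f = pexp (iid_list m chn) (\<lambda>l. f (map chnQ l, map chnT l, map chnY l, map chnZ l))"
  by (simp add: channel_model_chn letter_defs)

lemma prob_not_G1: "pexp B.src (\<lambda>(u, v, a, b, e). of_bool (\<not> B.G1 u v a)) \<le> (\<Sum>\<phi>\<leftarrow>[dUA, dVA]. atypical src \<phi> \<delta> n)"
  unfolding pexp_Bsrc prod.case
proof (rule atypical_union)
  fix l assume l: "l \<in> set_pmf (iid_list n src)"
    and typical: "\<And>\<phi>. \<phi> \<in> set [dUA, dVA] \<Longrightarrow> \<bar>(\<Sum>w\<leftarrow>l. \<phi> w) - real n * pexp src \<phi>\<bar> \<le> real n * \<delta>"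
  have len: "length l = n" using l by (rule length_iid_list)
  show "B.G1 (map srcU l) (map srcV l) (map srcA l)"
    unfolding B.G1_def unfolding source_model_list pmf_kern_list pmf_iid_list[OF len] iUA_def iVA_def
    using src_pos
    by (intro conjI typical_prod_bounds(1)[OF l _ _ _ typical]) (auto simp: dUA_def dVA_def fun_eq_iff)
qed simp

lemma prob_not_G2: "pexp B.src (\<lambda>(u, v, a, b, e). of_bool (\<not> B.G2 u v a b e))
   \<le> (\<Sum>\<phi>\<leftarrow>[dVB, dVBU, dEU, ddist]. atypical src \<phi> \<delta> n)"
  unfolding pexp_Bsrc prod.case
proof (rule atypical_union)
  fix l assume l: "l \<in> set_pmf (iid_list n src)"
    and typical: "\<And>\<phi>. \<phi> \<in> set [dVB, dVBU, dEU, ddist] \<Longrightarrow> \<bar>(\<Sum>w\<leftarrow>l. \<phi> w) - real n * pexp src \<phi>\<bar> \<le> real n * \<delta>"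
  have len: "length l = n" using l by (rule length_iid_list)
  have test: "B.testB (map srcU l) (map srcV l) (map srcB l)"
    unfolding B.testB_def unfolding source_model_list pmf_kern_list pmf_iid_list[OF len] iVB_def iVBU_def
    using src_pos
    by (intro conjI typical_prod_bounds(2)[OF l _ _ _ typical]) (auto simp: dVB_def dVBU_def fun_eq_iff)
  have "2 powr (real n * (pexp src dEU - \<delta>)) * prod_list (map (\<lambda>_. 1) l)
      \<le> prod_list (map (\<lambda>w. pmf (kEU (srcU w)) (srcE w)) l)"
    using src_pos by (intro typical_prod_bounds(2)[OF l _ _ _ typical]) (auto simp: dEU_def fun_eq_iff)
  moreover have "prod_list (map (\<lambda>_. 1) l) = (1::real)" by (induction l) auto
  ultimately have ev: "2 powr (- (real n * (hEU + \<delta>))) \<le> pmf (B.kEU (map srcU l)) (map srcE l)"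
    unfolding source_model_list pmf_kern_list by (simp add: hEU_def algebra_simps)
  have "(\<Sum>i<n. dd (map srcV l ! i) (map srcA l ! i) (map srcB l ! i)) = (\<Sum>w\<leftarrow>l. ddist w)"
    using len by (simp add: sum_list_sum_nth ddist_def atLeast0LessThan)
  hence "good_dist n (map srcV l) (map srcA l) (map srcB l)"
    using typical[of ddist] by (simp add: good_dist_def algebra_simps abs_le_iff)
  with test ev show "B.G2 (map srcU l) (map srcV l) (map srcA l) (map srcB l) (map srcE l)"
    by (simp add: B.G2_def)
qed simp

lemma prob_not_testY: "pexp B.chn (\<lambda>(q, t, y, z). of_bool (\<not> B.testY q t y)) \<le> (\<Sum>\<phi>\<leftarrow>[dTY, dTYQ]. atypical chn \<phi> \<delta> m)"
  unfolding pexp_Bchn prod.case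
proof (rule atypical_union)
  fix l assume l: "l \<in> set_pmf (iid_list m chn)"
    and typical: "\<And>\<phi>. \<phi> \<in> set [dTY, dTYQ] \<Longrightarrow> \<bar>(\<Sum>w\<leftarrow>l. \<phi> w) - real m * pexp chn \<phi>\<bar> \<le> real m * \<delta>"
  have len: "length l = m" using l by (rule length_iid_list)
  show "B.testY (map chnQ l) (map chnT l) (map chnY l)"
    unfolding B.testY_def unfolding channel_model_list pmf_kern_list pmf_iid_list[OF len] iTY_def iTYQ_def
    using chn_pos
    by (intro conjI typical_prod_bounds(2)[OF l _ _ _ typical]) (auto simp: dTY_def dTYQ_def fun_eq_iff)
qed simp

lemma powr_quotient_le:
  assumes "real n * a - (real n * (b - \<delta>) + real m * (c - \<delta>)) \<le> - (real n * \<delta>) + \<bar>c\<bar>"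
  shows "2 powr (real n * a) / (2 powr (real n * (b - \<delta>)) * 2 powr (real m * (c - \<delta>))) \<le> 2 powr \<bar>c\<bar> * 2 powr (- (real n * \<delta>))"
proof -
  have "2 powr (real n * a) / (2 powr (real n * (b - \<delta>)) * 2 powr (real m * (c - \<delta>)))
      = 2 powr (real n * a - (real n * (b - \<delta>) + real m * (c - \<delta>)))"
    by (simp add: powr_diff powr_add)
  also have "\<dots> \<le> 2 powr (- (real n * \<delta>) + \<bar>c\<bar>)" using assms by (intro powr_mono) auto
  also have "\<dots> = 2 powr \<bar>c\<bar> * 2 powr (- (real n * \<delta>))"
    by (subst add.commute) (rule powr_add)
  finally show ?thesis .
qed

text \<open>Of the margin (2 + k)\<delta>, one \<delta> pays for the side-information threshold,
  k\<delta> for the channel threshold, and one \<delta> remains as exponential decay. The term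
  \<open>\<bar>c\<bar>\<close> pays for rounding the number of channel uses.\<close>

lemma uses_exponent:
  assumes "a \<le> b + k * c - (2 + k) * \<delta>"
  shows "real n * a - (real n * (b - \<delta>) + real m * (c - \<delta>)) \<le> - (real n * \<delta>) + \<bar>c\<bar>"
proof -
  have "(k * real n - real m) * c \<le> \<bar>c\<bar>"
  proof -
    have "(k * real n - real m) * c \<le> \<bar>k * real n - real m\<bar> * \<bar>c\<bar>" by (metis abs_ge_self abs_mult)
    also have "\<dots> \<le> 1 * \<bar>c\<bar>" using uses_bounds[of n] by (intro mult_right_mono) auto
    finally show ?thesis by simp
  qed
  moreover have "real m * \<delta> \<le> k * real n * \<delta>" using uses_bounds[of n] \<delta> by (intro mult_right_mono) auto
  moreover have "real n * a \<le> real n * (b + k * c - (2 + k) * \<delta>)" using assms by (intro mult_left_mono) auto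
  ultimately show ?thesis by (simp add: algebra_simps)
qed

text \<open>Here \<eta> is x = \<open>2 powr (- (real n * \<delta>))\<close>. Of the covering margin
  3\<delta>, one \<delta> pays for the threshold and two leave quotients of at most x^2, which are
  still of order x after division by \<eta>.\<close>

lemma err_le:
  assumes cover1: "iUA + 3 * \<delta> \<le> RS" and cover2: "iVA + 3 * \<delta> \<le> RS + R2"
    and pack1: "RS + R2 + RK \<le> iVB + k * iTY - (2 + k) * \<delta>"
    and pack2: "R2 = 0 \<or> R2 + RK \<le> iVBU + k * iTYQ - (2 + k) * \<delta>"
  shows "B.err (2 powr (- (real n * \<delta>))) \<le> err_bound n"
proof -
  let ?x = "2 powr (- (real n * \<delta>))" and ?S = "real (code_size n RS)" and ?N = "real (code_size n R2)" and ?K = "real (code_size n RK)"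
  let ?t1 = "2 powr (real n * (iVB - \<delta>)) * 2 powr (real m * (iTY - \<delta>))"
    and ?t2 = "2 powr (real n * (iVBU - \<delta>)) * 2 powr (real m * (iTYQ - \<delta>))"
  let ?g1 = "2 powr (real n * (iUA + \<delta>))" and ?g2 = "2 powr (real n * (iVA + \<delta>))"
  note cs = code_size_bounds[OF R(1), of n] code_size_bounds[OF R(2), of n] code_size_bounds[OF R(3), of n]
  have nn: "0 \<le> (2::real) powr c" for c by simp
  have q1: "?g1 / ?S \<le> ?x * ?x"
  proof -
    have "?g1 / ?S \<le> ?g1 / 2 powr (real n * RS)"
      using cs by (intro divide_left_mono mult_pos_pos) auto
    also have "\<dots> = 2 powr (real n * (iUA + \<delta> - RS))" by (simp add: powr_diff[symmetric] algebra_simps)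
    also have "\<dots> \<le> 2 powr (real n * (- 2 * \<delta>))" using cover1 by (intro powr_mono mult_left_mono) auto
    finally show ?thesis by (simp add: powr_add[symmetric] algebra_simps)
  qed
  have q2: "?g2 / (?S * ?N) \<le> ?x * ?x"
  proof -
    have "?g2 / (?S * ?N)
        \<le> ?g2 / (2 powr (real n * RS) * 2 powr (real n * R2))"
      using cs by (intro divide_left_mono mult_pos_pos mult_mono) auto
    also have "\<dots> = 2 powr (real n * (iVA + \<delta> - (RS + R2)))"
      by (simp add: powr_diff[symmetric] powr_add[symmetric] algebra_simps)
    also have "\<dots> \<le> 2 powr (real n * (- 2 * \<delta>))" using cover2 by (intro powr_mono mult_left_mono) auto
    finally show ?thesis by (simp add: powr_add[symmetric] algebra_simps)
  qed
  have cover: "?x + (?g1 / ?S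
      + ?g2 / (?S * ?N)) / ?x \<le> 3 * ?x"
  proof -
    have "(?g1 / ?S
      + ?g2 / (?S * ?N)) / ?x \<le> (?x * ?x + ?x * ?x) / ?x"
      using q1 q2 by (intro divide_right_mono add_mono) auto
    also have "\<dots> = 2 * ?x" by (simp add: field_simps)
    finally show ?thesis by simp
  qed
  have conf1: "?S * ?N * ?K
      / (?t1) \<le> 8 * 2 powr \<bar>iTY\<bar> * ?x"
  proof -
    have "?S * ?N * ?K
        \<le> (2 * 2 powr (real n * RS)) * (2 * 2 powr (real n * R2)) * (2 * 2 powr (real n * RK))"
      using cs by (intro mult_mono) auto
    also have "\<dots> = 8 * 2 powr (real n * (RS + R2 + RK))" by (simp add: powr_add[symmetric] algebra_simps)
    finally have "?S * ?N * ?K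
      / (?t1)
      \<le> 8 * 2 powr (real n * (RS + R2 + RK)) / (?t1)"
      by (intro divide_right_mono) auto
    also have "\<dots> \<le> 8 * (2 powr \<bar>iTY\<bar> * ?x)"
      using powr_quotient_le[OF uses_exponent[OF pack1]] by simp
    finally show ?thesis by simp
  qed
  have conf2: "(?N - 1) * ?K
      / (?t2) \<le> 4 * 2 powr \<bar>iTYQ\<bar> * ?x"
  proof (cases "R2 = 0")
    \<comment> \<open>Rate 0 means a single inner word, so the factor \<open>?N - 1\<close> is 0 and
      no packing condition is called for.\<close>
    case True
    thus ?thesis using cs by simp
  next
    case False
    hence pack: "R2 + RK \<le> iVBU + k * iTYQ - (2 + k) * \<delta>" using pack2 by simp
    have "(?N - 1) * ?K \<le> (2 * 2 powr (real n * R2)) * (2 * 2 powr (real n * RK))"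
      using cs by (intro mult_mono) auto
    also have "\<dots> = 4 * 2 powr (real n * (R2 + RK))" by (simp add: powr_add[symmetric] algebra_simps)
    finally have "(?N - 1) * ?K
      / (?t2)
      \<le> 4 * 2 powr (real n * (R2 + RK)) / (?t2)"
      by (intro divide_right_mono) auto
    also have "\<dots> \<le> 4 * (2 powr \<bar>iTYQ\<bar> * ?x)"
      using powr_quotient_le[OF uses_exponent[OF pack]] by simp
    finally show ?thesis by simp
  qed
  show ?thesis
    unfolding B.err_def B.confusion_bound_def err_bound_def err_rest_def
    using prob_not_G1 prob_not_G2 prob_not_testY cover conf1 conf2 by (simp only: distrib_right)
qed

text \<open>On typical words the sum of densities is at most m(I(T;Z|Q) + \<delta>); on the others
  it is bounded by m times the sum of all absolute densities, weighted by a vanishing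
  probability.\<close>

lemma leakage_le: "B.leakage \<le> real n * leak_rate n"
proof -
  let ?c = "\<Sum>w\<in>set_pmf chn. \<bar>dTZQ w\<bar>"
  let ?at = "\<lambda>l. of_bool (real m * \<delta> < \<bar>(\<Sum>w\<leftarrow>l. dTZQ w) - real m * pexp chn dTZQ\<bar>) :: real"
  let ?b = "1 + max 0 (real m * (iTZQ + \<delta>) - real n * RK)"
  note cs = code_size_bounds[OF R(3), of n]
  have c0: "0 \<le> ?c" by (intro sum_nonneg) auto
  have "B.leakage = pexp (iid_list m chn) (\<lambda>l. log 2 (1 + pmf (B.kZ (map chnT l)) (map chnZ l)
      / (real (code_size n RK) * pmf (B.kZQ (map chnQ l)) (map chnZ l))))"
    unfolding B.leakage_def pexp_Bchn by simp
  also have "\<dots> \<le> pexp (iid_list m chn) (\<lambda>l. ?b + real m * ?c * ?at l)"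
  proof (rule pexp_mono)
    fix l assume l: "l \<in> set_pmf (iid_list m chn)"
    have len: "length l = m" using l by (rule length_iid_list)
    have sub: "set l \<subseteq> set_pmf chn" using l by (rule set_iid_list)
    let ?S = "\<Sum>w\<leftarrow>l. dTZQ w"
    have S_le: "?S \<le> real m * ?c"
    proof -
      have "?S \<le> (\<Sum>w\<leftarrow>l. ?c)"
      proof (rule sum_list_mono)
        fix w assume "w \<in> set l"
        hence "\<bar>dTZQ w\<bar> \<le> ?c" using sub by (intro member_le_sum) auto
        thus "dTZQ w \<le> ?c" by simp
      qed
      thus ?thesis using len by (simp add: sum_list_triv)
    qed
    have ratio: "pmf (B.kZ (map chnT l)) (map chnZ l) = 2 powr ?S * pmf (B.kZQ (map chnQ l)) (map chnZ l)"
      unfolding channel_model_list pmf_kern_list dTZQ_def using chn_pos sub by (intro prod_list_ratio) auto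
    have Zpos: "0 < pmf (B.kZQ (map chnQ l)) (map chnZ l)"
      unfolding channel_model_list pmf_kern_list using sub
      by (induction l) (auto intro!: mult_pos_pos chn_pos)
    have "pmf (B.kZ (map chnT l)) (map chnZ l) / (real (code_size n RK) * pmf (B.kZQ (map chnQ l)) (map chnZ l))
        = 2 powr ?S / real (code_size n RK)"
      unfolding ratio using Zpos by simp
    also have "\<dots> \<le> 2 powr ?S / 2 powr (real n * RK)"
      using cs by (intro divide_left_mono mult_pos_pos) auto
    also have "\<dots> = 2 powr (?S - real n * RK)" by (simp add: powr_diff)
    finally have "log 2 (1 + pmf (B.kZ (map chnT l)) (map chnZ l)
        / (real (code_size n RK) * pmf (B.kZQ (map chnQ l)) (map chnZ l))) \<le> log 2 (1 + 2 powr (?S - real n * RK))"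
      using Zpos by (subst log_le_cancel_iff) (auto intro!: add_pos_nonneg)
    also have "\<dots> \<le> 1 + max 0 (?S - real n * RK)" by (rule log2_one_plus_powr_le)
    also have "\<dots> \<le> ?b + real m * ?c * ?at l"
    proof (cases "real m * \<delta> < \<bar>?S - real m * pexp chn dTZQ\<bar>")
      case True
      have "0 \<le> real n * RK" using R by simp
      thus ?thesis using True S_le c0 by (simp add: max_def)
    next
      case False
      hence "?S \<le> real m * (iTZQ + \<delta>)" by (simp add: iTZQ_def algebra_simps abs_less_iff not_less abs_le_iff)
      thus ?thesis using False by (simp add: max_def)
    qed
    finally show "log 2 (1 + pmf (B.kZ (map chnT l)) (map chnZ l)
        / (real (code_size n RK) * pmf (B.kZQ (map chnQ l)) (map chnZ l))) \<le> ?b + real m * ?c * ?at l" .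
  qed simp
  also have "\<dots> = ?b + real m * ?c * atypical chn dTZQ \<delta> m"
    by (simp add: pexp_add pexp_cmult atypical_def)
  also have "\<dots> \<le> (1 + max 0 (real n * (k * (iTZQ + \<delta>) - RK))) + (k * real n) * ?c * atypical chn dTZQ \<delta> m"
  proof (intro add_mono mult_right_mono)
    show "max 0 (real m * (iTZQ + \<delta>) - real n * RK) \<le> max 0 (real n * (k * (iTZQ + \<delta>) - RK))"
    proof (cases "0 \<le> iTZQ + \<delta>")
      case True
      hence "real m * (iTZQ + \<delta>) \<le> k * real n * (iTZQ + \<delta>)"
        using uses_bounds[of n] by (intro mult_right_mono) auto
      thus ?thesis by (simp add: algebra_simps max_def)
    next
      \<comment> \<open>With a negative factor, replacing m by kn would go the wrong way, but then
        the left side is 0.\<close>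
      case False
      hence "real m * (iTZQ + \<delta>) \<le> 0" by (simp add: mult_nonneg_nonpos)
      moreover have "0 \<le> real n * RK" using R by simp
      ultimately show ?thesis by simp
    qed
  qed (use uses_bounds[of n] c0 atypical_nonneg in auto)
  also have "max 0 (real n * (k * (iTZQ + \<delta>) - RK)) = real n * max 0 (k * (iTZQ + \<delta>) - RK)"
    by (simp add: max_def zero_le_mult_iff mult_le_0_iff)
  also have "(1 + real n * max 0 (k * (iTZQ + \<delta>) - RK)) + (k * real n) * ?c * atypical chn dTZQ \<delta> m = real n * leak_rate n"
    using n by (simp add: leak_rate_def algebra_simps)
  finally show ?thesis .
qed

lemma Bcode_law: "B.code_law enc = map_pmf (\<lambda>(s, y, z). (map (\<lambda>(a, b, e). a) s, map (\<lambda>(a, b, e). b) s, map (\<lambda>(a, b, e). e) s, y, z))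
    (block_law n enc)"
  unfolding B.code_law_def source_model_pABE block_law_def
  by (simp add: map_bind_pmf bind_map_pmf map_pmf_comp case_prod_unfold)

lemma ent_BpAE: "ent B.pAE = real n * ent pAE"
proof -
  have "B.pAE = map_pmf (\<lambda>l. (map (\<lambda>(a, b, e). a) l, map (\<lambda>(a, b, e). e) l)) (iid_list n pABE)"
    by (simp add: B.pAE_def source_model_pABE map_pmf_comp)
  also have "ent \<dots> = ent (map_pmf (map (\<lambda>(a, b, e). (a, e))) (iid_list n pABE))"
  proof (rule ent_map_eq)
    fix w w' :: "('a \<times> 'b \<times> 'e) list"
    show "(map (\<lambda>(a, b, e). a) w, map (\<lambda>(a, b, e). e) w) = (map (\<lambda>(a, b, e). a) w', map (\<lambda>(a, b, e). e) w')
        \<longleftrightarrow> map (\<lambda>(a, b, e). (a, e)) w = map (\<lambda>(a, b, e). (a, e)) w'"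
      by (auto simp: list_eq_iff_nth_eq case_prod_unfold)
  qed simp
  also have "\<dots> = ent (iid_list n pAE)" by (simp add: map_iid_list pAE_def)
  also have "\<dots> = - pexp (iid_list n pAE) (\<lambda>l. \<Sum>w\<leftarrow>l. log 2 (pmf pAE w))"
  proof -
    have "log 2 (pmf (iid_list n pAE) l) = (\<Sum>w\<leftarrow>l. log 2 (pmf pAE w))" if l: "l \<in> set_pmf (iid_list n pAE)" for l
    proof -
      have "pmf (iid_list n pAE) l = prod_list (map (pmf pAE) l)"
        using pmf_iid_list[of l n pAE "\<lambda>x. x"] length_iid_list[OF l] by simp
      moreover have "0 < pmf pAE w" if "w \<in> set l" for w
        using set_iid_list[OF l] that by (auto intro: pmf_positive)
      hence "log 2 (prod_list (map (pmf pAE) l)) = (\<Sum>w\<leftarrow>l. log 2 (pmf pAE w)) \<and> 0 < prod_list (map (pmf pAE) l)"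
        by (induction l) (auto simp: log_mult_pos)
      ultimately show ?thesis by simp
    qed
    thus ?thesis by (simp add: ent_pexp cong: pexp_cong)
  qed
  also have "\<dots> = real n * ent pAE" by (simp add: pexp_iid_sum_list ent_pexp)
  finally show ?thesis .
qed

lemma card_BpAE: "log 2 (real (card (snd ` set_pmf B.pAE))) \<le> real n * log 2 (real CARD('e))"
proof -
  have "snd ` set_pmf B.pAE \<subseteq> {xs. set xs \<subseteq> UNIV \<and> length xs = n}"
    by (auto simp: B.pAE_def source_model_pABE dest: length_iid_list)
  hence "card (snd ` set_pmf B.pAE) \<le> card {xs :: 'e list. set xs \<subseteq> UNIV \<and> length xs = n}"
    by (intro card_mono finite_lists_length_eq) auto
  also have "\<dots> = CARD('e) ^ n" by (rule card_lists_length_eq) simp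
  finally have "card (snd ` set_pmf B.pAE) \<le> CARD('e) ^ n" .
  moreover have "0 < card (snd ` set_pmf B.pAE)"
    by (simp add: card_gt_0_iff set_pmf_not_empty B.pAE_def)
  ultimately have "log 2 (real (card (snd ` set_pmf B.pAE))) \<le> log 2 (real (CARD('e) ^ n))"
    by (subst log_le_cancel_iff) (auto simp del: of_nat_power)
  also have "\<dots> = real n * log 2 (real CARD('e))" by (simp add: log_nat_power)
  finally show ?thesis .
qed

text \<open>The multiplier of the error is n\<mu> because leakage grows linearly in n: the error
  then receives leakage rate / \<mu> and the equivocation rate loses \<mu> times the error. The term
  2/n collects one bit from rounding the outer codebook and one from mixing with the uniform
  law.\<close>

lemma block_code:
  assumes cover1: "iUA + 3 * \<delta> \<le> RS" and cover2: "iVA + 3 * \<delta> \<le> RS + R2"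
    and pack1: "RS + R2 + RK \<le> iVB + k * iTY - (2 + k) * \<delta>"
    and pack2: "R2 = 0 \<or> R2 + RK \<le> iVBU + k * iTYQ - (2 + k) * \<delta>"
    and \<mu>: "0 < \<mu>"
  obtains enc dec where "\<And>a t. t \<in> set_pmf (enc a) \<Longrightarrow> length t = m"
    "block_error n enc dec \<le> err_bound n + leak_rate n / \<mu>"
    "ent pAE - RS - hEU - \<delta> - 2 / real n - (err_bound n + leak_rate n / \<mu>) * log 2 (real CARD('e))
       - \<mu> * err_bound n - leak_rate n
      \<le> block_equivocation n enc / real n"
proof -
  let ?x = "2 powr (- (real n * \<delta>))" and ?M = "real n * \<mu>"
  have M: "0 < ?M" using n \<mu> by simp
  obtain enc dec where enc: "\<And>a. set_pmf (enc a) \<subseteq> (\<Union>q\<in>set_pmf (iid_list m pQ). set_pmf (kern_list kT q))"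
    and dist: "pexp (B.code_law enc) (\<lambda>(a, b, e, y, z). of_bool (\<not> good_dist n (dec y b) a b)) \<le> B.err ?x + B.leakage / ?M"
    and eqv: "ent B.pAE - log 2 (real (code_size n RS)) - (1 + real n * (hEU + \<delta>) + (B.err ?x + B.leakage / ?M) * log 2 (real (card (snd ` set_pmf B.pAE))))
      - (?M * B.err ?x + B.leakage) \<le> cond_ent (B.code_law enc) (\<lambda>(a, b, e, y, z). a) (\<lambda>(a, b, e, y, z). (e, z))"
    by (rule B.one_shot_coding[of ?x ?M]) (use M in auto)
  have fsteq: "(\<lambda>(a, b, e). a) = (fst :: 'a \<times> 'b \<times> 'e \<Rightarrow> 'a)" by (auto simp: fun_eq_iff)
  have err: "B.err ?x \<le> err_bound n" by (rule err_le[OF cover1 cover2 pack1 pack2])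
  have "B.leakage / ?M \<le> leak_rate n / \<mu>"
    using leakage_le n \<mu> by (simp add: field_simps)
  with err have eps: "B.err ?x + B.leakage / ?M \<le> err_bound n + leak_rate n / \<mu>" by simp
  \<comment> \<open>The error bound is nonnegative because it dominates a probability; this is
    needed to multiply it with the logarithm of the alphabet size.\<close>
  have "0 \<le> pexp (B.code_law enc) (\<lambda>(a, b, e, y, z). of_bool (\<not> good_dist n (dec y b) a b))"
    by (rule pexp_nonneg) auto
  with dist have eps0: "0 \<le> B.err ?x + B.leakage / ?M" by simp
  show ?thesis
  proof (rule that[of enc dec])
    show "length t = m" if "t \<in> set_pmf (enc a)" for a t
      using enc[of a] that by (auto dest!: length_kern_list length_iid_list)
    show "block_error n enc dec \<le> err_bound n + leak_rate n / \<mu>"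
      using dist eps unfolding Bcode_law fsteq block_error_def by (simp add: case_prod_unfold)
    have card0: "0 \<le> log 2 (real (card (snd ` set_pmf B.pAE)))"
    proof -
      have "card (snd ` set_pmf B.pAE) \<noteq> 0" by (simp add: set_pmf_not_empty B.pAE_def)
      thus ?thesis by simp
    qed
    have t1: "(B.err ?x + B.leakage / ?M) * log 2 (real (card (snd ` set_pmf B.pAE)))
        \<le> (err_bound n + leak_rate n / \<mu>) * (real n * log 2 (real CARD('e)))"
      using eps eps0 card0 card_BpAE by (intro mult_mono) auto
    have t2: "?M * B.err ?x \<le> ?M * err_bound n" using err M by (intro mult_left_mono) auto
    have t3: "log 2 (real (code_size n RS)) \<le> 1 + real n * RS"
    proof -
      have "log 2 (real (code_size n RS)) \<le> log 2 (2 * 2 powr (real n * RS))"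
        using code_size_bounds[OF R(1), of n] by (subst log_le_cancel_iff) auto
      thus ?thesis by (simp add: log_mult_pos)
    qed
    have ce: "cond_ent (B.code_law enc) (\<lambda>(a, b, e, y, z). a) (\<lambda>(a, b, e, y, z). (e, z))
        = block_equivocation n enc"
      unfolding block_equivocation_def by (rule cond_ent_cong_map) (simp add: Bcode_law fsteq map_pmf_comp case_prod_unfold)
    have "real n * (ent pAE - RS - hEU - \<delta> - 2 / real n - (err_bound n + leak_rate n / \<mu>) * log 2 (real CARD('e))
       - \<mu> * err_bound n - leak_rate n) = real n * ent pAE - (1 + real n * RS)
      - (1 + real n * (hEU + \<delta>) + (err_bound n + leak_rate n / \<mu>) * (real n * log 2 (real CARD('e))))
      - (?M * err_bound n + real n * leak_rate n)"
      using n by (simp add: algebra_simps)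
    also have "\<dots> \<le> block_equivocation n enc"
      using eqv t1 t2 t3 leakage_le unfolding ent_BpAE ce by linarith
    finally show "ent pAE - RS - hEU - \<delta> - 2 / real n - (err_bound n + leak_rate n / \<mu>) * log 2 (real CARD('e))
       - \<mu> * err_bound n - leak_rate n
      \<le> block_equivocation n enc / real n"
      using n by (simp add: pos_le_divide_eq mult.commute)
  qed
qed

end

end

section \<open>Limits as the blocklength grows\<close>

context block_coding begin

lemma uses_at_top: "filterlim uses at_top sequentially"
proof -
  have "filterlim (\<lambda>n. k * real n - 1) at_top sequentially"
  proof -
    have "filterlim (\<lambda>n. k * real n) at_top sequentially"
      using k by (intro filterlim_tendsto_pos_mult_at_top[OF tendsto_const _ filterlim_real_sequentially])
    from filterlim_tendsto_add_at_top[OF tendsto_const[of "-1"] this] show ?thesis by simp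
  qed
  hence "filterlim (\<lambda>n. real (uses n)) at_top sequentially"
    by (rule filterlim_at_top_mono) (use uses_bounds(2) in auto)
  thus ?thesis by (simp add: filterlim_sequentially_iff_filterlim_real)
qed

lemma err_bound_tendsto_0: "err_bound \<longlonglongrightarrow> 0"
proof -
  have s: "atypical src \<phi> \<delta> \<longlonglongrightarrow> 0" for \<phi> using \<delta> by (intro atypical_tendsto_0) auto
  have c: "(\<lambda>n. atypical chn \<phi> \<delta> (uses n)) \<longlonglongrightarrow> 0" for \<phi>
    using \<delta> by (intro filterlim_compose[OF atypical_tendsto_0 uses_at_top]) auto
  have "(\<lambda>n. (2 powr (- \<delta>)) ^ n) \<longlonglongrightarrow> 0"
    using \<delta> by (intro LIMSEQ_realpow_zero) (auto simp: powr_less_one)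
  moreover have "(2 powr (- \<delta>)) ^ n = 2 powr (- (real n * \<delta>))" for n
    by (simp add: powr_power mult.commute)
  ultimately have x: "(\<lambda>n. 2 powr (- (real n * \<delta>))) \<longlonglongrightarrow> 0" by simp
  have "(\<lambda>n. (\<Sum>\<phi>\<leftarrow>[dUA, dVA]. atypical src \<phi> \<delta> n) + (\<Sum>\<phi>\<leftarrow>[dVB, dVBU, dEU, ddist]. atypical src \<phi> \<delta> n)
     + (\<Sum>\<phi>\<leftarrow>[dTY, dTYQ]. atypical chn \<phi> \<delta> (uses n)) + err_rest * 2 powr (- (real n * \<delta>)))
    \<longlonglongrightarrow> (0 + (0 + 0)) + (0 + (0 + (0 + (0 + 0)))) + (0 + (0 + 0)) + err_rest * 0"
    unfolding list.map sum_list.Cons sum_list.Nil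
    by (intro tendsto_add tendsto_mult tendsto_const s c x)
  thus ?thesis by (simp add: err_bound_def[abs_def])
qed

lemma leak_rate_tendsto: "leak_rate \<longlonglongrightarrow> max 0 (k * (iTZQ + \<delta>) - RK)"
proof -
  have c: "(\<lambda>n. atypical chn dTZQ \<delta> (uses n)) \<longlonglongrightarrow> 0"
    using \<delta> by (intro filterlim_compose[OF atypical_tendsto_0 uses_at_top]) auto
  have "leak_rate \<longlonglongrightarrow> 0 + max 0 (k * (iTZQ + \<delta>) - RK) + k * (\<Sum>w\<in>set_pmf chn. \<bar>dTZQ w\<bar>) * 0"
    unfolding leak_rate_def[abs_def] by (intro tendsto_add tendsto_mult tendsto_const c lim_const_over_n)
  thus ?thesis by simp
qed

text \<open>The order of choices matters: \<mu> is fixed from the limit of the leakage rate, making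
  that limit divided by \<mu> small; only afterwards is n taken large enough for \<mu> times the
  error to be small.\<close>

theorem block_coding_limit:
  assumes cover1: "iUA + 3 * \<delta> \<le> RS" and cover2: "iVA + 3 * \<delta> \<le> RS + R2"
    and pack1: "RS + R2 + RK \<le> iVB + k * iTY - (2 + k) * \<delta>"
    and pack2: "R2 = 0 \<or> R2 + RK \<le> iVBU + k * iTYQ - (2 + k) * \<delta>"
    and \<epsilon>: "0 < \<epsilon>"
  obtains n enc dec where "0 < n" "\<And>a t. t \<in> set_pmf (enc a) \<Longrightarrow> length t = uses n"
    "block_error n enc dec \<le> \<epsilon>"
    "ent pAE - RS - hEU - \<delta> - max 0 (k * (iTZQ + \<delta>) - RK) - \<epsilon>
      \<le> block_equivocation n enc / real n"
proof -
  define L where "L = max 0 (k * (iTZQ + \<delta>) - RK)"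
  define c where "c = log 2 (real CARD('e))"
  have L0: "0 \<le> L" by (simp add: L_def)
  have "0 < CARD('e)" by simp
  hence "1 \<le> real CARD('e)" by linarith
  hence c0: "0 \<le> c" unfolding c_def by (subst zero_le_log_cancel_iff) auto
  \<comment> \<open>Target for the error probability, small enough to absorb the logarithm of Eve's
    alphabet.\<close>
  define \<theta> where "\<theta> = \<epsilon> / (4 * (c + 1))"
  have \<theta>: "0 < \<theta>" "\<theta> \<le> \<epsilon>" "\<theta> * c \<le> \<epsilon> / 4"
  proof -
    show "0 < \<theta>" using \<epsilon> c0 by (simp add: \<theta>_def)
    have "\<theta> * (4 * (c + 1)) = \<epsilon>" using c0 by (simp add: \<theta>_def)
    moreover have "0 \<le> \<theta> * c" using \<open>0 < \<theta>\<close> c0 by simp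
    ultimately show "\<theta> \<le> \<epsilon>" "\<theta> * c \<le> \<epsilon> / 4"
      using \<open>0 < \<theta>\<close> by (simp_all add: algebra_simps)
  qed
  \<comment> \<open>The leakage rate is eventually below L + 1, so its quotient by \<mu> is at most
    \<theta>/2.\<close>
  define \<mu> where "\<mu> = 2 * (L + 1) / \<theta>"
  have \<mu>: "0 < \<mu>" using \<theta> L0 by (simp add: \<mu>_def)
  have "eventually (\<lambda>n. err_bound n < min (\<theta> / 2) (\<epsilon> / 4 / \<mu>)) sequentially"
    using err_bound_tendsto_0 \<theta> \<epsilon> \<mu> by (intro order_tendstoD(2)) auto
  moreover have "eventually (\<lambda>n. leak_rate n < L + min 1 (\<epsilon> / 4)) sequentially"
    using leak_rate_tendsto \<epsilon> by (intro order_tendstoD(2)) (auto simp: L_def)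
  moreover have "eventually (\<lambda>n. 2 / real n < \<epsilon> / 4) sequentially"
    using \<epsilon> by (intro order_tendstoD(2)[OF lim_const_over_n]) auto
  moreover have "eventually (\<lambda>n::nat. 0 < n) sequentially" by (rule eventually_gt_at_top)
  ultimately have "eventually (\<lambda>n. err_bound n < min (\<theta> / 2) (\<epsilon> / 4 / \<mu>) \<and> leak_rate n < L + min 1 (\<epsilon> / 4)
      \<and> 2 / real n < \<epsilon> / 4 \<and> 0 < n) sequentially"
    by eventually_elim auto
  then obtain n where n: "err_bound n < min (\<theta> / 2) (\<epsilon> / 4 / \<mu>)" "leak_rate n < L + min 1 (\<epsilon> / 4)"
    "2 / real n < \<epsilon> / 4" "0 < n"
    by (auto simp: eventually_sequentially)
  obtain enc dec where enc: "\<And>a t. t \<in> set_pmf (enc a) \<Longrightarrow> length t = uses n"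
    and dist: "block_error n enc dec
      \<le> err_bound n + leak_rate n / \<mu>"
    and eqv: "ent pAE - RS - hEU - \<delta> - 2 / real n - (err_bound n + leak_rate n / \<mu>) * log 2 (real CARD('e))
       - \<mu> * err_bound n - leak_rate n
      \<le> block_equivocation n enc / real n"
    by (rule block_code[OF n(4) cover1 cover2 pack1 pack2 \<mu>]) (rule that)
  have "leak_rate n / \<mu> \<le> (L + 1) / \<mu>" using n(2) \<mu> by (intro divide_right_mono) auto
  also have "\<dots> = \<theta> / 2"
  proof -
    have *: "K / (2 * K / \<theta>) = \<theta> / 2" if "0 < K" for K
      using that \<theta>(1) by (simp add: field_simps)
    show ?thesis unfolding \<mu>_def using L0 by (intro *) simp
  qed
  finally have \<beta>: "err_bound n + leak_rate n / \<mu> \<le> \<theta>" using n(1) by linarith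
  hence "(err_bound n + leak_rate n / \<mu>) * c \<le> \<theta> * c" using c0 by (rule mult_right_mono)
  moreover have "\<mu> * err_bound n \<le> \<epsilon> / 4"
    using n(1) \<mu> by (simp add: pos_less_divide_eq mult.commute)
  ultimately have "ent pAE - RS - hEU - \<delta> - L - \<epsilon>
      \<le> block_equivocation n enc / real n"
    using eqv n(2,3) \<theta>(3) unfolding c_def[symmetric] by linarith
  hence eqv': "ent pAE - RS - hEU - \<delta> - max 0 (k * (iTZQ + \<delta>) - RK) - \<epsilon>
      \<le> block_equivocation n enc / real n"
    unfolding L_def .
  have dist': "block_error n enc dec \<le> \<epsilon>"
    using dist \<beta> \<theta>(2) by linarith
  show ?thesis
    by (rule that[OF n(4) _ dist' eqv']) (rule enc)
qed

end

section \<open>Single-letter identities\<close>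

lemma ent_return: "ent (return_pmf x) = 0"
  by (simp add: ent_def)

lemma ent_map_const: "ent (map_pmf (\<lambda>_. c) J) = 0"
  by (simp add: map_pmf_const ent_return)

lemma cond_ent_chain: "ent (map_pmf (\<lambda>w. (X w, Y w)) J) = cond_ent J X Y + ent (map_pmf Y J)"
  by (simp add: cond_ent_def)

lemma cond_ent_map: "cond_ent (map_pmf f J) X Y = cond_ent J (\<lambda>w. X (f w)) (\<lambda>w. Y (f w))"
  by (simp add: cond_ent_def map_pmf_comp)

lemma cmi_map: "cmi (map_pmf f J) X Y Z = cmi J (\<lambda>w. X (f w)) (\<lambda>w. Y (f w)) (\<lambda>w. Z (f w))"
  by (simp add: cmi_def cond_ent_map)

lemma mi_map: "mi (map_pmf f J) X Y = mi J (\<lambda>w. X (f w)) (\<lambda>w. Y (f w))"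
  by (simp add: mi_def cmi_map)

lemma mi_nonneg: "finite (set_pmf J) \<Longrightarrow> 0 \<le> mi J X Y"
  unfolding mi_def by (rule cmi_nonneg)

lemma cmi_alt:
  assumes "finite (set_pmf J)"
  shows "cmi J X Y Z = cond_ent J Y Z - cond_ent J Y (\<lambda>w. (X w, Z w))"
proof -
  have "ent (map_pmf (\<lambda>w. (X w, Y w, Z w)) J) = ent (map_pmf (\<lambda>w. (Y w, X w, Z w)) J)"
    using assms by (rule ent_map_eq) auto
  thus ?thesis by (simp add: cmi_def cond_ent_def)
qed

lemma mi_alt:
  assumes "finite (set_pmf J)"
  shows "mi J X Y = ent (map_pmf Y J) - cond_ent J Y X"
proof -
  have "ent (map_pmf (\<lambda>w. (Y w, ())) J) = ent (map_pmf Y J)" "ent (map_pmf (\<lambda>w. (X w, ())) J) = ent (map_pmf X J)"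
    "ent (map_pmf (\<lambda>w. (Y w, X w, ())) J) = ent (map_pmf (\<lambda>w. (Y w, X w)) J)"
    using assms by (rule ent_map_eq, auto)+
  thus ?thesis using assms by (simp add: mi_def cmi_alt cond_ent_def ent_map_const ent_return)
qed

lemma pexp_log_ratio:
  assumes "finite (set_pmf p)" "\<And>w. w \<in> set_pmf p \<Longrightarrow> 0 < f w" "\<And>w. w \<in> set_pmf p \<Longrightarrow> 0 < g w"
  shows "pexp p (\<lambda>w. log 2 (f w / g w)) = pexp p (\<lambda>w. log 2 (f w)) - pexp p (\<lambda>w. log 2 (g w))"
  unfolding pexp_diff[OF assms(1), symmetric] using assms by (intro pexp_cong) (simp add: log_divide_pos)

lemmas pmf_monad_simps = map_pmf_def bind_assoc_pmf bind_return_pmf bind_return_pmf' bind_pmf_const case_prod_unfold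

section \<open>Identities for the source and the channel\<close>

context wiretap_model begin

context
  assumes fin: "finite (set_pmf src)"
begin

lemma source_marginals: "map_pmf srcA src = pA" "map_pmf srcB src = pB" "map_pmf (\<lambda>w. (srcA w, srcE w)) src = pAE"
  "map_pmf (\<lambda>w. (srcA w, srcB w, srcE w)) src = pABE"
  by (simp_all add: src_def pA_def kAU_def[abs_def] pB_def kBU_def[abs_def] kB_def[abs_def] pAE_def pABE_def letter_defs pmf_monad_simps)

lemmas src_simps = src_def letter_defs pmf_monad_simps kAU_def kB_def kBU_def kEU_def

lemma source_cond_ents:
  "cond_ent src srcA srcU = - pexp src (\<lambda>w. log 2 (pmf (kAU (srcU w)) (srcA w)))"
  "cond_ent src srcA srcV = - pexp src (\<lambda>w. log 2 (pmf (kA (srcV w)) (srcA w)))"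
  "cond_ent src srcA (\<lambda>w. (srcV w, srcU w)) = - pexp src (\<lambda>w. log 2 (pmf (kA (srcV w)) (srcA w)))"
  "cond_ent src srcB srcU = - pexp src (\<lambda>w. log 2 (pmf (kBU (srcU w)) (srcB w)))"
  "cond_ent src srcB srcV = - pexp src (\<lambda>w. log 2 (pmf (kB (srcV w)) (srcB w)))"
  "cond_ent src srcB (\<lambda>w. (srcV w, srcU w)) = - pexp src (\<lambda>w. log 2 (pmf (kB (srcV w)) (srcB w)))"
  "cond_ent src srcE srcU = - pexp src (\<lambda>w. log 2 (pmf (kEU (srcU w)) (srcE w)))"
  subgoal by (subst cond_ent_kernel[OF fin, where K = kAU]) (simp_all add: src_simps)
  subgoal by (subst cond_ent_kernel[OF fin, where K = kA]) (simp_all add: src_simps)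
  subgoal by (subst cond_ent_kernel[OF fin, where K = "\<lambda>x. kA (fst x)"]) (simp_all add: src_simps)
  subgoal by (subst cond_ent_kernel[OF fin, where K = kBU]) (simp_all add: src_simps)
  subgoal by (subst cond_ent_kernel[OF fin, where K = kB]) (simp_all add: src_simps)
  subgoal by (subst cond_ent_kernel[OF fin, where K = "\<lambda>x. kB (fst x)"]) (simp_all add: src_simps)
  subgoal by (subst cond_ent_kernel[OF fin, where K = kEU]) (simp_all add: src_simps)
  done

lemma source_markov:
  "cond_ent src srcB (\<lambda>w. (srcA w, srcU w)) = cond_ent src srcB srcA"
  "cond_ent src srcB (\<lambda>w. (srcA w, srcV w)) = cond_ent src srcB srcA"
  "cond_ent src srcB (\<lambda>w. (srcA w, srcV w, srcU w)) = cond_ent src srcB srcA"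
  "cond_ent src srcE (\<lambda>w. (srcA w, srcU w)) = cond_ent src srcE srcA"
proof -
  let ?B = "\<lambda>a. map_pmf fst (kBE a)" and ?E = "\<lambda>a. map_pmf snd (kBE a)"
  have B: "cond_ent src srcB srcA = - pexp src (\<lambda>w. log 2 (pmf (?B (srcA w)) (srcB w)))"
    by (subst cond_ent_kernel[OF fin, where K = ?B]) (simp_all add: src_simps)
  have E: "cond_ent src srcE srcA = - pexp src (\<lambda>w. log 2 (pmf (?E (srcA w)) (srcE w)))"
    by (subst cond_ent_kernel[OF fin, where K = ?E]) (simp_all add: src_simps)
  show "cond_ent src srcB (\<lambda>w. (srcA w, srcU w)) = cond_ent src srcB srcA"
    unfolding B by (subst cond_ent_kernel[OF fin, where K = "\<lambda>x. ?B (fst x)"]) (simp_all add: src_simps)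
  show "cond_ent src srcB (\<lambda>w. (srcA w, srcV w)) = cond_ent src srcB srcA"
    unfolding B by (subst cond_ent_kernel[OF fin, where K = "\<lambda>x. ?B (fst x)"]) (simp_all add: src_simps)
  show "cond_ent src srcB (\<lambda>w. (srcA w, srcV w, srcU w)) = cond_ent src srcB srcA"
    unfolding B by (subst cond_ent_kernel[OF fin, where K = "\<lambda>x. ?B (fst x)"]) (simp_all add: src_simps)
  show "cond_ent src srcE (\<lambda>w. (srcA w, srcU w)) = cond_ent src srcE srcA"
    unfolding E by (subst cond_ent_kernel[OF fin, where K = "\<lambda>x. ?E (fst x)"]) (simp_all add: src_simps)
qed

lemma source_information:
  "iUA = ent (map_pmf srcA src) - cond_ent src srcA srcU"
  "iVA = ent (map_pmf srcA src) - cond_ent src srcA srcV"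
  "iVB = ent (map_pmf srcB src) - cond_ent src srcB srcV"
  "iVBU = cond_ent src srcB srcU - cond_ent src srcB srcV"
  "hEU = cond_ent src srcE srcU"
proof -
  have H: "ent (map_pmf srcA src) = - pexp src (\<lambda>w. log 2 (pmf pA (srcA w)))"
    "ent (map_pmf srcB src) = - pexp src (\<lambda>w. log 2 (pmf pB (srcB w)))"
    unfolding ent_map_pexp[OF fin] unfolding source_marginals by simp_all
  show "iUA = ent (map_pmf srcA src) - cond_ent src srcA srcU"
    "iVA = ent (map_pmf srcA src) - cond_ent src srcA srcV"
    "iVB = ent (map_pmf srcB src) - cond_ent src srcB srcV"
    "iVBU = cond_ent src srcB srcU - cond_ent src srcB srcV"
    "hEU = cond_ent src srcE srcU"
    unfolding iUA_def iVA_def iVB_def iVBU_def hEU_def dUA_def[abs_def] dVA_def[abs_def] dVB_def[abs_def] dVBU_def[abs_def]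
      dEU_def[abs_def] H source_cond_ents
    using fin src_pos by (simp_all add: pexp_log_ratio)
qed

text \<open>Chain rules along (U,V) - A - (B,E) and U - V - A. The fourth identity is what turns the
  outer rate and the cross entropy of E into H(A|U,E).\<close>

lemma source_identities:
  "cmi src srcU srcA srcB = iUA - (ent (map_pmf srcB src) - cond_ent src srcB srcU)"
  "cmi src srcV srcA srcB = iVA - iVB"
  "cmi src srcV srcA (\<lambda>w. (srcU w, srcB w)) = iVA - iUA - iVBU"
  "cond_ent src srcA (\<lambda>w. (srcU w, srcE w)) = ent pAE - iUA - hEU"
  "0 \<le> iUA" "0 \<le> iVBU"
proof -
  note ch = cond_ent_chain[of _ _ src]
  \<comment> \<open>Tuples are reordered so that the chain rule splits off B or E first, where the
    Markov property applies.\<close>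
  have perm: "ent (map_pmf (\<lambda>w. (srcU w, srcB w)) src) = ent (map_pmf (\<lambda>w. (srcB w, srcU w)) src)"
    "ent (map_pmf (\<lambda>w. (srcV w, srcB w)) src) = ent (map_pmf (\<lambda>w. (srcB w, srcV w)) src)"
    "ent (map_pmf (\<lambda>w. (srcA w, srcB w)) src) = ent (map_pmf (\<lambda>w. (srcB w, srcA w)) src)"
    "ent (map_pmf (\<lambda>w. (srcU w, srcA w, srcB w)) src) = ent (map_pmf (\<lambda>w. (srcB w, srcA w, srcU w)) src)"
    "ent (map_pmf (\<lambda>w. (srcV w, srcA w, srcB w)) src) = ent (map_pmf (\<lambda>w. (srcB w, srcA w, srcV w)) src)"
    "ent (map_pmf (\<lambda>w. (srcV w, srcU w, srcB w)) src) = ent (map_pmf (\<lambda>w. (srcB w, srcV w, srcU w)) src)"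
    "ent (map_pmf (\<lambda>w. (srcV w, srcA w, srcU w, srcB w)) src) = ent (map_pmf (\<lambda>w. (srcB w, srcA w, srcV w, srcU w)) src)"
    "ent (map_pmf (\<lambda>w. (srcA w, srcU w, srcB w)) src) = ent (map_pmf (\<lambda>w. (srcB w, srcA w, srcU w)) src)"
    "ent (map_pmf (\<lambda>w. (srcA w, srcU w, srcE w)) src) = ent (map_pmf (\<lambda>w. (srcE w, srcA w, srcU w)) src)"
    "ent (map_pmf (\<lambda>w. (srcU w, srcE w)) src) = ent (map_pmf (\<lambda>w. (srcE w, srcU w)) src)"
    "ent (map_pmf (\<lambda>w. (srcA w, srcE w)) src) = ent (map_pmf (\<lambda>w. (srcE w, srcA w)) src)"
    by (rule ent_map_eq[OF fin]; auto)+
  show "cmi src srcU srcA srcB = iUA - (ent (map_pmf srcB src) - cond_ent src srcB srcU)"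
    unfolding cmi_def cond_ent_def[of _ srcU] unfolding perm unfolding ch source_markov source_information by simp
  show "cmi src srcV srcA srcB = iVA - iVB"
    unfolding cmi_def cond_ent_def[of _ srcV] unfolding perm unfolding ch source_markov source_information by simp
  show "cmi src srcV srcA (\<lambda>w. (srcU w, srcB w)) = iVA - iUA - iVBU"
    unfolding cmi_def cond_ent_def[of _ srcV] unfolding perm unfolding ch source_markov source_information
    using source_cond_ents by simp
  have "cond_ent src srcA (\<lambda>w. (srcU w, srcE w)) = ent (map_pmf (\<lambda>w. (srcA w, srcU w, srcE w)) src) - ent (map_pmf (\<lambda>w. (srcU w, srcE w)) src)"
    by (rule cond_ent_def)
  also have "\<dots> = cond_ent src srcE srcA + cond_ent src srcA srcU - cond_ent src srcE srcU"
    unfolding perm unfolding ch source_markov by simp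
  also have "cond_ent src srcE srcA = ent pAE - ent (map_pmf srcA src)"
    unfolding source_marginals(3)[symmetric] unfolding perm unfolding ch by simp
  finally show "cond_ent src srcA (\<lambda>w. (srcU w, srcE w)) = ent pAE - iUA - hEU"
    by (simp add: source_information)
  have "0 \<le> mi src srcU srcA" by (rule mi_nonneg[OF fin])
  thus "0 \<le> iUA" by (simp add: mi_alt fin source_information)
  have "0 \<le> cmi src srcV srcB srcU" by (rule cmi_nonneg[OF fin])
  thus "0 \<le> iVBU" unfolding cmi_alt[OF fin] source_information source_cond_ents by simp
qed

end

context
  assumes fin: "finite (set_pmf chn)"
begin

text \<open>The last equation is the chain rule I(T;Y) = I(Q;Y) + I(T;Y|Q), valid because Q - T - Y
  is a Markov chain.\<close>

lemma channel_information:
  "mi chn chnT chnY = iTY" "cmi chn chnT chnY chnQ = iTYQ" "cmi chn chnT chnZ chnQ = iTZQ"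
  "mi chn chnQ chnY = iTY - iTYQ"
proof -
  note s = chn_def letter_defs pmf_monad_simps kY_def kYQ_def kZ_def kZQ_def pY_def
  have pY: "map_pmf chnY chn = pY" by (simp add: s kYQ_def[abs_def] kY_def[abs_def])
  have "map_pmf (\<lambda>w. (chnT w, chnY w)) chn = bind_pmf (map_pmf chnT chn) (\<lambda>x. map_pmf (Pair x) (kY x))" by (simp add: s)
  note YT = cond_ent_kernel[OF fin this]
  have "map_pmf (\<lambda>w. (chnQ w, chnY w)) chn = bind_pmf (map_pmf chnQ chn) (\<lambda>x. map_pmf (Pair x) (kYQ x))" by (simp add: s)
  note YQ = cond_ent_kernel[OF fin this]
  have "map_pmf (\<lambda>w. (chnQ w, chnZ w)) chn = bind_pmf (map_pmf chnQ chn) (\<lambda>x. map_pmf (Pair x) (kZQ x))" by (simp add: s)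
  note ZQ = cond_ent_kernel[OF fin this]
  have "map_pmf (\<lambda>w. ((chnT w, chnQ w), chnY w)) chn = bind_pmf (map_pmf (\<lambda>w. (chnT w, chnQ w)) chn) (\<lambda>x. map_pmf (Pair x) (kY (fst x)))" by (simp add: s)
  note YTQ = cond_ent_kernel[OF fin this]
  have "map_pmf (\<lambda>w. ((chnT w, chnQ w), chnZ w)) chn = bind_pmf (map_pmf (\<lambda>w. (chnT w, chnQ w)) chn) (\<lambda>x. map_pmf (Pair x) (kZ (fst x)))" by (simp add: s)
  note ZTQ = cond_ent_kernel[OF fin this]
  have i: "iTY = pexp chn (\<lambda>w. log 2 (pmf (kY (chnT w)) (chnY w))) - pexp chn (\<lambda>w. log 2 (pmf pY (chnY w)))"
    "iTYQ = pexp chn (\<lambda>w. log 2 (pmf (kY (chnT w)) (chnY w))) - pexp chn (\<lambda>w. log 2 (pmf (kYQ (chnQ w)) (chnY w)))"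
    "iTZQ = pexp chn (\<lambda>w. log 2 (pmf (kZ (chnT w)) (chnZ w))) - pexp chn (\<lambda>w. log 2 (pmf (kZQ (chnQ w)) (chnZ w)))"
    unfolding iTY_def iTYQ_def iTZQ_def dTY_def[abs_def] dTYQ_def[abs_def] dTZQ_def[abs_def]
    using fin chn_pos by (simp_all add: pexp_log_ratio)
  have HY: "ent (map_pmf chnY chn) = - pexp chn (\<lambda>w. log 2 (pmf pY (chnY w)))"
    unfolding ent_map_pexp[OF fin] unfolding pY ..
  show "mi chn chnT chnY = iTY" "cmi chn chnT chnY chnQ = iTYQ" "cmi chn chnT chnZ chnQ = iTZQ"
    "mi chn chnQ chnY = iTY - iTYQ"
    unfolding mi_alt[OF fin] cmi_alt[OF fin] HY YT YQ ZQ YTQ ZTQ i by simp_all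
qed

lemma channel_information_nonneg: "0 \<le> iTY" "0 \<le> iTYQ" "0 \<le> iTZQ"
  using mi_nonneg[OF fin, of chnT chnY] cmi_nonneg[OF fin, of chnT chnY chnQ] cmi_nonneg[OF fin, of chnT chnZ chnQ]
  by (simp_all add: channel_information)

end

end

section \<open>Achievability\<close>

lemma bind_cond_kernel_pair:
  "bind_pmf (map_pmf fst P) (\<lambda>x. bind_pmf (cond_kernel P x) (F x)) = bind_pmf P (\<lambda>(x, y). F x y)"
proof -
  have "bind_pmf P (\<lambda>(x, y). F x y)
      = bind_pmf (bind_pmf (map_pmf fst P) (\<lambda>x. map_pmf (Pair x) (cond_kernel P x))) (\<lambda>(x, y). F x y)"
    by (simp only: bind_cond_kernel)
  thus ?thesis by (simp add: bind_assoc_pmf bind_map_pmf)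
qed

text \<open>Bayes' rule as a kernel: the posterior of x given y.\<close>

definition backward :: "'x pmf \<Rightarrow> ('x \<Rightarrow> 'y pmf) \<Rightarrow> 'y \<Rightarrow> 'x pmf" where
  "backward p K = cond_kernel (bind_pmf p (\<lambda>x. map_pmf (\<lambda>y. (y, x)) (K x)))"

lemma bind_backward:
  "bind_pmf (bind_pmf p K) (\<lambda>y. bind_pmf (backward p K y) (\<lambda>x. F x y)) = bind_pmf p (\<lambda>x. bind_pmf (K x) (F x))"
proof -
  have "map_pmf fst (bind_pmf p (\<lambda>x. map_pmf (\<lambda>y. (y, x)) (K x))) = bind_pmf p K"
    by (simp add: map_bind_pmf map_pmf_comp)
  thus ?thesis
    using bind_cond_kernel_pair[of "bind_pmf p (\<lambda>x. map_pmf (\<lambda>y. (y, x)) (K x))" "\<lambda>y x. F x y"]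
    by (simp add: backward_def bind_assoc_pmf bind_map_pmf)
qed

text \<open>The source and channel halves of the single-letter law, with the auxiliary variables generated first,
  as in random coding: p(u) p(v|u) p(a|v) p(b,e|a) and p(q) p(t|q) p(x|t) P(y,z|x).\<close>

lemma source_reversal:
  fixes p :: "('a \<times> 'b \<times> 'e) pmf" and pVA :: "'a \<Rightarrow> 'v pmf" and pUV :: "'v \<Rightarrow> 'u pmf"
  defines "qA \<equiv> map_pmf fst p"
  defines "qV \<equiv> bind_pmf qA pVA"
  shows "source_model.src (bind_pmf qV pUV) (backward qV pUV) (backward qA pVA) (cond_kernel p)
    = bind_pmf p (\<lambda>(a, b, e). bind_pmf (pVA a) (\<lambda>v. map_pmf (\<lambda>u. (u, v, a, b, e)) (pUV v)))"
    and "source_model.pABE (bind_pmf qV pUV) (backward qV pUV) (backward qA pVA) (cond_kernel p) = p"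
proof -
  interpret source_model "bind_pmf qV pUV" "backward qV pUV" "backward qA pVA" "cond_kernel p" .
  have "src = bind_pmf (bind_pmf qV pUV) (\<lambda>u. bind_pmf (backward qV pUV u) (\<lambda>v. bind_pmf (backward qA pVA v) (\<lambda>a.
      map_pmf (\<lambda>(b, e). (u, v, a, b, e)) (cond_kernel p a))))"
    by (rule src_def)
  also have "\<dots> = bind_pmf qV (\<lambda>v. bind_pmf (pUV v) (\<lambda>u. bind_pmf (backward qA pVA v) (\<lambda>a.
      map_pmf (\<lambda>(b, e). (u, v, a, b, e)) (cond_kernel p a))))"
    by (rule bind_backward)
  \<comment> \<open>Given v, the draws of u and a are independent; exchanging them exposes the
    second kernel to be reversed.\<close>
  also have "\<dots> = bind_pmf (bind_pmf qA pVA) (\<lambda>v. bind_pmf (backward qA pVA v) (\<lambda>a. bind_pmf (pUV v) (\<lambda>u.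
      map_pmf (\<lambda>(b, e). (u, v, a, b, e)) (cond_kernel p a))))"
    by (subst bind_commute_pmf) (simp add: qV_def)
  also have "\<dots> = bind_pmf qA (\<lambda>a. bind_pmf (pVA a) (\<lambda>v. bind_pmf (pUV v) (\<lambda>u.
      map_pmf (\<lambda>(b, e). (u, v, a, b, e)) (cond_kernel p a))))"
    by (rule bind_backward)
  also have "\<dots> = bind_pmf qA (\<lambda>a. bind_pmf (pVA a) (\<lambda>v. bind_pmf (cond_kernel p a) (\<lambda>be. bind_pmf (pUV v) (\<lambda>u.
      return_pmf (u, v, a, fst be, snd be)))))"
    by (subst (2) bind_commute_pmf) (simp add: map_pmf_def case_prod_unfold)
  also have "\<dots> = bind_pmf qA (\<lambda>a. bind_pmf (cond_kernel p a) (\<lambda>be. bind_pmf (pVA a) (\<lambda>v. bind_pmf (pUV v) (\<lambda>u.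
      return_pmf (u, v, a, fst be, snd be)))))"
    by (subst bind_commute_pmf) simp
  also have "\<dots> = bind_pmf p (\<lambda>(a, b, e). bind_pmf (pVA a) (\<lambda>v. map_pmf (\<lambda>u. (u, v, a, b, e)) (pUV v)))"
    unfolding qA_def by (subst bind_cond_kernel_pair) (simp add: map_pmf_def case_prod_unfold)
  finally show src: "src = bind_pmf p (\<lambda>(a, b, e). bind_pmf (pVA a) (\<lambda>v. map_pmf (\<lambda>u. (u, v, a, b, e)) (pUV v)))" .
  have "map_pmf (\<lambda>(u, v, a, b, e). (a, b, e)) src = p"
    unfolding src by (simp add: pmf_monad_simps)
  moreover have "map_pmf (\<lambda>(u, v, a, b, e). (a, b, e)) src = pABE"
    by (simp add: src_def pABE_def kAU_def[abs_def] pA_def pmf_monad_simps)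
  ultimately show "pABE = p" by simp
qed

lemma channel_reversal:
  fixes px :: "'x pmf" and pTX :: "'x \<Rightarrow> 't pmf" and pQT :: "'t \<Rightarrow> 'q pmf" and W :: "'x \<Rightarrow> ('y \<times> 'z) pmf"
  defines "pT \<equiv> bind_pmf px pTX"
  shows "channel_model.chn (bind_pmf pT pQT) (backward pT pQT) (\<lambda>t. bind_pmf (backward px pTX t) W)
    = bind_pmf px (\<lambda>x. bind_pmf (pTX x) (\<lambda>t. bind_pmf (pQT t) (\<lambda>q. map_pmf (\<lambda>(y, z). (q, t, y, z)) (W x))))"
proof -
  interpret channel_model "bind_pmf pT pQT" "backward pT pQT" "\<lambda>t. bind_pmf (backward px pTX t) W" .
  have "chn = bind_pmf (bind_pmf pT pQT) (\<lambda>q. bind_pmf (backward pT pQT q) (\<lambda>t. bind_pmf (backward px pTX t) (\<lambda>x.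
      map_pmf (\<lambda>(y, z). (q, t, y, z)) (W x))))"
    by (simp add: chn_def map_bind_pmf)
  also have "\<dots> = bind_pmf pT (\<lambda>t. bind_pmf (pQT t) (\<lambda>q. bind_pmf (backward px pTX t) (\<lambda>x.
      map_pmf (\<lambda>(y, z). (q, t, y, z)) (W x))))"
    by (rule bind_backward)
  also have "\<dots> = bind_pmf (bind_pmf px pTX) (\<lambda>t. bind_pmf (backward px pTX t) (\<lambda>x. bind_pmf (pQT t) (\<lambda>q.
      map_pmf (\<lambda>(y, z). (q, t, y, z)) (W x))))"
    by (subst bind_commute_pmf) (simp add: pT_def)
  also have "\<dots> = bind_pmf px (\<lambda>x. bind_pmf (pTX x) (\<lambda>t. bind_pmf (pQT t) (\<lambda>q. map_pmf (\<lambda>(y, z). (q, t, y, z)) (W x))))"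
    by (rule bind_backward)
  finally show ?thesis .
qed

lemma sl_joint_marginals:
  "map_pmf fst (sl_joint p pVA pUV px pTX pQT W)
    = bind_pmf p (\<lambda>(a, b, e). bind_pmf (pVA a) (\<lambda>v. map_pmf (\<lambda>u. (u, v, a, b, e)) (pUV v)))"
  "map_pmf (\<lambda>(s, q, t, x, y, z). (q, t, y, z)) (sl_joint p pVA pUV px pTX pQT W)
    = bind_pmf px (\<lambda>x. bind_pmf (pTX x) (\<lambda>t. bind_pmf (pQT t) (\<lambda>q. map_pmf (\<lambda>(y, z). (q, t, y, z)) (W x))))"
  by (simp_all add: sl_joint_def pmf_monad_simps)

section \<open>From block codes to codes for the original channel\<close>

lemma chan_list_kern_pair: "chan_list W xs = kern_pair W xs"
  by (simp add: chan_list_eq_kern_list kern_pair_def)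

lemma bind_kern_pair: "bind_pmf (kern_list K xs) (kern_pair W) = kern_pair (\<lambda>x. bind_pmf (K x) W) xs"
proof -
  have "bind_pmf (kern_list K xs) (kern_pair W)
      = map_pmf (\<lambda>l. (map fst l, map snd l)) (bind_pmf (kern_list K xs) (kern_list W))"
    by (simp add: kern_pair_def[abs_def] map_bind_pmf)
  thus ?thesis by (simp add: bind_kern_list kern_pair_def)
qed

text \<open>The actual encoder appends the prefix p(x|t) letter by letter. Once the channel input is
  forgotten, prefix and channel merge into one kernel from t.\<close>

lemma code_joint_marginal:
  "map_pmf (\<lambda>(s, xs, ys, zs). (s, ys, zs)) (code_joint n p W (\<lambda>as. bind_pmf (enc as) (kern_list K)))
    = bind_pmf (iid_list n p) (\<lambda>s. bind_pmf (enc (map fst s))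
       (\<lambda>t. map_pmf (\<lambda>(y, z). (s, y, z)) (kern_pair (\<lambda>t. bind_pmf (K t) W) t)))"
  by (simp add: code_joint_def chan_list_kern_pair bind_kern_pair[symmetric] pmf_monad_simps)

lemma seq_dist_le:
  assumes "\<And>a b. d a b \<le> c"
  shows "seq_dist d as bs \<le> max 0 c"
proof (cases "length as = 0")
  case False
  have "(\<Sum>i<length as. d (as ! i) (bs ! i)) \<le> (\<Sum>i<length as. max 0 c)"
    by (intro sum_mono max.coboundedI2 assms)
  thus ?thesis using False by (simp add: seq_dist_def divide_le_eq mult.commute)
qed (simp add: seq_dist_def)

text \<open>If Bob's observation is useless, the constraints force the reconstruction variable to be independent of the
  source given the side information, so the best deterministic reconstruction from the side information is as good.\<close>
lemma cond_indep_reconstruction: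
  fixes J :: "'w pmf" and V :: "'w \<Rightarrow> 'v::finite"
  assumes fin: "finite (set_pmf J)" and ci: "cmi J V A B = 0"
  obtains v where "pexp J (\<lambda>w. c (A w) (v (B w)) (B w)) \<le> pexp J (\<lambda>w. c (A w) (V w) (B w))"
proof -
  define K where "K = cond_kernel (map_pmf (\<lambda>w. (B w, A w)) J)"
  have finK: "finite (set_pmf (K b))" for b using fin by (simp add: K_def)
  have "\<exists>v. \<forall>v'. pexp (K b) (\<lambda>a. c a v b) \<le> pexp (K b) (\<lambda>a. c a v' b)" for b
  proof -
    let ?f = "\<lambda>v. pexp (K b) (\<lambda>a. c a v b)"
    have "Min (range ?f) \<in> range ?f" by (intro Min_in) auto
    then obtain v where "?f v = Min (range ?f)" by force
    moreover have "Min (range ?f) \<le> ?f v'" for v' by (intro Min_le) auto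
    ultimately show ?thesis by metis
  qed
  then obtain v where v: "pexp (K b) (\<lambda>a. c a (v b) b) \<le> pexp (K b) (\<lambda>a. c a v' b)" for b v'
    by metis
  have "pexp J (\<lambda>w. c (A w) (v (B w)) (B w)) = pexp (map_pmf (\<lambda>w. (B w, A w)) J) (\<lambda>(b, a). c a (v b) b)"
    by simp
  also have "map_pmf (\<lambda>w. (B w, A w)) J = bind_pmf (map_pmf B J) (\<lambda>b. map_pmf (Pair b) (K b))"
    using bind_cond_kernel[of "map_pmf (\<lambda>w. (B w, A w)) J"] by (simp add: K_def map_pmf_comp)
  also have "pexp \<dots> (\<lambda>(b, a). c a (v b) b) = pexp J (\<lambda>w. pexp (K (B w)) (\<lambda>a. c a (v (B w)) (B w)))"
    using fin finK by (subst pexp_bind) auto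
  also have "\<dots> \<le> pexp J (\<lambda>w. pexp (K (B w)) (\<lambda>a. c a (V w) (B w)))"
    by (intro pexp_mono fin v)
  also have "\<dots> = pexp (bind_pmf (map_pmf (\<lambda>w. (B w, V w)) J) (\<lambda>bv. map_pmf (Pair bv) (K (fst bv)))) (\<lambda>((b, v), a). c a v b)"
    using fin finK by (subst pexp_bind) auto
  \<comment> \<open>Conditional independence: given B and V, the source still has the law
    \<open>K\<close> that depends on B alone.\<close>
  also have "bind_pmf (map_pmf (\<lambda>w. (B w, V w)) J) (\<lambda>bv. map_pmf (Pair bv) (K (fst bv))) = map_pmf (\<lambda>w. ((B w, V w), A w)) J"
    unfolding K_def using cmi_zero_imp_cond_indep[OF fin ci] by simp
  also have "pexp \<dots> (\<lambda>((b, v), a). c a v b) = pexp J (\<lambda>w. c (A w) (V w) (B w))"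
    by simp
  finally show ?thesis by (rule that)
qed

text \<open>The choice of rates: with \<alpha> = I(V;A|U,B) and y = k I(T;Y|Q), the local randomness has rate
  max 0 (y - \<alpha>) and the outer layer carries the excess rate max 0 (\<alpha> - y).\<close>
lemma rate_choice:
  fixes iUA iVA iVB iVBU iUB iTY iTYQ iTZQ k k' \<delta> :: real
  assumes nonneg: "0 \<le> iUA" "0 \<le> iVBU" "0 \<le> iTYQ" "0 \<le> iTZQ" "0 \<le> iVA - iUA - iVBU" "0 \<le> k" "k \<le> k'" "0 < \<delta>"
    and chain: "iVB = iUB + iVBU"
    and h1: "iUA - iUB \<le> k * (iTY - iTYQ)" and h2: "iVA - iVB \<le> k * iTY"
    and \<delta>: "(7 + 2 * k') * \<delta> \<le> (k' - k) * iTY"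
  obtains RS R2 RK where "0 \<le> RS" "0 \<le> R2" "0 \<le> RK" "iUA + 3 * \<delta> \<le> RS" "iVA + 3 * \<delta> \<le> RS + R2"
    "RS + R2 + RK \<le> iVB + k' * iTY - (2 + k') * \<delta>"
    "R2 = 0 \<or> R2 + RK \<le> iVBU + k' * iTYQ - (2 + k') * \<delta>"
    "RS + max 0 (k' * (iTZQ + \<delta>) - RK) \<le> iUA + max 0 (iVA - iUA - iVBU - k * (iTYQ - iTZQ))
       + ((5 + 2 * k') * \<delta> + (k' - k) * iTZQ)"
proof -
  define \<alpha> where "\<alpha> = iVA - iUA - iVBU"
  define y where "y = k * iTYQ"
  define z where "z = k * iTZQ"
  have y: "0 \<le> y" "y \<le> k' * iTYQ" using nonneg by (auto simp: y_def intro!: mult_right_mono)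
  have z: "0 \<le> z" using nonneg by (simp add: z_def)
  define RK where "RK = max 0 (y - \<alpha>)"
  \<comment> \<open>The margin is 3\<delta> + (2 + k')\<delta>: when R2 is positive, R2 = I(V;A) +
    3\<delta> - RS, and inner packing must still leave (2 + k')\<delta>.\<close>
  define RS where "RS = iUA + max 0 (\<alpha> - y) + (5 + k') * \<delta>"
  define R2 where "R2 = max 0 (iVA + 3 * \<delta> - RS)"
  have split: "max 0 (y - \<alpha>) = y - \<alpha> + max 0 (\<alpha> - y)" by simp
  have k'\<delta>: "0 \<le> k' * \<delta>" using nonneg by simp
  have exp: "(5 + k') * \<delta> = 5 * \<delta> + k' * \<delta>" "(2 + k') * \<delta> = 2 * \<delta> + k' * \<delta>" "(7 + 2 * k') * \<delta> = 7 * \<delta> + 2 * (k' * \<delta>)"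
    "(5 + 2 * k') * \<delta> = 5 * \<delta> + 2 * (k' * \<delta>)" "(k' - k) * iTY = k' * iTY - k * iTY"
    "k * (iTY - iTYQ) = k * iTY - y" "k * (iTYQ - iTZQ) = y - z" "k' * (iTZQ + \<delta>) = k' * iTZQ + k' * \<delta>"
    "(k' - k) * iTZQ = k' * iTZQ - z"
    by (simp_all add: algebra_simps y_def z_def)
  have z': "0 \<le> k' * iTZQ - z" unfolding z_def using nonneg by (simp add: mult_right_mono)
  show ?thesis
  proof (rule that[of RS R2 RK])
    show "0 \<le> RS" unfolding RS_def exp using nonneg k'\<delta> by simp
    show "0 \<le> R2" "0 \<le> RK" by (simp_all add: R2_def RK_def)
    show "iUA + 3 * \<delta> \<le> RS" unfolding RS_def exp using nonneg k'\<delta> by simp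
    show "iVA + 3 * \<delta> \<le> RS + R2" unfolding R2_def by simp
    \<comment> \<open>Together with the margin (2 + k')\<delta> of outer packing this is the origin
      of 7 + 2k' in the assumption on \<delta>.\<close>
    have "RS + R2 \<le> iVA + (5 + k') * \<delta>"
    proof -
      have "max 0 (\<alpha> - y) \<le> \<alpha>" using nonneg y by (simp add: \<alpha>_def)
      hence "RS \<le> iVA + (5 + k') * \<delta>" unfolding RS_def using nonneg by (simp add: \<alpha>_def)
      thus ?thesis unfolding R2_def exp using nonneg k'\<delta> by (simp add: max_def)
    qed
    \<comment> \<open>Both information constraints meet here. If \<alpha> \<ge> y then RK = 0 and
      this is \<open>h2\<close>; otherwise the left side equals I(U;A) - I(U;B) + y, bounded by
      \<open>h1\<close>.\<close>
    moreover have "iVA - iVB + RK \<le> k * iTY"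
      unfolding RK_def using h1 h2 chain unfolding exp by (simp add: max_def \<alpha>_def)
    ultimately show "RS + R2 + RK \<le> iVB + k' * iTY - (2 + k') * \<delta>"
      using \<delta> unfolding exp by simp
    show "R2 = 0 \<or> R2 + RK \<le> iVBU + k' * iTYQ - (2 + k') * \<delta>"
    proof (cases "R2 = 0")
      case False
      hence "R2 = iVA + 3 * \<delta> - RS" by (simp add: R2_def max_def split: if_splits)
      thus ?thesis unfolding RS_def RK_def split exp using y by (simp add: \<alpha>_def)
    qed simp
    \<comment> \<open>If \<alpha> > y, Eve gets all of z and the excess outer rate adds \<alpha> -
      y; otherwise she gets what z has beyond y - \<alpha>. Both amount to the positive part of
      \<alpha> - (y - z), up to the margins.\<close>
    show "RS + max 0 (k' * (iTZQ + \<delta>) - RK) \<le> iUA + max 0 (iVA - iUA - iVBU - k * (iTYQ - iTZQ))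
       + ((5 + 2 * k') * \<delta> + (k' - k) * iTZQ)"
      unfolding RS_def RK_def exp \<alpha>_def[symmetric] using z z' k'\<delta> by (simp add: max_def mult.commute)
  qed
qed

text \<open>Turns a bound on the probability of excess distortion into one on its mean: the bad
  event costs at most the maximal distortion c. The reconstruction applies \<open>Ahat\<close> to
  the decoded inner word and the side information letter by letter.\<close>

lemma achievable_block_code:
  fixes p :: "('a::finite \<times> 'b::finite \<times> 'e::finite) pmf" and W :: "'x::finite \<Rightarrow> ('y::finite \<times> 'z::finite) pmf"
    and enc :: "'a list \<Rightarrow> 't::finite list pmf" and dec :: "'y list \<Rightarrow> 'b list \<Rightarrow> 'v list" and kX :: "'t \<Rightarrow> 'x pmf"
    and Ahat :: "'v \<Rightarrow> 'b \<Rightarrow> 'a" and n :: nat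
  defines "enc' \<equiv> \<lambda>as. bind_pmf (enc as) (kern_list kX)"
  defines "g \<equiv> \<lambda>ys bs. map (\<lambda>i. Ahat (dec ys bs ! i) (bs ! i)) [0..<length bs]"
  defines "law \<equiv> bind_pmf (iid_list n p) (\<lambda>s. bind_pmf (enc (map fst s))
       (\<lambda>t. map_pmf (\<lambda>(y, z). (s, y, z)) (kern_pair (\<lambda>t. bind_pmf (kX t) W) t)))"
  assumes n: "0 < n" and D0: "0 \<le> D" and enc: "\<forall>a. \<forall>t\<in>set_pmf (enc a). length t = m"
    and d: "\<And>a a'. 0 \<le> d a a'" "\<And>a a'. d a a' \<le> c"
    and bad: "pexp law (\<lambda>(s, y, z). of_bool (\<not> (\<Sum>i<n. d (map fst s ! i)
       (Ahat (dec y (map (\<lambda>(a, b, e). b) s) ! i) (map (\<lambda>(a, b, e). b) s ! i))) \<le> real n * D)) \<le> \<epsilon>"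
  shows "valid_code n m enc' g"
    and "measure_pmf.expectation (code_joint n p W enc')
         (\<lambda>(s, xs, ys, zs). seq_dist d (map fst s) (g ys (map (\<lambda>t. fst (snd t)) s))) \<le> D + c * \<epsilon>"
    and "cond_ent (code_joint n p W enc') (\<lambda>(s, xs, ys, zs). map fst s) (\<lambda>(s, xs, ys, zs). (map (\<lambda>t. snd (snd t)) s, zs))
       = cond_ent law (\<lambda>(s, y, z). map fst s) (\<lambda>(s, y, z). (map (\<lambda>(a, b, e). e) s, z))"
proof -
  have law: "law = map_pmf (\<lambda>(s, xs, ys, zs). (s, ys, zs)) (code_joint n p W enc')"
    unfolding law_def enc'_def code_joint_marginal ..
  have "finite (set_pmf (enc a))" for a
    by (rule finite_subset[OF _ finite_lists_length_eq[of UNIV m]]) (use enc in auto)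
  hence finlaw: "finite (set_pmf law)" unfolding law_def by simp
  have c: "0 \<le> c" using d order_trans by blast
  show "valid_code n m enc' g"
    unfolding valid_code_def enc'_def g_def using enc by (auto dest!: length_kern_list)
  let ?b = "\<lambda>s :: ('a \<times> 'b \<times> 'e) list. map (\<lambda>(a, b, e). b) s"
  let ?good = "\<lambda>s y. (\<Sum>i<n. d (map fst s ! i) (Ahat (dec y (?b s) ! i) (?b s ! i))) \<le> real n * D"
  have D: "seq_dist d (map fst s) (g y (map (\<lambda>t. fst (snd t)) s)) \<le> D + c * of_bool (\<not> ?good s y)" if "length s = n" for s y
  proof (cases "?good s y")
    case True
    have beq: "map (\<lambda>t. fst (snd t)) s = ?b s" by (simp add: case_prod_unfold)
    have "seq_dist d (map fst s) (g y (?b s))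
        = (\<Sum>i<n. d (map fst s ! i) (Ahat (dec y (?b s) ! i) (?b s ! i))) / real n"
      using that by (simp add: seq_dist_def g_def)
    also have "\<dots> \<le> D" using True n by (simp add: divide_le_eq mult.commute)
    finally show ?thesis using True by (simp add: beq)
  next
    case False
    have "seq_dist d (map fst s) (g y (map (\<lambda>t. fst (snd t)) s)) \<le> max 0 c" by (rule seq_dist_le[OF d(2)])
    thus ?thesis using False c D0 by simp
  qed
  show "measure_pmf.expectation (code_joint n p W enc')
         (\<lambda>(s, xs, ys, zs). seq_dist d (map fst s) (g ys (map (\<lambda>t. fst (snd t)) s))) \<le> D + c * \<epsilon>"
  proof -
    have "measure_pmf.expectation (code_joint n p W enc')
         (\<lambda>(s, xs, ys, zs). seq_dist d (map fst s) (g ys (map (\<lambda>t. fst (snd t)) s)))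
        = pexp law (\<lambda>(s, y, z). seq_dist d (map fst s) (g y (map (\<lambda>t. fst (snd t)) s)))"
      unfolding law pexp_map by (simp add: pexp_def case_prod_unfold)
    also have "\<dots> \<le> pexp law (\<lambda>(s, y, z). D + c * of_bool (\<not> ?good s y))"
    proof (rule pexp_mono[OF finlaw])
      fix w assume "w \<in> set_pmf law"
      hence "length (fst w) = n" by (auto simp: law_def dest: length_iid_list)
      thus "(case w of (s, y, z) \<Rightarrow> seq_dist d (map fst s) (g y (map (\<lambda>t. fst (snd t)) s)))
          \<le> (case w of (s, y, z) \<Rightarrow> D + c * of_bool (\<not> ?good s y))"
        using D by (cases w) simp
    qed
    also have "\<dots> = D + c * pexp law (\<lambda>(s, y, z). of_bool (\<not> ?good s y))"
      unfolding case_prod_unfold by (simp only: pexp_add[OF finlaw] pexp_cmult pexp_const)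
    also have "\<dots> \<le> D + c * \<epsilon>"
      using bad c by (intro add_left_mono mult_left_mono)
    finally show ?thesis .
  qed
  show "cond_ent (code_joint n p W enc') (\<lambda>(s, xs, ys, zs). map fst s) (\<lambda>(s, xs, ys, zs). (map (\<lambda>t. snd (snd t)) s, zs))
       = cond_ent law (\<lambda>(s, y, z). map fst s) (\<lambda>(s, y, z). (map (\<lambda>(a, b, e). e) s, z))"
    unfolding law cond_ent_map by (simp add: case_prod_unfold)
qed

theorem theorem1:
  fixes p :: "('a::finite \<times> 'b::finite \<times> 'e::finite) pmf"
    and W :: "'x::finite \<Rightarrow> ('y::finite \<times> 'z::finite) pmf"
    and d :: "'a \<Rightarrow> 'a \<Rightarrow> real"
    and k D \<Delta> :: real
    and pUV :: "'v::finite \<Rightarrow> 'u::finite pmf"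
    and pVA :: "'a \<Rightarrow> 'v pmf"
    and pQT :: "'t::finite \<Rightarrow> 'q::finite pmf"
    and pTX :: "'x \<Rightarrow> 't pmf"
    and px :: "'x pmf"
    and Ahat :: "'v \<Rightarrow> 'b \<Rightarrow> 'a"
  assumes d_nonneg: "\<forall>a a'. 0 \<le> d a a'"
    and k_nonneg: "0 \<le> k" and D_nonneg: "0 \<le> D" and Delta_nonneg: "0 \<le> \<Delta>"
  defines "J \<equiv> sl_joint p pVA pUV px pTX pQT W"
  assumes h1: "cmi J (\<lambda>((u,v,a,b,e),(q,t,x,y,z)). u) (\<lambda>((u,v,a,b,e),(q,t,x,y,z)). a)
                     (\<lambda>((u,v,a,b,e),(q,t,x,y,z)). b)
               \<le> k * mi J (\<lambda>((u,v,a,b,e),(q,t,x,y,z)). q) (\<lambda>((u,v,a,b,e),(q,t,x,y,z)). y)"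
    and h2: "cmi J (\<lambda>((u,v,a,b,e),(q,t,x,y,z)). v) (\<lambda>((u,v,a,b,e),(q,t,x,y,z)). a)
                     (\<lambda>((u,v,a,b,e),(q,t,x,y,z)). b)
               \<le> k * mi J (\<lambda>((u,v,a,b,e),(q,t,x,y,z)). t) (\<lambda>((u,v,a,b,e),(q,t,x,y,z)). y)"
    and h3: "measure_pmf.expectation J (\<lambda>((u,v,a,b,e),(q,t,x,y,z)). d a (Ahat v b)) \<le> D"
    and h4: "\<Delta> \<le> cond_ent J (\<lambda>((u,v,a,b,e),(q,t,x,y,z)). a) (\<lambda>((u,v,a,b,e),(q,t,x,y,z)). (u, e))
               - max 0 (cmi J (\<lambda>((u,v,a,b,e),(q,t,x,y,z)). v) (\<lambda>((u,v,a,b,e),(q,t,x,y,z)). a)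
                              (\<lambda>((u,v,a,b,e),(q,t,x,y,z)). (u, b))
                        - k * (cmi J (\<lambda>((u,v,a,b,e),(q,t,x,y,z)). t) (\<lambda>((u,v,a,b,e),(q,t,x,y,z)). y)
                                     (\<lambda>((u,v,a,b,e),(q,t,x,y,z)). q)
                             - cmi J (\<lambda>((u,v,a,b,e),(q,t,x,y,z)). t) (\<lambda>((u,v,a,b,e),(q,t,x,y,z)). z)
                                     (\<lambda>((u,v,a,b,e),(q,t,x,y,z)). q)))"
  shows "achievable p W d k D \<Delta>"
proof -
  define qA where "qA = map_pmf fst p"
  define qV where "qV = bind_pmf qA pVA"
  define pU where "pU = bind_pmf qV pUV"
  define kV where "kV = backward qV pUV"
  define kA where "kA = backward qA pVA"
  define kBE where "kBE = cond_kernel p"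
  define pT where "pT = bind_pmf px pTX"
  define pQ where "pQ = bind_pmf pT pQT"
  define kT where "kT = backward pT pQT"
  define kX where "kX = backward px pTX"
  define kYZ where "kYZ t = bind_pmf (kX t) W" for t
  interpret S: wiretap_model pU kV kA kBE pQ kT kYZ .
  have srcJ: "S.src = map_pmf fst J"
    unfolding J_def sl_joint_marginals(1) pU_def kV_def kA_def kBE_def qV_def qA_def by (rule source_reversal(1))
  have pABE: "S.pABE = p"
    unfolding pU_def kV_def kA_def kBE_def qV_def qA_def by (rule source_reversal(2))
  have chnJ: "S.chn = map_pmf (\<lambda>(s, q, t, x, y, z). (q, t, y, z)) J"
    unfolding J_def sl_joint_marginals(2) pQ_def kT_def kYZ_def[abs_def] kX_def pT_def by (rule channel_reversal)
  have fin: "finite (set_pmf S.src)" "finite (set_pmf S.chn)" by simp_all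
  define iUB where "iUB = ent (map_pmf srcB S.src) - cond_ent S.src srcB srcU"
  have h1': "S.iUA - iUB \<le> k * (S.iTY - S.iTYQ)"
  proof -
    have "cmi S.src srcU srcA srcB \<le> k * mi S.chn chnQ chnY"
      unfolding srcJ chnJ cmi_map mi_map using h1 by (simp add: letter_defs case_prod_unfold)
    thus ?thesis unfolding S.source_identities[OF fin(1)] S.channel_information[OF fin(2)] iUB_def .
  qed
  have h2c: "cmi S.src srcV srcA srcB \<le> k * mi S.chn chnT chnY"
    unfolding srcJ chnJ cmi_map mi_map using h2 by (simp add: letter_defs case_prod_unfold)
  hence h2': "S.iVA - S.iVB \<le> k * S.iTY"
    unfolding S.source_identities[OF fin(1)] S.channel_information[OF fin(2)] .
  have h3': "pexp S.src (\<lambda>w. d (srcA w) (Ahat (srcV w) (srcB w))) \<le> D"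
    unfolding srcJ pexp_map pexp_def using h3 by (simp add: letter_defs case_prod_unfold)
  have h4c: "\<Delta> \<le> cond_ent S.src srcA (\<lambda>w. (srcU w, srcE w)) - max 0 (cmi S.src srcV srcA (\<lambda>w. (srcU w, srcB w))
      - k * (cmi S.chn chnT chnY chnQ - cmi S.chn chnT chnZ chnQ))"
    unfolding srcJ chnJ cmi_map cond_ent_map using h4 by (simp add: letter_defs case_prod_unfold)
  hence h4': "\<Delta> \<le> ent S.pAE - S.iUA - S.hEU - max 0 (S.iVA - S.iUA - S.iVBU - k * (S.iTYQ - S.iTZQ))"
    unfolding S.source_identities[OF fin(1)] S.channel_information[OF fin(2)] .
  show ?thesis
    unfolding achievable_def
  proof (intro allI impI)
    fix \<epsilon> :: real assume \<epsilon>: "0 < \<epsilon>"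
    show "\<exists>n m (enc :: 'a list \<Rightarrow> 'x list pmf) (g :: 'y list \<Rightarrow> 'b list \<Rightarrow> 'a list). n > 0 \<and> valid_code n m enc g \<and>
       real m / real n \<le> k + \<epsilon> \<and>
       measure_pmf.expectation (code_joint n p W enc)
         (\<lambda>(s, xs, ys, zs). seq_dist d (map fst s) (g ys (map (\<lambda>t. fst (snd t)) s))) \<le> D + \<epsilon> \<and>
       cond_ent (code_joint n p W enc) (\<lambda>(s, xs, ys, zs). map fst s)
         (\<lambda>(s, xs, ys, zs). (map (\<lambda>t. snd (snd t)) s, zs)) / real n \<ge> \<Delta> - \<epsilon>"
    proof (cases "S.iTY = 0")
      case True
      \<comment> \<open>With I(T;Y) = 0 the second constraint leaves I(V;A|B) no room above
        0.\<close>
      have ci: "cmi S.src srcV srcA srcB = 0"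
        using h2c cmi_nonneg[OF fin(1), of srcV srcA srcB] True by (simp add: S.channel_information[OF fin(2)])
      obtain v where v: "pexp S.src (\<lambda>w. d (srcA w) (Ahat (v (srcB w)) (srcB w)))
          \<le> pexp S.src (\<lambda>w. d (srcA w) (Ahat (srcV w) (srcB w)))"
        using cond_indep_reconstruction[OF fin(1) ci, of "\<lambda>a v b. d a (Ahat v b)"] by blast
      \<comment> \<open>One source letter and no channel use: the reconstruction relies on side
        information alone.\<close>
      define enc :: "'a list \<Rightarrow> 'x list pmf" where "enc = (\<lambda>_. return_pmf [])"
      define g :: "'y list \<Rightarrow> 'b list \<Rightarrow> 'a list" where "g = (\<lambda>ys. map (\<lambda>b. Ahat (v b) b))"
      have joint: "code_joint 1 p W enc = map_pmf (\<lambda>t. ([t], [], [], [])) p"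
        by (simp add: code_joint_def enc_def pmf_monad_simps)
      have psrc: "p = map_pmf (\<lambda>w. (srcA w, srcB w, srcE w)) S.src"
        using S.source_marginals(4)[OF fin(1)] pABE by simp
      have "measure_pmf.expectation (code_joint 1 p W enc)
         (\<lambda>(s, xs, ys, zs). seq_dist d (map fst s) (g ys (map (\<lambda>t. fst (snd t)) s)))
          = pexp p (\<lambda>t. d (fst t) (Ahat (v (fst (snd t))) (fst (snd t))))"
        unfolding joint by (simp add: pexp_def seq_dist_def g_def)
      also have "\<dots> = pexp S.src (\<lambda>w. d (srcA w) (Ahat (v (srcB w)) (srcB w)))"
        by (subst psrc) simp
      also have "\<dots> \<le> D" using v h3' by simp
      finally have dist: "measure_pmf.expectation (code_joint 1 p W enc)
         (\<lambda>(s, xs, ys, zs). seq_dist d (map fst s) (g ys (map (\<lambda>t. fst (snd t)) s))) \<le> D" .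
      have "cond_ent (code_joint 1 p W enc) (\<lambda>(s, xs, ys, zs). map fst s) (\<lambda>(s, xs, ys, zs). (map (\<lambda>t. snd (snd t)) s, zs))
          = cond_ent S.src (\<lambda>w. [srcA w]) (\<lambda>w. ([srcE w], [] :: 'z list))"
        unfolding joint cond_ent_map by (subst psrc) (simp add: cond_ent_map)
      also have "\<dots> = cond_ent S.src srcA srcE"
        unfolding cond_ent_def by (intro arg_cong2[of _ _ _ _ "(-)"] ent_map_eq fin(1)) auto
      \<comment> \<open>Eve observes only E, and H(A|E) \<ge> H(A|U,E), from which only a
        nonnegative amount was subtracted.\<close>
      also have "\<Delta> \<le> cond_ent S.src srcA srcE"
        using h4c cmi_nonneg[OF fin(1), of srcA srcU srcE] by (simp add: cmi_def max_def split: if_splits)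
      finally have eqv: "\<Delta> \<le> cond_ent (code_joint 1 p W enc) (\<lambda>(s, xs, ys, zs). map fst s) (\<lambda>(s, xs, ys, zs). (map (\<lambda>t. snd (snd t)) s, zs))" .
      have "valid_code 1 0 enc g" by (simp add: valid_code_def enc_def g_def)
      with dist eqv \<epsilon> k_nonneg show ?thesis
        by (intro exI[of _ "1::nat"] exI[of _ "0::nat"] exI[of _ enc] exI[of _ g]) simp
    next
      case False
      note nonneg = S.channel_information_nonneg[OF fin(2)]
      have TY: "0 < S.iTY" using False nonneg by simp
      define c where "c = Max (range (\<lambda>(a, a'). d a a'))"
      have dc: "d a a' \<le> c" for a a' unfolding c_def by (rule Max_ge) (auto intro: image_eqI[of _ _ "(a, a')"])
      have c0: "0 \<le> c" using dc d_nonneg order_trans by blast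
      have cancel: "\<epsilon> / (4 * K) * K = \<epsilon> / 4" if "0 < K" for K using that by simp
      \<comment> \<open>The extra bandwidth: within \<epsilon>, and so small that the additional
        information \<kappa> I(T;Z|Q) given to Eve stays below \<epsilon>/4.\<close>
      define \<kappa> where "\<kappa> = min \<epsilon> (\<epsilon> / (4 * (S.iTZQ + 1)))"
      have \<kappa>: "0 < \<kappa>" "\<kappa> \<le> \<epsilon>" using \<epsilon> nonneg by (auto simp: \<kappa>_def)
      have \<kappa>Z: "\<kappa> * S.iTZQ \<le> \<epsilon> / 4"
      proof -
        have "\<kappa> * S.iTZQ \<le> \<epsilon> / (4 * (S.iTZQ + 1)) * (S.iTZQ + 1)"
          using nonneg \<epsilon> by (intro mult_mono) (auto simp: \<kappa>_def)
        also have "\<dots> = \<epsilon> / 4" using nonneg by (intro cancel) simp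
        finally show ?thesis .
      qed
      define k' where "k' = k + \<kappa>"
      have k': "0 < k'" "k \<le> k'" using k_nonneg \<kappa> by (auto simp: k'_def)
      \<comment> \<open>The first entry is the share of \<epsilon> allotted to typicality, the
        second the decoding slack gained from the extra bandwidth, which is positive because I(T;Y)
        > 0.\<close>
      define \<delta> where "\<delta> = min (\<epsilon> / 4) (\<kappa> * S.iTY) / (7 + 2 * k')"
      have \<delta>: "0 < \<delta>" using \<epsilon> \<kappa> TY k' by (simp add: \<delta>_def)
      have \<delta>min: "(7 + 2 * k') * \<delta> = min (\<epsilon> / 4) (\<kappa> * S.iTY)" using k' by (simp add: \<delta>_def)
      have \<delta>1: "(7 + 2 * k') * \<delta> \<le> (k' - k) * S.iTY" unfolding \<delta>min by (simp add: k'_def)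
      have \<delta>2: "(7 + 2 * k') * \<delta> \<le> \<epsilon> / 4" unfolding \<delta>min by simp
      \<comment> \<open>The tolerance for the block code enters the equivocation directly and the
        distortion with factor c.\<close>
      define \<theta> where "\<theta> = min (\<epsilon> / 4) (\<epsilon> / (4 * (c + 1)))"
      have \<theta>: "0 < \<theta>" "\<theta> \<le> \<epsilon> / 4" unfolding \<theta>_def using \<epsilon> c0 by (simp, intro min.cobounded1)
      have \<theta>c: "c * \<theta> \<le> \<epsilon> / 4"
      proof -
        have "\<theta> * c \<le> \<epsilon> / (4 * (c + 1)) * (c + 1)" using c0 \<epsilon> by (intro mult_mono) (auto simp: \<theta>_def)
        also have "\<dots> = \<epsilon> / 4" using c0 by (intro cancel) simp
        finally show ?thesis by (simp add: mult.commute)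
      qed
      have \<alpha>0: "0 \<le> S.iVA - S.iUA - S.iVBU"
        using cmi_nonneg[OF fin(1), of srcV srcA "\<lambda>w. (srcU w, srcB w)"] unfolding S.source_identities[OF fin(1)] .
      have chain: "S.iVB = iUB + S.iVBU" by (simp add: iUB_def S.source_information[OF fin(1)])
      obtain RS R2 RK where R: "0 \<le> RS" "0 \<le> R2" "0 \<le> RK"
        and cover: "S.iUA + 3 * \<delta> \<le> RS" "S.iVA + 3 * \<delta> \<le> RS + R2"
        and pack: "RS + R2 + RK \<le> S.iVB + k' * S.iTY - (2 + k') * \<delta>"
          "R2 = 0 \<or> R2 + RK \<le> S.iVBU + k' * S.iTYQ - (2 + k') * \<delta>"
        and loss: "RS + max 0 (k' * (S.iTZQ + \<delta>) - RK) \<le> S.iUA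
          + max 0 (S.iVA - S.iUA - S.iVBU - k * (S.iTYQ - S.iTZQ)) + ((5 + 2 * k') * \<delta> + (k' - k) * S.iTZQ)"
        by (rule rate_choice[OF S.source_identities(5,6)[OF fin(1)] nonneg(2,3) \<alpha>0 k_nonneg k'(2) \<delta> chain h1' h2' \<delta>1])
      interpret B: block_coding pU kV kA kBE pQ kT kYZ "\<lambda>v a b. d a (Ahat v b)" k' \<delta> RS R2 RK
        by standard (use \<delta> k' R in auto)
      obtain n enc dec where n: "0 < n" and enc: "\<And>a t. t \<in> set_pmf (enc a) \<Longrightarrow> length t = B.uses n"
        and bad: "B.block_error n enc dec \<le> \<theta>"
        and eqv: "ent S.pAE - RS - S.hEU - \<delta> - max 0 (k' * (S.iTZQ + \<delta>) - RK) - \<theta>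
          \<le> B.block_equivocation n enc / real n"
        by (rule B.block_coding_limit[OF cover pack \<theta>(1)]) (rule that)
      define D' where "D' = pexp S.src B.ddist + \<delta>"
      have "pexp S.src B.ddist \<le> D" using h3' by (simp add: B.ddist_def[abs_def])
      hence D': "D' \<le> D + \<delta>" by (simp add: D'_def)
      have "0 \<le> pexp S.src B.ddist" using d_nonneg by (intro pexp_nonneg) (simp add: B.ddist_def)
      hence D'0: "0 \<le> D'" using \<delta> by (simp add: D'_def)
      have law: "B.block_law n enc = bind_pmf (iid_list n p) (\<lambda>s. bind_pmf (enc (map fst s))
         (\<lambda>t. map_pmf (\<lambda>(y, z). (s, y, z)) (kern_pair (\<lambda>t. bind_pmf (kX t) W) t)))"
        unfolding B.block_law_def unfolding pABE kYZ_def[abs_def] ..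
      have enc_len: "\<forall>a. \<forall>t\<in>set_pmf (enc a). length t = B.uses n" using enc by blast
      note code = achievable_block_code[where p = p and W = W and enc = enc and kX = kX and n = n and d = d
          and c = c and D = D' and \<epsilon> = \<theta> and Ahat = Ahat and dec = dec and m = "B.uses n",
          OF n D'0 enc_len d_nonneg[rule_format] dc bad[unfolded B.block_error_def law B.good_dist_def D'_def[symmetric]]]
      have \<delta>0: "0 \<le> k' * \<delta>" using k' \<delta> by simp
      have rate: "real (B.uses n) / real n \<le> k + \<epsilon>"
      proof -
        have "real (B.uses n) / real n \<le> k'" using B.uses_bounds(1)[of n] n by (simp add: divide_le_eq)
        thus ?thesis using \<kappa> by (simp add: k'_def)
      qed
      have distD: "D' + c * \<theta> \<le> D + \<epsilon>"
        using D' \<theta>c \<delta>2 \<delta>0 \<delta> \<epsilon> by (simp add: algebra_simps)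
      \<comment> \<open>Three shares of \<epsilon>/4 are spent: extra leakage, typicality margins
        and the tolerance \<theta>.\<close>
      have equiv: "\<Delta> - \<epsilon> \<le> B.block_equivocation n enc / real n"
      proof -
        have "(k' - k) * S.iTZQ \<le> \<epsilon> / 4" using \<kappa>Z by (simp add: k'_def)
        moreover have "(5 + 2 * k') * \<delta> + \<delta> \<le> \<epsilon> / 4" using \<delta>2 \<delta> by (simp add: algebra_simps)
        ultimately show ?thesis using eqv h4' loss \<theta>(2) \<epsilon> by linarith
      qed
      show ?thesis
      proof (intro exI conjI)
        show "0 < n" by (rule n)
        show "valid_code n (B.uses n) (\<lambda>as. bind_pmf (enc as) (kern_list kX))
            (\<lambda>ys bs. map (\<lambda>i. Ahat (dec ys bs ! i) (bs ! i)) [0..<length bs])"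
          by (rule code(1))
        show "real (B.uses n) / real n \<le> k + \<epsilon>" by (rule rate)
        show "\<Delta> - \<epsilon> \<le> cond_ent (code_joint n p W (\<lambda>as. bind_pmf (enc as) (kern_list kX))) (\<lambda>(s, xs, ys, zs). map fst s)
         (\<lambda>(s, xs, ys, zs). (map (\<lambda>t. snd (snd t)) s, zs)) / real n"
          using equiv unfolding code(3) B.block_equivocation_def law .
      qed (rule order_trans[OF code(2) distD])
    qed
  qed
qed

end
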